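(* Let $(T,\Sigma,\mu)$ be a complete saturated finite measure space, let $E$ be a separable real Banach space with norm dual $E^*$, and let $\Gamma:T\twoheadrightarrow E^*$ be an integrably bounded multifunction with weakly$^*$ closed values such that $\mathrm{gph}\,\Gamma\in\Sigma\otimes\mathrm{Borel}(E^*,w^* )$. Then $$\int_T\Gamma(t)\,d\mu=\int_T\mathrm{ex}\,\overline{\mathrm{co}}^{\,w^*}\Gamma(t)\,d\mu .$$
   Context: A finite measure space $(T,\Sigma,\mu)$ is saturated if for every $S\in\Sigma$ with $\mu(S)>0$ the space $L^1_S(\mu)$ of $\mu$-integrable functions on $(S,\Sigma_S)$, $\Sigma_S=\{A\cap S: A\in\Sigma\}$, is nonseparable. $\mathrm{Borel}(E^*,w^* )$ is the Borel $\sigma$-algebra of the weak$^*$ topology of $E^*$. A function $f:T\to E^*$ is weakly$^*$ scalarly measurable if $\langle f(\cdot),x\rangle$ is measurable for every $x\in E$ (for separable $E$ this is the same as measurability with respect to $\mathrm{Borel}(E^*,w^* )$). It is Gelfand integrable over $A\in\Sigma$ if it is weakly$^*$ scalarly measurable and there is $x_A^*\in E^*$ with $\langle x_A^*,x\rangle=\int_A\langle f(t),x\rangle d\mu$ for every $x\in E$; then $\int_A f\,d\mu:=x_A^*$ is the Gelfand integral. A multifunction $\Gamma:T\twoheadrightarrow E^*$ is a set-valued map with nonempty values; $\mathrm{gph}\,\Gamma=\{(t,x^* )\in T\times E^*: x^*\in\Gamma(t)\}$. It is integrably bounded if there is $\varphi\in L^1(\mu)$ with $\sup_{x^*\in\Gamma(t)}\|x^*\|\le\varphi(t)$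 for every $t\in T$. $\overline{\mathrm{co}}^{\,w^*}\Gamma(t)$ is the weakly$^*$ closed convex hull of $\Gamma(t)$, and $\mathrm{ex}\,\overline{\mathrm{co}}^{\,w^*}\Gamma(t)$ is the set of its extreme points. A selector of $\Gamma$ is a function $f:T\to E^*$ with $f(t)\in\Gamma(t)$ a.e. The Gelfand integral of a multifunction is $\int_T\Gamma(t)d\mu=\{\int_T f\,d\mu : f \text{ a Gelfand integrable selector of }\Gamma\}$. *)

theory Defs
  imports "HOL-Analysis.Analysis"
begin

(* Elements of L^1 are represented by integrable functions rather than by their
   a.e.-equivalence classes; density refers to the L^1-seminorm, so this does not
   affect separability. *)
definition separable_L1 :: "'a measure \<Rightarrow> bool" where
  "separable_L1 N \<longleftrightarrow>
     (\<exists>D :: ('a \<Rightarrow> real) set. countable D \<and> (\<forall>g\<in>D. integrable N g) \<and>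
        (\<forall>f :: 'a \<Rightarrow> real. integrable N f \<longrightarrow>
           (\<forall>e>0. \<exists>g\<in>D. (\<integral>t. \<bar>f t - g t\<bar> \<partial>N) < e)))"

definition saturated :: "'a measure \<Rightarrow> bool" where
  "saturated M \<longleftrightarrow>
     (\<forall>S\<in>sets M. measure M S > 0 \<longrightarrow> \<not> separable_L1 (restrict_space M S))"

(* For operators into the scalar field the strong operator topology, i.e. the
   topology of pointwise convergence, is the weak-star topology of the dual. *)
abbreviation weak_star :: "('e::real_normed_vector \<Rightarrow>\<^sub>L real) topology" where
  "weak_star \<equiv> strong_operator_topology"

definition borel_weak_star :: "('e::real_normed_vector \<Rightarrow>\<^sub>L real) measure" where
  "borel_weak_star = sigma UNIV {U. openin weak_star U}"

definition weak_star_scalarly_measurable ::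
    "'a measure \<Rightarrow> ('a \<Rightarrow> ('e::real_normed_vector \<Rightarrow>\<^sub>L real)) \<Rightarrow> bool" where
  "weak_star_scalarly_measurable M f \<longleftrightarrow>
     (\<forall>x. (\<lambda>t. blinfun_apply (f t) x) \<in> borel_measurable M)"

(* Integrability is demanded explicitly because the library integral of a
   non-integrable function is 0 by convention. *)
definition has_gelfand_integral ::
    "'a measure \<Rightarrow> 'a set \<Rightarrow> ('a \<Rightarrow> ('e::real_normed_vector \<Rightarrow>\<^sub>L real)) \<Rightarrow>
     ('e \<Rightarrow>\<^sub>L real) \<Rightarrow> bool" where
  "has_gelfand_integral M A f y \<longleftrightarrow>
     weak_star_scalarly_measurable M f \<and>
     (\<forall>x. set_integrable M A (\<lambda>t. blinfun_apply (f t) x) \<and>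
          blinfun_apply y x = (LINT t:A|M. blinfun_apply (f t) x))"

definition gelfand_integrable ::
    "'a measure \<Rightarrow> 'a set \<Rightarrow> ('a \<Rightarrow> ('e::real_normed_vector \<Rightarrow>\<^sub>L real)) \<Rightarrow> bool" where
  "gelfand_integrable M A f \<longleftrightarrow> (\<exists>y. has_gelfand_integral M A f y)"

definition gelfand_integral ::
    "'a measure \<Rightarrow> 'a set \<Rightarrow> ('a \<Rightarrow> ('e::real_normed_vector \<Rightarrow>\<^sub>L real)) \<Rightarrow>
     ('e \<Rightarrow>\<^sub>L real)" where
  "gelfand_integral M A f = (THE y. has_gelfand_integral M A f y)"

lemma has_gelfand_integral_unique:
  assumes "has_gelfand_integral M A f y" and "has_gelfand_integral M A f z"
  shows "y = z"
  using assms unfolding has_gelfand_integral_def by (intro blinfun_eqI) simp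

lemma gelfand_integral_eqI:
  "has_gelfand_integral M A f y \<Longrightarrow> gelfand_integral M A f = y"
  unfolding gelfand_integral_def by (blast intro: the_equality has_gelfand_integral_unique)

(* A multifunction is a set-valued map on the whole type; only its values on
   space M matter. *)
definition multifunction ::
    "'a measure \<Rightarrow> ('a \<Rightarrow> ('e::real_normed_vector \<Rightarrow>\<^sub>L real) set) \<Rightarrow> bool" where
  "multifunction M \<Gamma> \<longleftrightarrow> (\<forall>t\<in>space M. \<Gamma> t \<noteq> {})"

definition gph ::
    "'a measure \<Rightarrow> ('a \<Rightarrow> ('e::real_normed_vector \<Rightarrow>\<^sub>L real) set) \<Rightarrow>
     ('a \<times> ('e \<Rightarrow>\<^sub>L real)) set" where
  "gph M \<Gamma> = {(t, y). t \<in> space M \<and> y \<in> \<Gamma> t}"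

definition integrably_bounded ::
    "'a measure \<Rightarrow> ('a \<Rightarrow> ('e::real_normed_vector \<Rightarrow>\<^sub>L real) set) \<Rightarrow> bool" where
  "integrably_bounded M \<Gamma> \<longleftrightarrow>
     (\<exists>\<phi> :: 'a \<Rightarrow> real. integrable M \<phi> \<and> (\<forall>t\<in>space M. \<forall>y\<in>\<Gamma> t. norm y \<le> \<phi> t))"

definition selector ::
    "'a measure \<Rightarrow> ('a \<Rightarrow> ('e::real_normed_vector \<Rightarrow>\<^sub>L real) set) \<Rightarrow>
     ('a \<Rightarrow> ('e \<Rightarrow>\<^sub>L real)) \<Rightarrow> bool" where
  "selector M \<Gamma> f \<longleftrightarrow> (AE t in M. f t \<in> \<Gamma> t)"

definition multifunction_integral ::
    "'a measure \<Rightarrow> ('a \<Rightarrow> ('e::real_normed_vector \<Rightarrow>\<^sub>L real) set) \<Rightarrow>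
     ('e \<Rightarrow>\<^sub>L real) set" where
  "multifunction_integral M \<Gamma> =
     {gelfand_integral M (space M) f | f. selector M \<Gamma> f \<and> gelfand_integrable M (space M) f}"

definition weak_star_closed_convex_hull ::
    "('e::real_normed_vector \<Rightarrow>\<^sub>L real) set \<Rightarrow> ('e \<Rightarrow>\<^sub>L real) set" where
  "weak_star_closed_convex_hull C = weak_star closure_of (convex hull C)"

definition extreme_points :: "'v::real_vector set \<Rightarrow> 'v set" where
  "extreme_points C = {x. x extreme_point_of C}"

end

theory Submission
  imports Defs "HOL-Probability.Probability"
begin

text \<open>
  Since \<open>\<Gamma> t\<close> is weak-star compact, extreme points of its closed convex hull \<open>K t\<close> lie in \<open>\<Gamma> t\<close>
  (Milman), which gives one inclusion.  For the other, fix a selection of \<open>\<Gamma>\<close> with integral \<open>y\<close> and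
  consider the convex set of all selections of \<open>K\<close> with integral \<open>y\<close>.  It has an extreme point \<open>h\<close>:
  embedding the values into a Hilbert space, a variational principle provides a point of this
  closed bounded set at which a small perturbation of the squared norm is maximal.  If \<open>h t\<close> were not
  extreme in \<open>K t\<close> on a set of positive measure, measurable selection would give a set \<open>A\<close> of positive
  measure and a measurable \<open>w\<close>, nonzero exactly on \<open>A\<close>, with \<open>h t \<plusminus> w t \<in> K t\<close>.  The coordinates of \<open>w\<close> generate a
  sub-\<open>\<sigma>\<close>-algebra with separable \<open>L\<^sup>1\<close>, so by saturation it misses a measurable subset of \<open>A\<close>, and an
  indicator minus its conditional expectation is a nonzero \<open>\<psi>\<close> with \<open>\<bar>\<psi>\<bar> \<le> 1\<close> and \<open>\<integral> \<psi> w = 0\<close>.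
  Then \<open>h \<plusminus> \<psi> w\<close> contradicts the extremality of \<open>h\<close>.
\<close>

section \<open>Measurable projection and selection\<close>

text \<open>The coordinates \<open>coord u m\<close> are the values of \<open>u\<close> at points
  \<open>z m\<close> whose positive multiples are dense in \<open>E\<close>, with
  \<open>norm (z m)\<close> at most 2^-m. They make bounded weak-star closed sets compact in a
  countable product of lines, they are square summable, which gives the Hilbert structure, and, the
  multiples being positive, the half-spaces \<open>coord v m \<le> c\<close> alone cut out a closed
  hull. Membership in \<open>K t\<close> thus becomes countably many inequalities whose right-hand
  sides are suprema over \<open>\<Gamma> t\<close>. Those suprema are the reason for the projection
  theorem: the graph is only known to be product measurable, and the superlevel sets of a supremum
  over its sections are projections. Completeness of the measure enters there. The set of selections
  is convex, bounded and complete for the energy but need not be compact for it, so a strictly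
  convex functional may fail to attain its maximum. This is the obstacle that the variational
  principle removes; its perturbation must be so small that strict convexity survives.\<close>

definition suslin_scheme :: "'b set set \<Rightarrow> (nat \<Rightarrow> (nat \<Rightarrow> nat) \<Rightarrow> 'b set) \<Rightarrow> bool" where
  "suslin_scheme \<C> R \<longleftrightarrow> (\<forall>n \<sigma>. R n \<sigma> \<in> \<C>) \<and>
     (\<forall>n \<sigma> \<tau>. (\<forall>i<n. \<sigma> i = \<tau> i) \<longrightarrow> R n \<sigma> = R n \<tau>)"

text \<open>Suslin's operation A. Level n of a scheme sees only the first n entries of a branch, so
  a scheme is a family indexed by finite sequences; whole branches stand in for finite lists. The
  sets along a branch need not decrease.\<close>

definition suslin_op :: "(nat \<Rightarrow> (nat \<Rightarrow> nat) \<Rightarrow> 'b set) \<Rightarrow> 'b set" where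
  "suslin_op R = (\<Union>\<sigma>. \<Inter>n. R n \<sigma>)"

lemma suslin_schemeD:
  assumes "suslin_scheme \<C> R"
  shows "R n \<sigma> \<in> \<C>" and "(\<And>i. i < n \<Longrightarrow> \<sigma> i = \<tau> i) \<Longrightarrow> R n \<sigma> = R n \<tau>"
  using assms unfolding suslin_scheme_def by blast+

lemma mem_suslin_op: "p \<in> suslin_op R \<longleftrightarrow> (\<exists>\<sigma>. \<forall>n. p \<in> R n \<sigma>)"
  unfolding suslin_op_def by auto

text \<open>Koenig's lemma: prefixes bounded by \<open>b\<close> form a finitely branching tree with
  nodes at every level.\<close>

lemma bounded_branch_exists:
  fixes D :: "nat \<Rightarrow> (nat \<Rightarrow> nat) \<Rightarrow> 'b set"
  assumes mono: "\<And>m n \<sigma>. m \<le> n \<Longrightarrow> D n \<sigma> \<subseteq> D m \<sigma>"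
    and loc: "\<And>n \<sigma> \<tau>. (\<And>i. i < n \<Longrightarrow> \<sigma> i = \<tau> i) \<Longrightarrow> D n \<sigma> = D n \<tau>"
    and ex: "\<And>k. \<exists>\<sigma>. (\<forall>i<k. \<sigma> i \<le> b i) \<and> p \<in> D k \<sigma>"
  shows "\<exists>\<sigma>. \<forall>n. p \<in> D n \<sigma>"
proof -
  \<comment> \<open>The prefix of length k extends to bounded branches that contain \<open>p\<close>
    at arbitrarily high levels; this is what survives one more step.\<close>
  define P where "P k \<sigma> \<longleftrightarrow> (\<forall>m\<ge>k. \<exists>\<sigma>'. (\<forall>i<k. \<sigma>' i = \<sigma> i) \<and> (\<forall>i<m. \<sigma>' i \<le> b i) \<and> p \<in> D m \<sigma>')"
    for k and \<sigma> :: "nat \<Rightarrow> nat"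
  have P0: "P 0 \<sigma>" for \<sigma> using ex by (auto simp: P_def)
  have step: "\<exists>v. P (Suc k) (\<sigma>(k := v))" if P: "P k \<sigma>" for k \<sigma>
  proof (rule ccontr)
    assume "\<nexists>v. P (Suc k) (\<sigma>(k := v))"
    then have "\<forall>v. \<exists>m\<ge>Suc k. \<not> (\<exists>\<sigma>'. (\<forall>i<Suc k. \<sigma>' i = (\<sigma>(k := v)) i) \<and> (\<forall>i<m. \<sigma>' i \<le> b i) \<and> p \<in> D m \<sigma>')"
      unfolding P_def by blast
    then obtain m where m: "\<And>v. m v \<ge> Suc k"
      "\<And>v \<sigma>'. (\<forall>i<Suc k. \<sigma>' i = (\<sigma>(k := v)) i) \<Longrightarrow> (\<forall>i<m v. \<sigma>' i \<le> b i) \<Longrightarrow> p \<notin> D (m v) \<sigma>'"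
      by metis
    \<comment> \<open>Each of the finitely many values \<open>v \<le> b k\<close> would fail from
      some level on. At the largest of these levels a good extension still exists, and its own entry
      at k is one of the values.\<close>
    define N where "N = Max (m ` {..b k})"
    have mN: "m v \<le> N" if "v \<le> b k" for v
      unfolding N_def using that by (intro Max_ge) auto
    have "Suc k \<le> N" using m(1)[of 0] mN[of 0] by simp
    then obtain \<sigma>' where s: "\<forall>i<k. \<sigma>' i = \<sigma> i" "\<forall>i<N. \<sigma>' i \<le> b i" "p \<in> D N \<sigma>'"
      using P unfolding P_def by (metis Suc_leD)
    have v: "\<sigma>' k \<le> b k" using s(2) \<open>Suc k \<le> N\<close> by simp
    have "p \<notin> D (m (\<sigma>' k)) \<sigma>'"
      using s mN[OF v] by (intro m(2)) (auto simp: less_Suc_eq)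
    moreover have "p \<in> D (m (\<sigma>' k)) \<sigma>'"
      using mono[OF mN[OF v]] s(3) by blast
    ultimately show False by simp
  qed
  then obtain v where v: "\<And>k \<sigma>. P k \<sigma> \<Longrightarrow> P (Suc k) (\<sigma>(k := v k \<sigma>))" by metis
  \<comment> \<open>Stage k changes entry k only, so the diagonal \<open>f (Suc i) i\<close> agrees
    with \<open>f n\<close> below n. The same device returns in later recursions.\<close>
  define f where "f = rec_nat (\<lambda>_. 0) (\<lambda>k \<sigma>. \<sigma>(k := v k \<sigma>))"
  have f: "f (Suc k) = (f k)(k := v k (f k))" for k by (simp add: f_def)
  have Pf: "P k (f k)" for k
  proof (induction k)
    case (Suc k)
    then show ?case unfolding f by (rule v)
  qed (rule P0)
  define \<sigma> where "\<sigma> i = f (Suc i) i" for i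
  have agree: "f (Suc (i + j)) i = \<sigma> i" for i j
    by (induction j) (auto simp: \<sigma>_def f)
  have "f n i = \<sigma> i" if "i < n" for i n
    using agree[of i "n - Suc i"] that by simp
  then have "p \<in> D n \<sigma>" for n
    using Pf[of n] loc[of n] unfolding P_def by (metis order_refl)
  then show ?thesis by blast
qed

text \<open>Lusin--Sierpinski: the outer measure is continuous along increasing sequences, so the branches
  can be bounded one coordinate at a time at no cost, and a tree with bounded branches is compact.\<close>

lemma sets_suslin_op:
  assumes fin: "finite_measure M" and compl: "complete_measure M"
    and R: "suslin_scheme (sets M) R"
  shows "suslin_op R \<in> sets M"
proof -
  interpret finite_measure M by fact
  interpret complete_measure M by fact
  define A where "A = suslin_op R"
  define D where "D n \<sigma> = (\<Inter>k\<le>n. R k \<sigma>)" for n \<sigma>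
  have D_sets: "D n \<sigma> \<in> sets M" for n \<sigma>
    unfolding D_def using suslin_schemeD(1)[OF R] by (intro sets.finite_INT) auto
  have D_mono: "m \<le> n \<Longrightarrow> D n \<sigma> \<subseteq> D m \<sigma>" for m n \<sigma>
    unfolding D_def by (meson INF_superset_mono atMost_subset_iff order_refl)
  have D_loc: "D n \<sigma> = D n \<tau>" if "\<And>i. i < n \<Longrightarrow> \<sigma> i = \<tau> i" for n \<sigma> \<tau>
    unfolding D_def by (intro INF_cong refl suslin_schemeD(2)[OF R] that) auto
  \<comment> \<open>\<open>P k b\<close> is the part of \<open>A\<close> reached by branches whose
    first k entries are at most \<open>b\<close>; its measurability is unknown, hence the outer
    measure. \<open>C k b\<close> is a measurable superset that forgets all levels beyond k; up to
    that level only finitely many prefixes matter.\<close>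
  define P where "P k b = {p. \<exists>\<sigma>. (\<forall>i<k. \<sigma> i \<le> b i) \<and> (\<forall>n. p \<in> R n \<sigma>)}" for k and b :: "nat \<Rightarrow> nat"
  define C where "C k b = (\<Union>\<sigma>\<in>PiE {..<k} (\<lambda>i. {..b i}). D k \<sigma>)" for k b
  have C_sets: "C k b \<in> sets M" for k b
    unfolding C_def by (intro sets.finite_UN finite_PiE D_sets) auto
  have C_iff: "p \<in> C k b \<longleftrightarrow> (\<exists>\<sigma>. (\<forall>i<k. \<sigma> i \<le> b i) \<and> p \<in> D k \<sigma>)" for p k b
  proof
    assume "\<exists>\<sigma>. (\<forall>i<k. \<sigma> i \<le> b i) \<and> p \<in> D k \<sigma>"
    then obtain \<sigma> where s: "\<forall>i<k. \<sigma> i \<le> b i" "p \<in> D k \<sigma>" by blast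
    have "p \<in> D k (restrict \<sigma> {..<k})"
      using s(2) D_loc[of k \<sigma> "restrict \<sigma> {..<k}"] by auto
    moreover have "restrict \<sigma> {..<k} \<in> PiE {..<k} (\<lambda>i. {..b i})" using s(1) by auto
    ultimately show "p \<in> C k b" unfolding C_def by blast
  qed (auto simp: C_def PiE_iff)
  have PC: "P k b \<subseteq> C k b" for k b
    unfolding P_def D_def subset_iff C_iff by (auto simp: D_def)
  have A_space: "A \<subseteq> space M"
    unfolding A_def subset_iff mem_suslin_op using suslin_schemeD(1)[OF R, THEN sets.sets_into_space] by blast
  have PA: "P k b \<subseteq> A" for k b
    unfolding P_def A_def subset_iff mem_suslin_op by blast
  have P0: "P 0 b = A" for b unfolding P_def A_def set_eq_iff mem_suslin_op by simp
  have P_step: "\<exists>v. c < outer_measure_of M (P (Suc k) (b(k := v)))" if c: "c < outer_measure_of M (P k b)" for c k b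
  proof -
    have un: "(\<Union>v. P (Suc k) (b(k := v))) = P k b"
    proof (intro subset_antisym subsetI)
      fix p assume "p \<in> P k b"
      then obtain \<sigma> where "\<forall>i<k. \<sigma> i \<le> b i" "\<forall>n. p \<in> R n \<sigma>" unfolding P_def by blast
      then have "p \<in> P (Suc k) (b(k := \<sigma> k))" unfolding P_def by (auto simp: less_Suc_eq)
      then show "p \<in> (\<Union>v. P (Suc k) (b(k := v)))" by blast
    next
      fix p assume "p \<in> (\<Union>v. P (Suc k) (b(k := v)))"
      then obtain v \<sigma> where s: "\<forall>i<Suc k. \<sigma> i \<le> (b(k := v)) i" "\<forall>n. p \<in> R n \<sigma>" unfolding P_def by blast
      have "\<sigma> i \<le> b i" if "i < k" for i using s(1)[rule_format, of i] that by simp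
      then show "p \<in> P k b" unfolding P_def using s(2) by blast
    qed
    have "incseq (\<lambda>v. P (Suc k) (b(k := v)))"
      unfolding incseq_def
    proof (intro allI impI subsetI)
      fix v w :: nat and p assume vw: "v \<le> w" and "p \<in> P (Suc k) (b(k := v))"
      then obtain \<sigma> where s: "\<forall>i<Suc k. \<sigma> i \<le> (b(k := v)) i" "\<forall>n. p \<in> R n \<sigma>" unfolding P_def by blast
      have "\<sigma> i \<le> (b(k := w)) i" if "i < Suc k" for i
        using s(1)[rule_format, of i] that vw by (cases "i = k") auto
      then show "p \<in> P (Suc k) (b(k := w))" unfolding P_def using s(2) by blast
    qed
    then have "(SUP v. outer_measure_of M (P (Suc k) (b(k := v)))) = outer_measure_of M (P k b)"
      using SUP_outer_measure_of_incseq[of "\<lambda>v. P (Suc k) (b(k := v))" M] PA A_space un by (metis order_trans)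
    then show ?thesis using c by (metis less_SUP_iff UNIV_I)
  qed
  \<comment> \<open>Choosing the bounds one by one keeps the outer measure of every
    \<open>P k b\<close> above c, so the decreasing sets \<open>C k b\<close> have measure at least
    c, and so has their intersection. By \<open>bounded_branch_exists\<close> that intersection lies
    inside \<open>A\<close>.\<close>
  have inner: "\<exists>B\<in>sets M. B \<subseteq> A \<and> c \<le> emeasure M B" if c: "c < outer_measure_of M A" for c
  proof -
    obtain v where v: "\<And>k b. c < outer_measure_of M (P k b) \<Longrightarrow> c < outer_measure_of M (P (Suc k) (b(k := v k b)))"
      using P_step by metis
    define f where "f = rec_nat (\<lambda>_. 0) (\<lambda>k b. b(k := v k b))"
    have f: "f (Suc k) = (f k)(k := v k (f k))" for k by (simp add: f_def)
    have cf: "c < outer_measure_of M (P k (f k))" for k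
    proof (induction k)
      case (Suc k)
      then show ?case unfolding f by (rule v)
    qed (simp add: P0 c)
    define b where "b i = f (Suc i) i" for i
    have agree: "f (Suc (i + j)) i = b i" for i j
      by (induction j) (auto simp: b_def f)
    have fb: "f n i = b i" if "i < n" for i n
      using agree[of i "n - Suc i"] that by simp
    have "P k (f k) = P k b" for k unfolding P_def using fb by auto
    then have cP: "c < outer_measure_of M (P k b)" for k using cf by simp
    define B where "B = (\<Inter>k. C k b)"
    have dec: "decseq (\<lambda>k. C k b)"
    proof (intro decseq_SucI subsetI)
      fix k p assume "p \<in> C (Suc k) b"
      then obtain \<sigma> where s: "\<forall>i<Suc k. \<sigma> i \<le> b i" "p \<in> D (Suc k) \<sigma>" unfolding C_iff by blast
      have "p \<in> D k \<sigma>" using D_mono[of k "Suc k" \<sigma>] s(2) by auto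
      then show "p \<in> C k b" unfolding C_iff using s(1) less_SucI by blast
    qed
    have "B \<subseteq> A"
    proof
      fix p assume "p \<in> B"
      then have "\<exists>\<sigma>. (\<forall>i<k. \<sigma> i \<le> b i) \<and> p \<in> D k \<sigma>" for k
        unfolding B_def using C_iff by blast
      from bounded_branch_exists[OF D_mono D_loc this] obtain \<sigma> where "\<forall>n. p \<in> D n \<sigma>" by blast
      then show "p \<in> A" unfolding A_def mem_suslin_op D_def by blast
    qed
    moreover have "c \<le> emeasure M (C k b)" for k
      using cP[of k] outer_measure_of_mono[OF PC[of k b], of M] C_sets[of k b] by simp
    then have "c \<le> (INF k. emeasure M (C k b))" by (intro INF_greatest)
    then have "c \<le> emeasure M B"
      unfolding B_def using INF_emeasure_decseq[OF _ dec] C_sets by (simp add: image_subset_iff)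
    moreover have "B \<in> sets M" unfolding B_def using C_sets by auto
    ultimately show ?thesis by blast
  qed
  obtain E where E: "E \<in> sets M" "A \<subseteq> E" "outer_measure_of M A = emeasure M E"
    using outer_measure_of_attain[OF A_space] by blast
  define r where "r = measure M E"
  have r: "outer_measure_of M A = ennreal r" by (simp add: E r_def emeasure_eq_measure)
  \<comment> \<open>The inner sets exhaust the measure r of the measurable hull \<open>E\<close>.
    Their union \<open>U\<close> satisfies \<open>U \<subseteq> A \<subseteq> E\<close> with
    \<open>E - U\<close> null, and completeness makes \<open>A - U\<close> measurable. The case r =
    0 is apart because then no c lies strictly below r.\<close>
  have "\<exists>B\<in>sets M. B \<subseteq> A \<and> r - r / real (Suc n) \<le> measure M B" for n
  proof (cases "r = 0")
    case True
    then show ?thesis by (intro bexI[of _ "{}"]) auto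
  next
    case False
    then have "r > 0" using measure_nonneg[of M E] by (simp add: r_def less_le)
    then have "ennreal (r - r / real (Suc n)) < ennreal r"
      by (intro ennreal_lessI) (auto simp: field_simps)
    from inner[OF this[folded r]] show ?thesis
      by (auto simp: emeasure_eq_measure)
  qed
  then obtain B where B: "\<And>n. B n \<in> sets M" "\<And>n. B n \<subseteq> A" "\<And>n. r - r / real (Suc n) \<le> measure M (B n)"
    by metis
  define U where "U = (\<Union>n. B n)"
  have U: "U \<in> sets M" "U \<subseteq> A" using B by (auto simp: U_def)
  have "r - r / real (Suc n) \<le> measure M U" for n
    using B(3)[of n] finite_measure_mono[of "B n" U] U by (force simp: U_def)
  moreover have "(\<lambda>n. r - r / real (Suc n)) \<longlonglongrightarrow> r - 0"
    by (intro tendsto_diff tendsto_const LIMSEQ_Suc lim_const_over_n)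
  ultimately have "r \<le> measure M U" by (intro LIMSEQ_le_const2[of _ "r"]) auto
  then have "measure M (E - U) \<le> 0"
    using finite_measure_Diff[OF E(1) U(1)] U E by (simp add: r_def)
  then have "E - U \<in> null_sets M"
    using E U by (auto simp: null_sets_def emeasure_eq_measure measure_le_0_iff)
  then have "A - U \<in> sets M" using E by (intro complete[of "A - U" "E - U"]) auto
  then have "U \<union> (A - U) \<in> sets M" using U by blast
  then show ?thesis using U by (simp add: A_def Un_absorb1)
qed

section \<open>Suslin sets, their closure properties, and product measurable sets\<close>

definition suslin_sets :: "'b set set \<Rightarrow> 'b set set" where
  "suslin_sets \<C> = {suslin_op R | R. suslin_scheme \<C> R}"

lemma subset_suslin_sets: "\<C> \<subseteq> suslin_sets \<C>"
proof
  fix c assume "c \<in> \<C>"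
  then have "suslin_scheme \<C> (\<lambda>n \<sigma>. c)" "c = suslin_op (\<lambda>n \<sigma>. c)"
    by (auto simp: suslin_scheme_def suslin_op_def)
  then show "c \<in> suslin_sets \<C>" unfolding suslin_sets_def by blast
qed

lemma prod_encode_less: "k < n \<Longrightarrow> prod_encode (i, k) < prod_encode (i, n)"
proof -
  have "triangle a < triangle b" if "a < b" for a b
    using that by (induction rule: strict_inc_induct) (auto simp: triangle_Suc)
  then show "k < n \<Longrightarrow> ?thesis" by (simp add: prod_encode_def)
qed

lemma suslin_sets_INT:
  fixes A :: "nat \<Rightarrow> 'b set"
  assumes "\<And>i. A i \<in> suslin_sets \<C>"
  shows "(\<Inter>i. A i) \<in> suslin_sets \<C>"
proof -
  have "\<forall>i. \<exists>R. suslin_scheme \<C> R \<and> A i = suslin_op R"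
    using assms unfolding suslin_sets_def by blast
  then obtain R where R: "\<And>i. suslin_scheme \<C> (R i)" "\<And>i. A i = suslin_op (R i)" by metis
  \<comment> \<open>All branches are interleaved into one: entry k of the i-th branch sits at
    \<open>prod_encode (i, k)\<close>, and level \<open>prod_encode (i, n)\<close> tests level n of
    the i-th scheme. By \<open>prod_encode_less\<close> the entries needed there have smaller index
    than the level, which is the locality of the merged scheme.\<close>
  define Q where "Q m \<tau> = (case prod_decode m of (i, n) \<Rightarrow> R i n (\<lambda>k. \<tau> (prod_encode (i, k))))"
    for m and \<tau> :: "nat \<Rightarrow> nat"
  have "suslin_scheme \<C> Q"
    unfolding suslin_scheme_def
  proof (intro conjI allI impI)
    fix m \<tau> show "Q m \<tau> \<in> \<C>"
      unfolding Q_def using suslin_schemeD(1)[OF R(1)] by (auto split: prod.split)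
  next
    fix m and \<sigma> \<tau> :: "nat \<Rightarrow> nat" assume eq: "\<forall>i<m. \<sigma> i = \<tau> i"
    obtain i n where m: "m = prod_encode (i, n)" by (metis prod_decode_inverse surj_pair)
    show "Q m \<sigma> = Q m \<tau>"
      unfolding Q_def m using eq prod_encode_less[of _ n i] by (auto simp: m intro!: suslin_schemeD(2)[OF R(1)])
  qed
  moreover have "(\<Inter>i. A i) = suslin_op Q"
  proof (intro set_eqI)
    fix p
    have "p \<in> suslin_op Q \<longleftrightarrow> (\<exists>\<tau>. \<forall>i n. p \<in> R i n (\<lambda>k. \<tau> (prod_encode (i, k))))"
    proof -
      have "(\<forall>m. p \<in> Q m \<tau>) \<longleftrightarrow> (\<forall>i n. p \<in> R i n (\<lambda>k. \<tau> (prod_encode (i, k))))" for \<tau>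
      proof (intro iffI allI)
        fix i n assume h: "\<forall>m. p \<in> Q m \<tau>"
        show "p \<in> R i n (\<lambda>k. \<tau> (prod_encode (i, k)))"
          using h[rule_format, of "prod_encode (i, n)"] by (simp add: Q_def)
      next
        fix m assume "\<forall>i n. p \<in> R i n (\<lambda>k. \<tau> (prod_encode (i, k)))"
        then show "p \<in> Q m \<tau>" by (auto simp: Q_def split: prod.split)
      qed
      then show ?thesis by (simp add: mem_suslin_op)
    qed
    also have "\<dots> \<longleftrightarrow> (\<forall>i. \<exists>\<sigma>. \<forall>n. p \<in> R i n \<sigma>)"
    proof
      assume "\<forall>i. \<exists>\<sigma>. \<forall>n. p \<in> R i n \<sigma>"
      then obtain s where s: "\<And>i n. p \<in> R i n (s i)" by metis
      have "(\<lambda>k. (\<lambda>m. case prod_decode m of (i, k) \<Rightarrow> s i k) (prod_encode (i, k))) = s i" for i by simp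
      then show "\<exists>\<tau>. \<forall>i n. p \<in> R i n (\<lambda>k. \<tau> (prod_encode (i, k)))"
        using s by (intro exI[of _ "\<lambda>m. case prod_decode m of (i, k) \<Rightarrow> s i k"]) auto
    qed blast
    finally show "p \<in> (\<Inter>i. A i) \<longleftrightarrow> p \<in> suslin_op Q" by (simp add: R(2) mem_suslin_op)
  qed
  ultimately show ?thesis unfolding suslin_sets_def by blast
qed

lemma suslin_sets_UN:
  fixes A :: "nat \<Rightarrow> 'b set"
  assumes "\<And>i. A i \<in> suslin_sets \<C>" and \<Omega>: "\<Omega> \<in> \<C>" "\<And>c. c \<in> \<C> \<Longrightarrow> c \<subseteq> \<Omega>"
  shows "(\<Union>i. A i) \<in> suslin_sets \<C>"
proof -
  have "\<forall>i. \<exists>R. suslin_scheme \<C> R \<and> A i = suslin_op R"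
    using assms unfolding suslin_sets_def by blast
  then obtain R where R: "\<And>i. suslin_scheme \<C> (R i)" "\<And>i. A i = suslin_op (R i)" by metis
  \<comment> \<open>Entry 0 of the branch names the set of the union, the rest is a branch of its
    scheme. Level 0 sees no entry and can only be the common superset \<open>\<Omega>\<close>; hence
    the shift by one.\<close>
  define Q where "Q m \<tau> = (case m of 0 \<Rightarrow> \<Omega> | Suc n \<Rightarrow> R (\<tau> 0) n (\<lambda>k. \<tau> (Suc k)))"
    for m and \<tau> :: "nat \<Rightarrow> nat"
  have "suslin_scheme \<C> Q"
    unfolding suslin_scheme_def
  proof (intro conjI allI impI)
    fix m \<tau> show "Q m \<tau> \<in> \<C>"
      unfolding Q_def using suslin_schemeD(1)[OF R(1)] \<Omega> by (auto split: nat.split)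
  next
    fix m and \<sigma> \<tau> :: "nat \<Rightarrow> nat" assume eq: "\<forall>i<m. \<sigma> i = \<tau> i"
    show "Q m \<sigma> = Q m \<tau>"
    proof (cases m)
      case (Suc n)
      then have "\<sigma> 0 = \<tau> 0" using eq by simp
      moreover have "R (\<tau> 0) n (\<lambda>k. \<sigma> (Suc k)) = R (\<tau> 0) n (\<lambda>k. \<tau> (Suc k))"
        using eq Suc by (intro suslin_schemeD(2)[OF R(1)]) auto
      ultimately show ?thesis by (simp add: Q_def Suc)
    qed (simp add: Q_def)
  qed
  moreover have "(\<Union>i. A i) = suslin_op Q"
  proof (intro set_eqI)
    fix p
    have "p \<in> (\<Union>i. A i) \<longleftrightarrow> (\<exists>i \<sigma>. \<forall>n. p \<in> R i n \<sigma>)" by (simp add: R(2) mem_suslin_op)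
    also have "\<dots> \<longleftrightarrow> (\<exists>\<tau>. \<forall>n. p \<in> R (\<tau> 0) n (\<lambda>k. \<tau> (Suc k)))"
    proof
      assume "\<exists>i \<sigma>. \<forall>n. p \<in> R i n \<sigma>"
      then obtain i \<sigma> where "\<forall>n. p \<in> R i n \<sigma>" by blast
      then show "\<exists>\<tau>. \<forall>n. p \<in> R (\<tau> 0) n (\<lambda>k. \<tau> (Suc k))"
        by (intro exI[of _ "case_nat i \<sigma>"]) auto
    qed blast
    also have "\<dots> \<longleftrightarrow> (\<exists>\<tau>. \<forall>n. p \<in> Q n \<tau>)"
    proof -
      have "(\<forall>n. p \<in> R (\<tau> 0) n (\<lambda>k. \<tau> (Suc k))) \<longleftrightarrow> (\<forall>n. p \<in> Q n \<tau>)" for \<tau>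
      proof
        assume h: "\<forall>n. p \<in> R (\<tau> 0) n (\<lambda>k. \<tau> (Suc k))"
        then have "p \<in> \<Omega>" using \<Omega>(2) suslin_schemeD(1)[OF R(1)] by blast
        then show "\<forall>n. p \<in> Q n \<tau>" using h by (auto simp: Q_def split: nat.split)
      next
        assume h: "\<forall>n. p \<in> Q n \<tau>"
        show "\<forall>n. p \<in> R (\<tau> 0) n (\<lambda>k. \<tau> (Suc k))"
        proof
          fix n show "p \<in> R (\<tau> 0) n (\<lambda>k. \<tau> (Suc k))" using h[rule_format, of "Suc n"] by (simp add: Q_def)
        qed
      qed
      then show ?thesis by simp
    qed
    finally show "p \<in> (\<Union>i. A i) \<longleftrightarrow> p \<in> suslin_op Q" by (simp add: mem_suslin_op)
  qed
  ultimately show ?thesis unfolding suslin_sets_def by blast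
qed

text \<open>The closed sets are level sets of the distance to the complement. The whole space is
  treated apart, since \<open>infdist\<close> to the empty set is 0 by convention.\<close>

lemma open_eq_UN_closed:
  fixes U :: "'b::metric_space set"
  assumes "open U"
  shows "\<exists>F :: nat \<Rightarrow> 'b set. (\<forall>n. closed (F n)) \<and> U = (\<Union>n. F n)"
proof (cases "U = UNIV")
  case True
  then show ?thesis by (intro exI[of _ "\<lambda>_. UNIV"]) auto
next
  case False
  define F where "F n = {x. 1 / real (Suc n) \<le> infdist x (- U)}" for n
  have "closed (F n)" for n
    unfolding F_def by (intro closed_Collect_le continuous_intros)
  moreover have "U = (\<Union>n. F n)"
  proof (intro set_eqI iffI)
    fix x assume "x \<in> U"
    then have "infdist x (- U) \<noteq> 0"
      using in_closed_iff_infdist_zero[of "- U" x] assms False by auto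
    then have "infdist x (- U) > 0" using infdist_nonneg[of x "- U"] by linarith
    then obtain n where "1 / real (Suc n) < infdist x (- U)" using nat_approx_posE by metis
    then show "x \<in> (\<Union>n. F n)" unfolding F_def by (auto intro!: exI[of _ n])
  next
    fix x assume "x \<in> (\<Union>n. F n)"
    then obtain n where "1 / real (Suc n) \<le> infdist x (- U)" by (auto simp: F_def)
    then have "infdist x (- U) \<noteq> 0" by (smt (verit) of_nat_0_less_iff zero_less_Suc zero_less_divide_1_iff)
    then show "x \<in> U" by (metis ComplI infdist_zero)
  qed
  ultimately show ?thesis by blast
qed

definition closed_rectangles :: "'a measure \<Rightarrow> ('a \<times> 'b::topological_space) set set" where
  "closed_rectangles M = {S \<times> F | S F. S \<in> sets M \<and> closed F}"

text \<open>Suslin sets are closed under countable unions and intersections but not under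
  complements. Both inductions over the generated algebra therefore carry a set together with its
  complement; the complement of a closed set is covered because it is a countable union of closed
  sets.\<close>

lemma sets_pair_subset_suslin:
  fixes M :: "'a measure"
  shows "sets (M \<Otimes>\<^sub>M (borel :: 'b::metric_space measure)) \<subseteq> suslin_sets (closed_rectangles M)"
proof
  let ?\<C> = "closed_rectangles M :: ('a \<times> 'b) set set"
  let ?S = "suslin_sets ?\<C>"
  let ?\<Omega> = "space M \<times> (UNIV :: 'b set)"
  have rect: "S \<times> F \<in> ?S" if "S \<in> sets M" "closed F" for S and F :: "'b set"
    using that subset_suslin_sets[of ?\<C>] unfolding closed_rectangles_def by blast
  have \<Omega>: "?\<Omega> \<in> ?\<C>" unfolding closed_rectangles_def using sets.top by blast
  have \<Omega>': "c \<subseteq> ?\<Omega>" if "c \<in> ?\<C>" for c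
    using that unfolding closed_rectangles_def using sets.sets_into_space by blast
  note UN = suslin_sets_UN[OF _ \<Omega> \<Omega>']
  have Un: "A \<union> B \<in> ?S" if "A \<in> ?S" "B \<in> ?S" for A B
  proof -
    have "(\<Union>i::nat. if i = 0 then A else B) \<in> ?S" by (rule UN) (use that in auto)
    moreover have "(\<Union>i::nat. if i = 0 then A else B) = A \<union> B" by (auto split: if_splits)
    ultimately show ?thesis by simp
  qed
  have S_borel: "S \<times> b \<in> ?S \<and> S \<times> (UNIV - b) \<in> ?S" if S: "S \<in> sets M" and b: "b \<in> sets borel" for S and b :: "'b set"
  proof -
    have "b \<in> sigma_sets UNIV {F :: 'b set. closed F}" using b by (simp add: borel_eq_closed)
    then show ?thesis
    proof (induction rule: sigma_sets.induct)
      case (Basic F)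
      then obtain G :: "nat \<Rightarrow> 'b set" where G: "\<And>n. closed (G n)" "UNIV - F = (\<Union>n. G n)"
        using open_eq_UN_closed[of "UNIV - F"] by (auto simp: Compl_eq_Diff_UNIV[symmetric])
      have "(\<Union>n. S \<times> G n) \<in> ?S" by (rule UN) (use G rect S in auto)
      moreover have "(\<Union>n. S \<times> G n) = S \<times> (UNIV - F)" unfolding G(2) by blast
      ultimately have "S \<times> (UNIV - F) \<in> ?S" by simp
      then show ?case using rect S Basic by blast
    next
      case Empty
      show ?case using rect[OF S] by (auto intro!: rect[of "{}" UNIV, simplified])
    next
      case (Compl a)
      then show ?case by (simp add: Diff_Diff_Int)
    next
      case (Union a)
      have "(\<Union>i. S \<times> a i) \<in> ?S" by (rule UN) (use Union in auto)
      moreover have "(\<Inter>i. S \<times> (UNIV - a i)) \<in> ?S" by (rule suslin_sets_INT) (use Union in auto)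
      moreover have "(\<Union>i. S \<times> a i) = S \<times> (\<Union>i. a i)" "(\<Inter>i. S \<times> (UNIV - a i)) = S \<times> (UNIV - (\<Union>i. a i))" by auto
      ultimately show ?case by simp
    qed
  qed
  fix G :: "('a \<times> 'b) set" assume "G \<in> sets (M \<Otimes>\<^sub>M borel)"
  then have "G \<in> sigma_sets ?\<Omega> {a \<times> b | a b. a \<in> sets M \<and> b \<in> sets (borel :: 'b measure)}"
    by (simp add: sets_pair_measure)
  then have "G \<in> ?S \<and> ?\<Omega> - G \<in> ?S"
  proof (induction rule: sigma_sets.induct)
    case (Basic g)
    then obtain S b where g: "g = S \<times> b" "S \<in> sets M" "b \<in> sets borel" by blast
    have "(space M - S) \<times> UNIV \<union> S \<times> (UNIV - b) \<in> ?S"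
      using g S_borel by (intro Un rect[of "space M - S" UNIV]) auto
    moreover have "(space M - S) \<times> UNIV \<union> S \<times> (UNIV - b) = ?\<Omega> - g"
      using g sets.sets_into_space[of S M] by auto
    ultimately show ?case using g S_borel by auto
  next
    case Empty
    show ?case using rect[of "{}" UNIV] \<Omega> subset_suslin_sets by auto
  next
    case (Compl a)
    have "{a \<times> b | a b. a \<in> sets M \<and> b \<in> sets (borel :: 'b measure)} \<subseteq> Pow ?\<Omega>"
      using sets.sets_into_space by blast
    then have "a \<subseteq> ?\<Omega>" using Compl.hyps by (rule sigma_sets_into_sp)
    then show ?case using Compl by (simp add: double_diff)
  next
    case (Union a)
    have "(\<Union>i. a i) \<in> ?S" by (rule UN) (use Union in auto)
    moreover have "(\<Inter>i. ?\<Omega> - a i) \<in> ?S" by (rule suslin_sets_INT) (use Union in auto)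
    moreover have "(\<Inter>i. ?\<Omega> - a i) = ?\<Omega> - (\<Union>i. a i)" by auto
    ultimately show ?case by simp
  qed
  then show "G \<in> ?S" ..
qed

text \<open>Operation A commutes with projection along a compact set: from a scheme of rectangles
  only the measurable sides are kept, and compactness recovers the point that the closed sides must
  share.\<close>

theorem measurable_projection:
  fixes C :: "'b::metric_space set"
  assumes "finite_measure M" and "complete_measure M"
    and G: "G \<in> sets (M \<Otimes>\<^sub>M borel)" and C: "compact C"
  shows "{t \<in> space M. \<exists>p\<in>C. (t, p) \<in> G} \<in> sets M"
proof -
  obtain R where R: "suslin_scheme (closed_rectangles M) R" "G = suslin_op R"
    using sets_pair_subset_suslin G unfolding suslin_sets_def by blast
  have "\<forall>n \<sigma>. \<exists>S F. R n \<sigma> = S \<times> F \<and> S \<in> sets M \<and> closed F"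
    using suslin_schemeD(1)[OF R(1)] unfolding closed_rectangles_def by blast
  then obtain S0 F0 where SF0: "\<And>n \<sigma>. R n \<sigma> = S0 n \<sigma> \<times> F0 n \<sigma>" "\<And>n \<sigma>. S0 n \<sigma> \<in> sets M" "\<And>n \<sigma>. closed (F0 n \<sigma>)"
    by metis
  \<comment> \<open>The sides are chosen separately for every branch, so the choice need not respect
    common prefixes. Evaluating it at the branch continued by zeros restores locality.\<close>
  define cut where "cut n \<sigma> = (\<lambda>i. if i < n then \<sigma> i else 0)" for n and \<sigma> :: "nat \<Rightarrow> nat"
  define S where "S n \<sigma> = S0 n (cut n \<sigma>)" for n \<sigma>
  define F where "F n \<sigma> = F0 n (cut n \<sigma>)" for n \<sigma>
  have cut_eq: "cut n \<sigma> = cut n \<tau>" if "\<And>i. i < n \<Longrightarrow> \<sigma> i = \<tau> i" for n \<sigma> \<tau> using that by (auto simp: cut_def)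
  have RSF: "R n \<sigma> = S n \<sigma> \<times> F n \<sigma>" for n \<sigma>
  proof -
    have "R n \<sigma> = R n (cut n \<sigma>)" by (rule suslin_schemeD(2)[OF R(1)]) (simp add: cut_def)
    then show ?thesis by (simp add: SF0(1) S_def F_def)
  qed
  \<comment> \<open>The side \<open>S n \<sigma>\<close> survives only if the closed sides up to
    level n still meet inside \<open>C\<close>. If this holds at all levels, the finite intersection
    property yields one point lying in all of them.\<close>
  define P where "P n \<sigma> = (if C \<inter> (\<Inter>k\<le>n. F k \<sigma>) \<noteq> {} then S n \<sigma> else {})" for n \<sigma>
  have loc: "F k \<sigma> = F k \<tau>" "S k \<sigma> = S k \<tau>" if "k \<le> n" "\<And>i. i < n \<Longrightarrow> \<sigma> i = \<tau> i" for n k \<sigma> \<tau>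
    using cut_eq[of k \<sigma> \<tau>] that by (auto simp: F_def S_def)
  have "suslin_scheme (sets M) P"
    unfolding suslin_scheme_def
  proof (intro conjI allI impI)
    fix n \<sigma> show "P n \<sigma> \<in> sets M" unfolding P_def S_def using SF0(2) by auto
  next
    fix n and \<sigma> \<tau> :: "nat \<Rightarrow> nat" assume eq: "\<forall>i<n. \<sigma> i = \<tau> i"
    have "(\<Inter>k\<le>n. F k \<sigma>) = (\<Inter>k\<le>n. F k \<tau>)" "S n \<sigma> = S n \<tau>"
      using loc[of _ n \<sigma> \<tau>] eq by auto
    then show "P n \<sigma> = P n \<tau>" by (simp add: P_def)
  qed
  then have "suslin_op P \<in> sets M" by (rule sets_suslin_op[OF assms(1,2)])
  moreover have "suslin_op P = {t \<in> space M. \<exists>p\<in>C. (t, p) \<in> G}"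
  proof (intro set_eqI iffI)
    fix t assume "t \<in> suslin_op P"
    then obtain \<sigma> where \<sigma>: "\<And>n. t \<in> P n \<sigma>" by (auto simp: mem_suslin_op)
    then have ne: "C \<inter> (\<Inter>k\<le>n. F k \<sigma>) \<noteq> {}" and tS: "t \<in> S n \<sigma>" for n
      unfolding P_def by (metis empty_iff, metis empty_iff)
    have "C \<inter> (\<Inter>k. F k \<sigma>) \<noteq> {}"
    proof (rule compact_imp_fip_image[OF C])
      show "closed (F k \<sigma>)" for k using SF0(3) by (simp add: F_def)
      fix I :: "nat set" assume "finite I"
      then obtain n where "I \<subseteq> {..n}" using finite_nat_iff_bounded_le by blast
      then have "(\<Inter>k\<le>n. F k \<sigma>) \<subseteq> (\<Inter>k\<in>I. F k \<sigma>)" by blast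
      then show "C \<inter> (\<Inter>k\<in>I. F k \<sigma>) \<noteq> {}" using ne[of n] by blast
    qed
    then obtain p where "p \<in> C" "\<And>k. p \<in> F k \<sigma>" by blast
    then have "(t, p) \<in> G" using tS unfolding R(2) mem_suslin_op by (auto simp: RSF intro!: exI[of _ \<sigma>])
    moreover have "t \<in> space M" using tS[of 0] SF0(2) sets.sets_into_space by (fastforce simp: S_def)
    ultimately show "t \<in> {t \<in> space M. \<exists>p\<in>C. (t, p) \<in> G}" using \<open>p \<in> C\<close> by blast
  next
    fix t assume "t \<in> {t \<in> space M. \<exists>p\<in>C. (t, p) \<in> G}"
    then obtain p where p: "p \<in> C" "(t, p) \<in> G" by blast
    then obtain \<sigma> where "\<And>n. (t, p) \<in> S n \<sigma> \<times> F n \<sigma>" unfolding R(2) mem_suslin_op RSF by blast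
    then have "t \<in> P n \<sigma>" for n using p unfolding P_def by auto
    then show "t \<in> suslin_op P" by (auto simp: mem_suslin_op)
  qed
  ultimately show ?thesis by simp
qed

section \<open>Measurable selection from compact sections\<close>

lemma ex_prefix_recursion:
  fixes F :: "nat \<Rightarrow> (nat \<Rightarrow> 'b::zero) \<Rightarrow> 'b"
  assumes loc: "\<And>k p q. (\<And>i. i < k \<Longrightarrow> p i = q i) \<Longrightarrow> F k p = F k q"
  shows "\<exists>s. \<forall>k. s k = F k s"
proof -
  define f where "f = rec_nat (\<lambda>_. 0) (\<lambda>k p. p(k := F k p))"
  have f: "f (Suc k) = (f k)(k := F k (f k))" for k by (simp add: f_def)
  define s where "s i = f (Suc i) i" for i
  have "f (Suc (i + j)) i = s i" for i j by (induction j) (auto simp: s_def f)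
  from this[of _ "n - Suc i" for n i] have "f n i = s i" if "i < n" for i n using that by (metis Suc_eq_plus1 add_Suc le_add_diff_inverse Suc_leI)
  then have "F k (f k) = F k s" for k by (intro loc)
  then have "s k = F k s" for k by (simp add: s_def f)
  then show ?thesis by blast
qed

lemma continuous_on_coordinate: "continuous_on S (\<lambda>p :: 'i \<Rightarrow> 'b::topological_space. p i)"
  using continuous_on_product_coordinates[THEN continuous_on_subset, OF subset_UNIV] .

lemma measurable_coordinate [measurable]:
  "(\<lambda>p :: nat \<Rightarrow> real. p i) \<in> borel_measurable borel"
  by (intro borel_measurable_continuous_onI continuous_on_coordinate)

text \<open>The selected point is the lexicographic maximum of the section.\<close>

theorem compact_measurable_selection:
  fixes C :: "(nat \<Rightarrow> real) set"
  assumes fin: "finite_measure M" and compl: "complete_measure M"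
    and G: "G \<in> sets (M \<Otimes>\<^sub>M (borel :: (nat \<Rightarrow> real) measure))" and C: "compact C"
    and sec: "\<And>t. t \<in> space M \<Longrightarrow> closed {p \<in> C. (t, p) \<in> G}"
  shows "\<exists>s. (\<forall>k. (\<lambda>t. s t k) \<in> borel_measurable M) \<and>
    (\<forall>t\<in>space M. (\<exists>p\<in>C. (t, p) \<in> G) \<longrightarrow> s t \<in> C \<and> (t, s t) \<in> G)"
proof -
  have "\<exists>s. \<forall>k. s k = Sup ((\<lambda>p. p k) ` {p \<in> C. (t, p) \<in> G \<and> (\<forall>i<k. p i = s i)})" for t
    by (rule ex_prefix_recursion) (auto intro!: arg_cong[where f = Sup] image_cong)
  then have "\<forall>t. \<exists>s. \<forall>k. s k = Sup ((\<lambda>p. p k) ` {p \<in> C. (t, p) \<in> G \<and> (\<forall>i<k. p i = s i)})" ..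
  from choice[OF this] obtain s where
    s: "\<forall>t k. s t k = Sup ((\<lambda>p. p k) ` {p \<in> C. (t, p) \<in> G \<and> (\<forall>i<k. p i = s t i)})" ..
  \<comment> \<open>Points of the section that agree with \<open>s t\<close> before coordinate k;
    \<open>s t k\<close> is the largest coordinate k among them. The supremum is attained by
    compactness, which is why no \<open>Z k t\<close> becomes empty.\<close>
  define Z where "Z k t = {p \<in> C. (t, p) \<in> G \<and> (\<forall>i<k. p i = s t i)}" for k t
  have Z_compact: "compact (Z k t)" if t: "t \<in> space M" for k t
  proof -
    have "Z k t = C \<inter> ({p \<in> C. (t, p) \<in> G} \<inter> (\<Inter>i<k. {p. p i = s t i}))"
      unfolding Z_def by auto
    also have "compact \<dots>"
      by (intro compact_Int_closed[OF C] closed_Int sec[OF t] closed_INT ballI closed_Collect_eq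
          continuous_on_coordinate continuous_on_const)
    finally show ?thesis .
  qed
  have bdd: "bdd_above ((\<lambda>p. p k) ` Z j t)" if t: "t \<in> space M" for k j t
    using compact_continuous_image[OF continuous_on_coordinate[of _ k] Z_compact[OF t]]
    by (intro bounded_imp_bdd_above compact_imp_bounded)
  have sZ: "s t k = Sup ((\<lambda>p. p k) ` Z k t)" for t k unfolding Z_def using s by blast
  define A where "A = {t \<in> space M. \<exists>p\<in>C. (t, p) \<in> G}"
  have A: "A \<in> sets M" unfolding A_def by (rule measurable_projection[OF fin compl G C])
  have Z_ne: "Z k t \<noteq> {}" if t: "t \<in> A" for k t
  proof (induction k)
    case 0
    then show ?case using t by (auto simp: A_def Z_def)
  next
    case (Suc k)
    have tM: "t \<in> space M" using t by (simp add: A_def)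
    obtain p where p: "p \<in> Z k t" "\<And>q. q \<in> Z k t \<Longrightarrow> q k \<le> p k"
      using continuous_attains_sup[OF Z_compact[OF tM] Suc continuous_on_coordinate[of _ k]] by blast
    then have "s t k = p k" unfolding sZ by (intro cSup_eq_maximum) auto
    then have "p \<in> Z (Suc k) t" using p(1) unfolding Z_def by (auto simp: less_Suc_eq)
    then show ?case by blast
  qed
  have meas: "(\<lambda>t. s t k) \<in> borel_measurable M" for k
  proof (induction k rule: less_induct)
    case (less k)
    \<comment> \<open>Coordinates before k are measurable by induction, so the constraint of
      agreeing with them is product measurable, and the superlevel sets of \<open>s t k\<close>
      become projections.\<close>
    have Gk: "{w \<in> space (M \<Otimes>\<^sub>M (borel :: (nat \<Rightarrow> real) measure)). w \<in> G \<and> (\<forall>i<k. snd w i = s (fst w) i) \<and> c < snd w k} \<in> sets (M \<Otimes>\<^sub>M (borel :: (nat \<Rightarrow> real) measure))" for c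
    proof -
      have si: "(\<lambda>t. s t i) \<in> borel_measurable M" if "i \<in> {..<k}" for i using less that by simp
      have [measurable]: "(\<lambda>w :: 'a \<times> (nat \<Rightarrow> real). s (fst w) i) \<in> borel_measurable (M \<Otimes>\<^sub>M (borel :: (nat \<Rightarrow> real) measure))" if "i \<in> {..<k}" for i
        using measurable_compose[OF measurable_fst si[OF that]] .
      have "{w \<in> space (M \<Otimes>\<^sub>M (borel :: (nat \<Rightarrow> real) measure)). w \<in> G \<and> (\<forall>i\<in>{..<k}. snd w i = s (fst w) i) \<and> c < snd w k} \<in> sets (M \<Otimes>\<^sub>M (borel :: (nat \<Rightarrow> real) measure))"
        using G by measurable
      then show ?thesis by (simp add: Ball_def)
    qed
    have "{t \<in> space M. c < s t k} \<in> sets M" for c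
    proof -
      let ?B = "{t \<in> space M. \<exists>p\<in>C. (t, p) \<in> {w \<in> space (M \<Otimes>\<^sub>M (borel :: (nat \<Rightarrow> real) measure)). w \<in> G \<and> (\<forall>i<k. snd w i = s (fst w) i) \<and> c < snd w k}}"
      have B: "?B \<in> sets M" by (rule measurable_projection[OF fin compl Gk C])
      \<comment> \<open>Where the section is empty, \<open>s t k\<close> has the constant default
        value \<open>Sup {}\<close>.\<close>
      have "{t \<in> space M. c < s t k} = ?B \<union> {t \<in> space M - A. c < Sup ({} :: real set)}"
      proof (intro set_eqI)
        fix t
        show "t \<in> {t \<in> space M. c < s t k} \<longleftrightarrow> t \<in> ?B \<union> {t \<in> space M - A. c < Sup ({} :: real set)}"
        proof (cases "t \<in> A")
          case True
          then have t: "t \<in> space M" by (simp add: A_def)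
          have "c < s t k \<longleftrightarrow> (\<exists>p\<in>Z k t. c < p k)"
            unfolding sZ using less_cSup_iff[OF _ bdd[OF t]] Z_ne[OF True, of k] by auto
          also have "\<dots> \<longleftrightarrow> t \<in> ?B" using t by (auto simp: Z_def space_pair_measure)
          finally show ?thesis using True t by auto
        next
          case False
          then have "Z k t = {}" if "t \<in> space M" using that by (auto simp: A_def Z_def)
          then show ?thesis using False sZ[of t k] by (auto simp: A_def)
        qed
      qed
      then show ?thesis using A B by simp
    qed
    then show ?case by (simp add: borel_measurable_iff_greater)
  qed
  moreover have "s t \<in> {p \<in> C. (t, p) \<in> G}" if t: "t \<in> A" for t
  proof -
    \<comment> \<open>A point of \<open>Z k t\<close> shares its first k coordinates with
      \<open>s t\<close>, so these points converge to \<open>s t\<close>, and the section is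
      closed.\<close>
    have "\<forall>k. \<exists>p. p \<in> Z k t" using Z_ne[OF t] by blast
    then obtain p where p: "\<And>k. p k \<in> Z k t" by metis
    have "(\<lambda>k. p k i) \<longlonglongrightarrow> s t i" for i
    proof (rule tendsto_eventually)
      show "\<forall>\<^sub>F k in sequentially. p k i = s t i"
        by (rule eventually_mono[OF eventually_gt_at_top[of i]]) (use p in \<open>auto simp: Z_def\<close>)
    qed
    then have "p \<longlonglongrightarrow> s t"
      using limitin_componentwise[of "\<lambda>_. euclidean" UNIV p "s t" sequentially]
      by (simp add: euclidean_product_topology)
    moreover have "p k \<in> {p \<in> C. (t, p) \<in> G}" for k using p[of k] by (simp add: Z_def)
    ultimately show ?thesis
      using closed_sequentially[OF sec] t by (auto simp: A_def)
  qed
  ultimately show ?thesis by (intro exI[of _ s]) (auto simp: A_def)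
qed

section \<open>Saturation\<close>

text \<open>All functions are pulled back at once, as one map into the Polish space of real
  sequences. Every set of the generated algebra is then the preimage of a single Borel set
  there.\<close>

definition generated_by :: "'a measure \<Rightarrow> (nat \<Rightarrow> 'a \<Rightarrow> real) \<Rightarrow> 'a measure" where
  "generated_by N u = vimage_algebra (space N) (\<lambda>t m. u m t) borel"

text \<open>The countable dense family consists of rational combinations of indicators of sets in
  \<open>\<D>\<close>. Approximability is carried through the induction that builds integrable
  functions: indicators, sums, dominated limits.\<close>

lemma separable_L1I_sets:
  fixes N :: "'a measure" and \<D> :: "'a set set"
  assumes fin: "finite_measure N" and cnt: "countable \<D>" and sub: "\<D> \<subseteq> sets N"
    and approx: "\<And>B e. B \<in> sets N \<Longrightarrow> e > 0 \<Longrightarrow> \<exists>D\<in>\<D>. measure N (B - D \<union> (D - B)) < e"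
  shows "separable_L1 N"
proof -
  interpret finite_measure N by fact
  define ev where "ev l = (\<lambda>t. \<Sum>(q, D)\<leftarrow>l. real_of_rat q * indicator D t)" for l :: "(rat \<times> 'a set) list"
  define \<F> where "\<F> = ev ` lists (UNIV \<times> \<D>)"
  have "countable \<F>"
    unfolding \<F>_def using cnt by (intro countable_image countable_lists) auto
  have int: "integrable N (ev l)" if "l \<in> lists (UNIV \<times> \<D>)" for l
    using that unfolding ev_def
    by (induction l) (use sub in \<open>auto intro!: integrable_mult_right integrable_real_indicator simp: less_top[symmetric]\<close>)
  define P where "P f \<longleftrightarrow> (\<forall>e>0. \<exists>g\<in>\<F>. (\<integral>t. \<bar>f t - g t\<bar> \<partial>N) < e)" for f :: "'a \<Rightarrow> real"
  have PD: "\<exists>l. l \<in> lists (UNIV \<times> \<D>) \<and> (\<integral>t. \<bar>f t - ev l t\<bar> \<partial>N) < e / 2" if "P f" "e > 0" for f e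
  proof -
    obtain g where "g \<in> \<F>" "(\<integral>t. \<bar>f t - g t\<bar> \<partial>N) < e / 2"
      using \<open>P f\<close>[unfolded P_def, rule_format, of "e / 2"] \<open>e > 0\<close> by auto
    then show ?thesis unfolding \<F>_def by blast
  qed
  have P_add: "P (\<lambda>t. f t + g t)" if f: "integrable N f" "P f" and g: "integrable N g" "P g" for f g
    unfolding P_def
  proof (intro allI impI)
    fix e :: real assume "e > 0"
    obtain l where l: "l \<in> lists (UNIV \<times> \<D>)" "(\<integral>t. \<bar>f t - ev l t\<bar> \<partial>N) < e/2"
      using PD[OF f(2) \<open>e > 0\<close>] by auto
    obtain l' where l': "l' \<in> lists (UNIV \<times> \<D>)" "(\<integral>t. \<bar>g t - ev l' t\<bar> \<partial>N) < e/2"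
      using PD[OF g(2) \<open>e > 0\<close>] by auto
    have ev_app: "ev (l @ l') t = ev l t + ev l' t" for t by (simp add: ev_def)
    have "(\<integral>t. \<bar>f t + g t - ev (l @ l') t\<bar> \<partial>N) \<le> (\<integral>t. \<bar>f t - ev l t\<bar> + \<bar>g t - ev l' t\<bar> \<partial>N)"
      unfolding ev_app using f g int[OF l(1)] int[OF l'(1)]
      by (intro integral_mono) (auto intro!: Bochner_Integration.integrable_add Bochner_Integration.integrable_diff)
    also have "\<dots> = (\<integral>t. \<bar>f t - ev l t\<bar> \<partial>N) + (\<integral>t. \<bar>g t - ev l' t\<bar> \<partial>N)"
      using f g int[OF l(1)] int[OF l'(1)] by (intro Bochner_Integration.integral_add) auto
    also have "\<dots> < e" using l l' by simp
    finally show "\<exists>h\<in>\<F>. (\<integral>t. \<bar>f t + g t - h t\<bar> \<partial>N) < e"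
      using l l' unfolding \<F>_def by (intro bexI[of _ "ev (l @ l')"]) auto
  qed
  have ind: "P (\<lambda>t. indicator B t *\<^sub>R c)" if B: "B \<in> sets N" for B and c :: real
    unfolding P_def
  proof (intro allI impI)
    fix e :: real assume e: "e > 0"
    \<comment> \<open>One half of e pays for replacing c by a rational, the other for replacing
      \<open>B\<close> by \<open>D\<close>; the summands 1 in both denominators avoid division by
      zero.\<close>
    define r where "r = e / (2 * (measure N (space N) + 1))"
    have r: "r > 0" "r * measure N (space N) < e / 2"
      unfolding r_def using e measure_nonneg[of N "space N"] by (auto simp: field_simps add_pos_nonneg)
    obtain q :: rat where "c - r < of_rat q" "of_rat q < c"
      using of_rat_dense[of "c - r" c] r by auto
    then have q: "\<bar>c - of_rat q\<bar> < r" by simp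
    obtain D where D: "D \<in> \<D>" "measure N (B - D \<union> (D - B)) < e / (2 * (\<bar>c\<bar> + 1))"
      using approx[OF B, of "e / (2 * (\<bar>c\<bar> + 1))"] e by (auto simp: add_nonneg_pos)
    have Ds: "D \<in> sets N" using D sub by blast
    let ?S = "B - D \<union> (D - B)"
    have [measurable]: "?S \<in> sets N" "D \<in> sets N" "B \<in> sets N" using B Ds by auto
    have "(\<integral>t. \<bar>indicator B t *\<^sub>R c - ev [(q, D)] t\<bar> \<partial>N) \<le> (\<integral>t. \<bar>c\<bar> * indicator ?S t + r \<partial>N)"
    proof (intro integral_mono)
      show "\<bar>indicator B t *\<^sub>R c - ev [(q, D)] t\<bar> \<le> \<bar>c\<bar> * indicator ?S t + r" for t
      proof -
        have "\<bar>indicator B t * c - q' * indicator D t\<bar> \<le> \<bar>c\<bar> * indicator ?S t + r" if "\<bar>c - q'\<bar> < r" for q' :: real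
          using that by (auto simp: indicator_def)
        from this[OF q] show ?thesis by (simp add: ev_def)
      qed
    qed (auto simp: ev_def less_top[symmetric] intro!: Bochner_Integration.integrable_add integrable_real_indicator)
    also have "\<dots> = \<bar>c\<bar> * measure N ?S + r * measure N (space N)"
      by (subst Bochner_Integration.integral_add) (auto simp: less_top[symmetric])
    also have "\<bar>c\<bar> * measure N ?S \<le> (\<bar>c\<bar> + 1) * (e / (2 * (\<bar>c\<bar> + 1)))"
      using D(2) by (intro mult_mono) auto
    also have "\<dots> = e / 2" by (simp add: field_simps)
    finally show "\<exists>g\<in>\<F>. (\<integral>t. \<bar>indicator B t *\<^sub>R c - g t\<bar> \<partial>N) < e"
      using D(1) r(2) unfolding \<F>_def by (intro bexI[of _ "ev [(q, D)]"]) auto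
  qed
  have P_lim: "P f" if s: "\<And>i. integrable N (s i)" "\<And>i. P (s i)" "\<And>t. t \<in> space N \<Longrightarrow> (\<lambda>i. s i t) \<longlonglongrightarrow> f t"
    "\<And>i t. t \<in> space N \<Longrightarrow> norm (s i t) \<le> 2 * norm (f t)" and f: "integrable N f" for f and s :: "nat \<Rightarrow> 'a \<Rightarrow> real"
    unfolding P_def
  proof (intro allI impI)
    fix e :: real assume e: "e > 0"
    have "(\<lambda>i. \<integral>t. \<bar>f t - s i t\<bar> \<partial>N) \<longlonglongrightarrow> (\<integral>t. 0 \<partial>N)"
    proof (rule integral_dominated_convergence)
      show "integrable N (\<lambda>t. 3 * norm (f t))" using f by auto
      show "AE t in N. (\<lambda>i. \<bar>f t - s i t\<bar>) \<longlonglongrightarrow> 0"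
      proof (intro AE_I2)
        fix t assume "t \<in> space N"
        then have "(\<lambda>i. \<bar>f t - s i t\<bar>) \<longlonglongrightarrow> \<bar>f t - f t\<bar>" by (intro tendsto_intros s(3))
        then show "(\<lambda>i. \<bar>f t - s i t\<bar>) \<longlonglongrightarrow> 0" by simp
      qed
      show "AE t in N. norm \<bar>f t - s i t\<bar> \<le> 3 * norm (f t)" for i
        using s(4)[of _ i] by (intro AE_I2) (smt (verit) real_norm_def)
    qed (use f s(1) in auto)
    then have "\<forall>\<^sub>F i in sequentially. (\<integral>t. \<bar>f t - s i t\<bar> \<partial>N) < e / 2"
      using e by (intro order_tendstoD) auto
    then obtain i where i: "(\<integral>t. \<bar>f t - s i t\<bar> \<partial>N) < e / 2" by (auto simp: eventually_sequentially)
    obtain l where l: "l \<in> lists (UNIV \<times> \<D>)" "(\<integral>t. \<bar>s i t - ev l t\<bar> \<partial>N) < e / 2"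
      using PD[OF s(2) e] by blast
    have "(\<integral>t. \<bar>f t - ev l t\<bar> \<partial>N) \<le> (\<integral>t. \<bar>f t - s i t\<bar> + \<bar>s i t - ev l t\<bar> \<partial>N)"
      using f s(1)[of i] int[OF l(1)]
      by (intro integral_mono) (auto intro!: Bochner_Integration.integrable_add Bochner_Integration.integrable_diff)
    also have "\<dots> = (\<integral>t. \<bar>f t - s i t\<bar> \<partial>N) + (\<integral>t. \<bar>s i t - ev l t\<bar> \<partial>N)"
      using f s(1)[of i] int[OF l(1)] by (intro Bochner_Integration.integral_add) auto
    also have "\<dots> < e" using i l by simp
    finally show "\<exists>h\<in>\<F>. (\<integral>t. \<bar>f t - h t\<bar> \<partial>N) < e"
      using l unfolding \<F>_def by (intro bexI[of _ "ev l"]) auto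
  qed
  have "P f" if "integrable N f" for f :: "'a \<Rightarrow> real"
    using that
  proof (induction rule: integrable_induct)
    case (base B c)
    show ?case by (rule ind) (rule base(1))
  next
    case (add f g)
    then show ?case by (intro P_add)
  next
    case (lim f s)
    show ?case by (rule P_lim[of s]) (use lim in auto)
  qed
  moreover have "\<forall>g\<in>\<F>. integrable N g" unfolding \<F>_def using int by blast
  ultimately show ?thesis
    unfolding separable_L1_def P_def using \<open>countable \<F>\<close> by blast
qed

text \<open>Outer regularity reduces Borel sets to open ones, and an open set is the increasing
  union of finite unions of basis sets, of which there are countably many.\<close>

lemma countable_borel_approximation:
  fixes \<nu> :: "'b::polish_space measure"
  assumes fin: "finite_measure \<nu>" and sb: "sets \<nu> = sets borel"
  shows "\<exists>\<U>. countable \<U> \<and> \<U> \<subseteq> sets borel \<and>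
    (\<forall>B\<in>sets borel. \<forall>e>0. \<exists>U\<in>\<U>. measure \<nu> (B - U \<union> (U - B)) < e)"
proof -
  interpret finite_measure \<nu> by fact
  obtain \<B> :: "'b set set" where \<B>: "countable \<B>" "topological_basis \<B>"
    using ex_countable_basis by blast
  define \<U> where "\<U> = Union ` {\<F>. finite \<F> \<and> \<F> \<subseteq> \<B>}"
  have "countable \<U>"
    unfolding \<U>_def by (intro countable_image countable_Collect_finite_subset \<B>)
  moreover have "\<U> \<subseteq> sets borel"
    unfolding \<U>_def using topological_basis_open[OF \<B>(2)] by (auto intro!: borel_open open_Union)
  moreover have "\<exists>U\<in>\<U>. measure \<nu> (B - U \<union> (U - B)) < e" if B: "B \<in> sets borel" and e: "e > 0" for B and e :: real
  proof -
    have "emeasure \<nu> B < ennreal (measure \<nu> B + e / 2)"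
      using e by (simp add: emeasure_eq_measure ennreal_less_iff)
    then have "(INF U\<in>{U. B \<subseteq> U \<and> open U}. emeasure \<nu> U) < ennreal (measure \<nu> B + e / 2)"
      using outer_regular[OF sb _ B] by simp
    then obtain W where W: "B \<subseteq> W" "open W" "emeasure \<nu> W < ennreal (measure \<nu> B + e / 2)"
      unfolding INF_less_iff by blast
    have [measurable]: "W \<in> sets \<nu>" "B \<in> sets \<nu>" using W B sb by auto
    have WB: "measure \<nu> (W - B) < e / 2"
    proof -
      have "measure \<nu> W < measure \<nu> B + e / 2"
        using W(3) e by (simp add: emeasure_eq_measure ennreal_less_iff del: ennreal_plus)
      then show ?thesis using finite_measure_Diff[of W B] W(1) by simp
    qed
    obtain \<F> where \<F>: "\<F> \<subseteq> \<B>" "\<Union>\<F> = W" using \<B>(2) W(2) unfolding topological_basis_def by blast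
    \<comment> \<open>The empty set is inserted so that the enumeration makes sense even if
      \<open>\<F>\<close> is empty; it is removed again when \<open>V n\<close> is recognised as a
      member of \<open>\<U>\<close>.\<close>
    define g where "g = from_nat_into (insert {} \<F>)"
    have cf: "countable (insert {} \<F>)" using \<B>(1) \<F>(1) countable_subset by auto
    have g: "range g = insert {} \<F>" unfolding g_def by (rule range_from_nat_into) (use cf in auto)
    define V where "V n = (\<Union>i\<le>n. g i)" for n
    have gW: "(\<Union>i. g i) = W" using g \<F>(2) by auto
    have [measurable]: "g i \<in> sets \<nu>" for i
    proof -
      have "g i \<in> insert {} \<F>" using g by blast
      then show ?thesis using \<F>(1) topological_basis_open[OF \<B>(2)] sb by auto
    qed
    have V_sets[measurable]: "V n \<in> sets \<nu>" for n unfolding V_def by measurable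
    have "(\<lambda>n. measure \<nu> (V n)) \<longlonglongrightarrow> measure \<nu> (\<Union>n. V n)"
    proof (intro finite_Lim_measure_incseq incseq_SucI)
      show "V n \<subseteq> V (Suc n)" for n unfolding V_def by (intro UN_mono) auto
    qed auto
    moreover have UV: "(\<Union>n. V n) = W" unfolding V_def gW[symmetric] by auto
    ultimately have "(\<lambda>n. measure \<nu> W - measure \<nu> (V n)) \<longlonglongrightarrow> measure \<nu> W - measure \<nu> W"
      by (intro tendsto_intros) auto
    then have "\<forall>\<^sub>F n in sequentially. measure \<nu> W - measure \<nu> (V n) < e / 2"
      using e by (intro order_tendstoD) auto
    then obtain n where n: "measure \<nu> W - measure \<nu> (V n) < e / 2" by (auto simp: eventually_sequentially)
    have VW: "V n \<subseteq> W" using UV by blast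
    have "measure \<nu> (B - V n \<union> (V n - B)) \<le> measure \<nu> ((W - V n) \<union> (W - B))"
      using VW W(1) by (intro finite_measure_mono) auto
    also have "\<dots> \<le> measure \<nu> (W - V n) + measure \<nu> (W - B)"
      by (intro measure_Un_le) auto
    also have "measure \<nu> (W - V n) = measure \<nu> W - measure \<nu> (V n)"
      using VW by (intro finite_measure_Diff) auto
    finally have "measure \<nu> (B - V n \<union> (V n - B)) < e" using n WB by simp
    moreover have "V n \<in> \<U>"
    proof -
      have "V n = \<Union>(g ` {..n} - {{}})" unfolding V_def by auto
      moreover have "g ` {..n} - {{}} \<subseteq> \<B>" using g \<F>(1) by blast
      ultimately show ?thesis unfolding \<U>_def by blast
    qed
    ultimately show ?thesis by blast
  qed
  ultimately show ?thesis by blast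
qed

lemma generated_by:
  fixes u :: "nat \<Rightarrow> 'a \<Rightarrow> real"
  assumes u: "\<And>m. u m \<in> borel_measurable N"
  shows "(\<lambda>t m. u m t) \<in> N \<rightarrow>\<^sub>M borel"
    and "sets (generated_by N u) = {(\<lambda>t m. u m t) -` C \<inter> space N | C. C \<in> sets borel}"
    and "subalgebra N (generated_by N u)"
    and "u m \<in> borel_measurable (generated_by N u)"
proof -
  show U: "(\<lambda>t m. u m t) \<in> N \<rightarrow>\<^sub>M borel"
    by (rule measurable_coordinatewise_then_product) (rule u)
  show sets: "sets (generated_by N u) = {(\<lambda>t m. u m t) -` C \<inter> space N | C. C \<in> sets borel}"
    unfolding generated_by_def by (rule sets_vimage_algebra2) auto
  show "subalgebra N (generated_by N u)"
    unfolding subalgebra_def sets using measurable_sets[OF U] by (auto simp: generated_by_def)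
  have "(\<lambda>t m. u m t) \<in> generated_by N u \<rightarrow>\<^sub>M borel"
    unfolding generated_by_def by (rule measurable_vimage_algebra1) auto
  from measurable_compose[OF this, of "\<lambda>p. p m" borel]
  show "u m \<in> borel_measurable (generated_by N u)"
    by (simp add: borel_measurable_continuous_onI)
qed

text \<open>Otherwise every measurable set would agree almost everywhere with the preimage of a
  Borel set of sequences. A countable family approximating Borel sets for the image measure would
  then pull back to one approximating all measurable sets, and \<open>L^1\<close> would be
  separable.\<close>

lemma nonseparable_imp_nontrivial_cond_exp:
  fixes N :: "'a measure" and u :: "nat \<Rightarrow> 'a \<Rightarrow> real"
  assumes fin: "finite_measure N" and nsep: "\<not> separable_L1 N"
    and u: "\<And>m. u m \<in> borel_measurable N"
  shows "\<exists>B\<in>sets N. \<not> (AE t in N. real_cond_exp N (generated_by N u) (indicator B) t = indicator B t)"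
proof (rule ccontr)
  interpret finite_measure N by fact
  let ?F = "generated_by N u" and ?U = "\<lambda>t m. u m t"
  note U = generated_by(1)[of u N, OF u] and sets_F = generated_by(2)[of u N, OF u]
  assume "\<not> ?thesis"
  then have triv: "AE t in N. real_cond_exp N ?F (indicator B) t = indicator B t" if "B \<in> sets N" for B
    using that by blast
  define \<nu> where "\<nu> = distr N borel ?U"
  interpret \<nu>: finite_measure \<nu> unfolding \<nu>_def by (rule finite_measure_distr[OF U])
  obtain \<U> where \<U>: "countable \<U>" "\<U> \<subseteq> sets borel"
    "\<And>B e. B \<in> sets borel \<Longrightarrow> e > 0 \<Longrightarrow> \<exists>V\<in>\<U>. measure \<nu> (B - V \<union> (V - B)) < e"
    using countable_borel_approximation[OF \<nu>.finite_measure_axioms] by (auto simp: \<nu>_def)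
  define \<D> where "\<D> = (\<lambda>V. ?U -` V \<inter> space N) ` \<U>"
  have "separable_L1 N"
  proof (rule separable_L1I_sets[OF fin])
    show "countable \<D>" unfolding \<D>_def using \<U>(1) by (rule countable_image)
    show "\<D> \<subseteq> sets N" unfolding \<D>_def using \<U>(2) measurable_sets[OF U] by blast
    fix B and e :: real assume B[measurable]: "B \<in> sets N" and e: "e > 0"
    \<comment> \<open>A set of the generated algebra that equals \<open>B\<close> almost everywhere,
      because there the conditional expectation is the indicator.\<close>
    define B' where "B' = {t \<in> space N. real_cond_exp N ?F (indicator B) t = 1}"
    have sp: "space ?F = space N" using generated_by(3)[of u N, OF u] by (simp add: subalgebra_def)
    have "{t \<in> space ?F. real_cond_exp N ?F (indicator B) t = 1} \<in> sets ?F"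
      by (intro borel_measurable_eq) auto
    then obtain C where C: "C \<in> sets borel" "B' = ?U -` C \<inter> space N"
      unfolding B'_def sets_F sp by blast
    obtain V where V: "V \<in> \<U>" "measure \<nu> (C - V \<union> (V - C)) < e" using \<U>(3)[OF C(1) e] by blast
    let ?D = "?U -` V \<inter> space N"
    have Vb: "V \<in> sets borel" using V \<U>(2) by blast
    have [measurable]: "?D \<in> sets N" "B' \<in> sets N" using measurable_sets[OF U] Vb C by auto
    have "measure N (B - ?D \<union> (?D - B)) = measure N (B' - ?D \<union> (?D - B'))"
    proof (rule measure_eq_AE)
      show "AE t in N. t \<in> B - ?D \<union> (?D - B) \<longleftrightarrow> t \<in> B' - ?D \<union> (?D - B')"
        using triv[OF B] AE_space
      proof eventually_elim
        case (elim t)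
        then have "t \<in> B \<longleftrightarrow> t \<in> B'" by (simp add: B'_def indicator_def)
        then show ?case by blast
      qed
    qed auto
    also have "B' - ?D \<union> (?D - B') = ?U -` (C - V \<union> (V - C)) \<inter> space N"
      unfolding C(2) by auto
    also have "measure N \<dots> = measure \<nu> (C - V \<union> (V - C))"
      unfolding \<nu>_def using C Vb by (intro measure_distr[symmetric] U) auto
    finally have "measure N (B - ?D \<union> (?D - B)) < e" using V(2) by simp
    moreover have "?D \<in> \<D>" unfolding \<D>_def using V(1) by blast
    ultimately show "\<exists>D\<in>\<D>. measure N (B - D \<union> (D - B)) < e" by blast
  qed
  then show False using nsep by blast
qed

theorem saturated_exists_orthogonal:
  fixes M :: "'a measure" and u :: "nat \<Rightarrow> 'a \<Rightarrow> real"
  assumes fin: "finite_measure M" and sat: "saturated M"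
    and A: "A \<in> sets M" "measure M A > 0" and u: "\<And>m. integrable M (u m)"
  shows "\<exists>\<psi> \<in> borel_measurable M. (\<forall>t. \<bar>\<psi> t\<bar> \<le> (1::real)) \<and> (\<forall>t. t \<notin> A \<longrightarrow> \<psi> t = 0) \<and>
    \<not> (AE t in M. \<psi> t = 0) \<and> (\<forall>m. (\<integral>t. \<psi> t * u m t \<partial>M) = 0)"
proof -
  interpret M: finite_measure M by fact
  define N where "N = restrict_space M A"
  have AM: "A \<inter> space M = A" "A \<inter> space M \<in> sets M" using A sets.sets_into_space by auto
  interpret N: finite_measure N unfolding N_def by (rule finite_measure_restrict_space) (use fin A in auto)
  have space_N: "space N = A" using AM by (simp add: N_def space_restrict_space)
  have uN: "integrable N (u m)" for m
    unfolding N_def using integrable_restrict_space[OF AM(2), of "u m"] integrable_mult_indicator[OF A(1) u[of m]]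
    by simp
  have nsep: "\<not> separable_L1 N" using sat A unfolding saturated_def N_def by blast
  let ?F = "generated_by N u"
  have uN': "u m \<in> borel_measurable N" for m using uN by blast
  obtain B where B[measurable]: "B \<in> sets N"
    and nt: "\<not> (AE t in N. real_cond_exp N ?F (indicator B) t = indicator B t)"
    using nonseparable_imp_nontrivial_cond_exp[OF N.finite_measure_axioms nsep uN'] by (rule bexE)
  interpret F: finite_measure_subalgebra N ?F
    by unfold_locales (rule generated_by(3)[OF uN'])
  define c where "c = real_cond_exp N ?F (indicator B)"
  have [measurable]: "c \<in> borel_measurable N" unfolding c_def by (rule borel_measurable_cond_exp2)
  \<comment> \<open>The conditional expectation lies between 0 and 1 only almost everywhere, while
    the bound on \<open>\<psi>\<close> is claimed at every point; hence the clamping.\<close>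
  define \<psi>0 where "\<psi>0 t = max (-1) (min 1 (indicator B t - c t))" for t
  define \<psi> where "\<psi> t = (if t \<in> A then \<psi>0 t else 0)" for t
  have iB: "integrable N (indicator B :: 'a \<Rightarrow> real)" by (auto simp: less_top[symmetric])
  have "AE t in N. c t \<ge> 0" unfolding c_def by (rule F.real_cond_exp_pos) auto
  moreover have "AE t in N. c t \<le> 1" unfolding c_def by (rule F.real_cond_exp_le_c[OF iB]) auto
  ultimately have eq: "AE t in N. \<psi>0 t = indicator B t - c t"
    by eventually_elim (auto simp: \<psi>0_def indicator_def)
  have \<psi>0_meas: "\<psi>0 \<in> borel_measurable N" unfolding \<psi>0_def by measurable
  have \<psi>_meas: "\<psi> \<in> borel_measurable M"
  proof -
    have "(\<lambda>t. indicator A t *\<^sub>R \<psi>0 t) \<in> borel_measurable M"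
      using \<psi>0_meas borel_measurable_restrict_space_iff[OF AM(2), of \<psi>0] unfolding N_def by (simp add: mult.commute)
    moreover have "(\<lambda>t. indicator A t *\<^sub>R \<psi>0 t) = \<psi>" by (auto simp: \<psi>_def)
    ultimately show ?thesis by simp
  qed
  have "\<not> (AE t in M. \<psi> t = 0)"
  proof
    assume "AE t in M. \<psi> t = 0"
    then have "AE t in M. t \<in> A \<longrightarrow> \<psi>0 t = 0" by eventually_elim (auto simp: \<psi>_def)
    then have "AE t in N. \<psi>0 t = 0" unfolding N_def by (subst AE_restrict_space_iff[OF AM(2)])
    with eq have "AE t in N. c t = indicator B t" by eventually_elim simp
    then show False using nt unfolding c_def by blast
  qed
  moreover have "(\<integral>t. \<psi> t * u m t \<partial>M) = 0" for m
  proof -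
    have iuB: "integrable N (\<lambda>t. u m t * indicator B t)"
      using integrable_mult_indicator[OF B uN[of m]] by (simp add: mult.commute)
    have um: "u m \<in> borel_measurable ?F" by (rule generated_by(4)[OF uN'])
    \<comment> \<open>As \<open>u m\<close> is measurable for the generated algebra,
      \<open>indicator B\<close> and its conditional expectation have the same integral against it.
      This is the orthogonality.\<close>
    note cond = F.real_cond_exp_intg[OF iuB um]
    have "(\<integral>t. \<psi> t * u m t \<partial>M) = (\<integral>t. indicator A t *\<^sub>R (\<psi>0 t * u m t) \<partial>M)"
      by (intro Bochner_Integration.integral_cong) (auto simp: \<psi>_def)
    also have "\<dots> = (\<integral>t. \<psi>0 t * u m t \<partial>N)"
      unfolding N_def by (rule integral_restrict_space[OF AM(2), symmetric])
    also have "\<dots> = (\<integral>t. u m t * indicator B t - u m t * c t \<partial>N)"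
    proof (rule integral_cong_AE)
      show "AE t in N. \<psi>0 t * u m t = u m t * indicator B t - u m t * c t"
        using eq by eventually_elim (simp add: right_diff_distrib mult.commute)
    qed (use \<psi>0_meas uN'[of m] in measurable)
    also have "\<dots> = 0"
      using cond iuB by (subst Bochner_Integration.integral_diff) (auto simp: c_def)
    finally show ?thesis .
  qed
  moreover have "\<bar>\<psi> t\<bar> \<le> 1" "t \<notin> A \<longrightarrow> \<psi> t = 0" for t by (auto simp: \<psi>_def \<psi>0_def)
  ultimately show ?thesis using \<psi>_meas by blast
qed

section \<open>A variational principle\<close>

text \<open>The variational principle of Borwein and Preiss; \<open>d\<close> plays the role of a squared distance.\<close>

lemma smooth_variational_principle:
  fixes d :: "'x \<Rightarrow> 'x \<Rightarrow> real" and \<Phi> :: "'x \<Rightarrow> real"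
  assumes x0: "x0 \<in> X"
    and d_nonneg: "\<And>x y. x \<in> X \<Longrightarrow> y \<in> X \<Longrightarrow> 0 \<le> d x y"
    and d_bound: "\<And>x y. x \<in> X \<Longrightarrow> y \<in> X \<Longrightarrow> d x y \<le> b"
    and d_self: "\<And>x. x \<in> X \<Longrightarrow> d x x = 0"
    and \<Phi>_bound: "\<And>x. x \<in> X \<Longrightarrow> \<Phi> x \<le> c"
    and complete: "\<And>y. (\<And>n. y n \<in> X) \<Longrightarrow> (\<And>m n. n \<le> m \<Longrightarrow> d (y m) (y n) \<le> (1 / 4) ^ n) \<Longrightarrow>
      \<exists>z\<in>X. (\<lambda>n. \<Phi> (y n)) \<longlonglongrightarrow> \<Phi> z \<and> (\<forall>x\<in>X. (\<lambda>n. d (y n) x) \<longlonglongrightarrow> d z x)"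
  shows "\<exists>z\<in>X. \<exists>y. (\<forall>n. y n \<in> X) \<and> (\<forall>x\<in>X.
    \<Phi> x - (\<Sum>n. (1 / 2) ^ (n + 2) * d x (y n)) \<le> \<Phi> z - (\<Sum>n. (1 / 2) ^ (n + 2) * d z (y n)))"
proof -
  \<comment> \<open>The weights \<open>\<delta> n\<close> sum to 1/2, the fraction of the energy
    that may be lost later. The tolerance \<open>\<epsilon> n\<close> makes the points approach at
    the rate 4^-n, which \<open>AE_convergent_of_energy_Cauchy\<close> is built for.\<close>
  define \<delta> where "\<delta> n = (1 / 2 :: real) ^ (n + 2)" for n
  define \<epsilon> where "\<epsilon> n = \<delta> n * (1 / 4) ^ n" for n
  have \<delta>: "\<delta> n > 0" and \<epsilon>: "\<epsilon> n > 0" for n by (auto simp: \<delta>_def \<epsilon>_def)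
  \<comment> \<open>A point that maximises \<open>q\<close> up to \<open>\<epsilon> n\<close> and is
    no worse than the current one.\<close>
  define good where "good q n y y' \<longleftrightarrow> y' \<in> X \<and> q y \<le> q y' \<and> (\<forall>x\<in>X. q x \<le> q y' + \<epsilon> n)"
    for q :: "'x \<Rightarrow> real" and n y y'
  have good_ex: "\<exists>y'. good q n y y'" if y: "y \<in> X" and q: "\<And>x. x \<in> X \<Longrightarrow> q x \<le> c" for q n y
  proof -
    have bdd: "bdd_above (q ` X)" using q by (auto simp: bdd_above_def)
    have "Sup (q ` X) - \<epsilon> n < Sup (q ` X)" using \<epsilon> by simp
    then obtain x where x: "x \<in> X" "Sup (q ` X) - \<epsilon> n < q x"
      using less_cSup_iff[OF _ bdd] x0 by blast
    have up: "q w \<le> Sup (q ` X)" if "w \<in> X" for w using that bdd by (intro cSup_upper) auto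
    show ?thesis
    proof (cases "q y \<le> q x")
      case True
      then have "good q n y x" unfolding good_def using x up by fastforce
      then show ?thesis ..
    next
      case False
      then have "good q n y y" unfolding good_def using x up y by fastforce
      then show ?thesis ..
    qed
  qed
  define pick where "pick q n y = (SOME y'. good q n y y')" for q n y
  have pick: "good q n y (pick q n y)" if "y \<in> X" "\<And>x. x \<in> X \<Longrightarrow> q x \<le> c" for q n y
    unfolding pick_def by (rule someI_ex[OF good_ex[OF that]])
  \<comment> \<open>The state is the current functional with the current point. Each round penalises
    the distance to that point and picks a near-maximiser of the penalised functional.\<close>
  define S where "S = rec_nat (\<Phi>, pick \<Phi> 0 x0)
    (\<lambda>n (q, y). (\<lambda>x. q x - \<delta> n * d x y, pick (\<lambda>x. q x - \<delta> n * d x y) (Suc n) y))"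
  define Q where "Q n = fst (S n)" for n
  define y where "y n = snd (S n)" for n
  have Q0: "Q 0 = \<Phi>" and y0: "y 0 = pick \<Phi> 0 x0" by (auto simp: Q_def y_def S_def)
  have QS: "Q (Suc n) = (\<lambda>x. Q n x - \<delta> n * d x (y n))" for n
    by (auto simp: Q_def y_def S_def split: prod.split)
  have yS: "y (Suc n) = pick (Q (Suc n)) (Suc n) (y n)" for n
    by (auto simp: Q_def y_def S_def split: prod.split)
  have inv: "y n \<in> X \<and> (\<forall>x\<in>X. Q n x \<le> c) \<and> (\<forall>x\<in>X. Q n x \<le> Q n (y n) + \<epsilon> n)" for n
  proof (induction n)
    case 0
    have "good \<Phi> 0 x0 (y 0)" unfolding y0 by (rule pick[OF x0 \<Phi>_bound])
    then show ?case using \<Phi>_bound by (auto simp: good_def Q0)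
  next
    case (Suc n)
    then have q: "Q (Suc n) x \<le> c" if "x \<in> X" for x
      unfolding QS using that d_nonneg[of x "y n"] \<delta>[of n]
      by (smt (verit) mult_nonneg_nonneg)
    have "good (Q (Suc n)) (Suc n) (y n) (y (Suc n))"
      unfolding yS by (rule pick) (use Suc q in auto)
    then show ?case using q by (auto simp: good_def)
  qed
  have yX: "y n \<in> X" and near: "x \<in> X \<Longrightarrow> Q n x \<le> Q n (y n) + \<epsilon> n" for n x using inv by auto
  have step: "Q n (y n) \<le> Q (Suc n) (y (Suc n))" for n
  proof -
    have "good (Q (Suc n)) (Suc n) (y n) (y (Suc n))"
      unfolding yS by (rule pick) (use inv in auto)
    then have "Q (Suc n) (y n) \<le> Q (Suc n) (y (Suc n))" by (simp add: good_def)
    then show ?thesis using d_self[OF yX] by (simp add: QS)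
  qed
  have Qdec: "Q m x \<le> Q n x" if "n \<le> m" "x \<in> X" for m n x
    using that(1)
  proof (induction rule: dec_induct)
    case (step k)
    have "0 \<le> \<delta> k * d x (y k)" using d_nonneg[OF that(2) yX] \<delta>[of k] by (simp add: less_imp_le)
    then show ?case using step by (simp add: QS)
  qed simp
  have Qy: "Q n (y n) \<le> Q m (y m)" if "n \<le> m" for m n
    using that by (induction rule: dec_induct) (auto intro: order_trans[OF _ step])
  have low: "Q n (y n) \<le> Q (Suc n) (y m)" if "n \<le> m" for m n
  proof (cases "m = n")
    case True
    then show ?thesis using d_self[OF yX] by (simp add: QS)
  next
    case False
    then have "Suc n \<le> m" using that by simp
    then show ?thesis using Qy[OF that] Qdec[of "Suc n" m "y m"] yX by (meson order_trans)
  qed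
  have "d (y m) (y n) \<le> (1 / 4) ^ n" if "n \<le> m" for m n
  proof -
    \<comment> \<open>At \<open>y m\<close> the functional \<open>Q n\<close> exceeds
      \<open>Q n (y n)\<close> by at most \<open>\<epsilon> n\<close>, yet after subtracting the
      penalty it is still at least \<open>Q n (y n)\<close>. So the penalty is at most
      \<open>\<epsilon> n\<close>.\<close>
    have "\<delta> n * d (y m) (y n) \<le> \<epsilon> n"
      using low[OF that] near[OF yX, of n m] by (simp add: QS)
    then show ?thesis using \<delta>[of n] by (simp add: \<epsilon>_def)
  qed
  from complete[OF yX this] obtain z where z: "z \<in> X" "(\<lambda>n. \<Phi> (y n)) \<longlonglongrightarrow> \<Phi> z"
    "\<And>x. x \<in> X \<Longrightarrow> (\<lambda>n. d (y n) x) \<longlonglongrightarrow> d z x" by auto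
  have Q_sum: "Q n x = \<Phi> x - (\<Sum>i<n. \<delta> i * d x (y i))" for n x
    by (induction n) (auto simp: Q0 QS)
  have Q_lim: "(\<lambda>n. Q n x) \<longlonglongrightarrow> \<Phi> x - (\<Sum>i. \<delta> i * d x (y i))" if x: "x \<in> X" for x
  proof -
    have "summable (\<lambda>i. \<delta> i * b)"
      unfolding \<delta>_def power_add by (intro summable_mult2 summable_geometric) simp
    then have "summable (\<lambda>i. \<delta> i * d x (y i))"
    proof (rule summable_comparison_test[rotated])
      have "norm (\<delta> n * d x (y n)) \<le> \<delta> n * b" for n
        using d_nonneg[OF x yX] d_bound[OF x yX] \<delta>[of n] by (simp add: abs_mult)
      then show "\<exists>N. \<forall>n\<ge>N. norm (\<delta> n * d x (y n)) \<le> \<delta> n * b" by blast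
    qed
    then show ?thesis unfolding Q_sum by (intro tendsto_diff tendsto_const summable_LIMSEQ)
  qed
  have zlow: "Q n (y n) \<le> Q (Suc n) z" for n
  proof (rule LIMSEQ_le_const)
    show "(\<lambda>m. Q (Suc n) (y m)) \<longlonglongrightarrow> Q (Suc n) z"
      unfolding Q_sum by (intro tendsto_intros z yX)
    show "\<exists>N. \<forall>m\<ge>N. Q n (y n) \<le> Q (Suc n) (y m)" using low by blast
  qed
  have "\<Phi> x - (\<Sum>i. \<delta> i * d x (y i)) \<le> \<Phi> z - (\<Sum>i. \<delta> i * d z (y i))" if x: "x \<in> X" for x
  proof (rule LIMSEQ_le)
    show "(\<lambda>n. Q n x) \<longlonglongrightarrow> \<Phi> x - (\<Sum>i. \<delta> i * d x (y i))" by (rule Q_lim[OF x])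
    have "(\<lambda>n. \<epsilon> n) \<longlonglongrightarrow> 0"
    proof -
      have "(\<lambda>n. (1 / 4) * (1 / 8 :: real) ^ n) \<longlonglongrightarrow> (1 / 4) * 0"
        by (intro tendsto_mult tendsto_const LIMSEQ_power_zero) simp
      moreover have "\<epsilon> = (\<lambda>n. (1 / 4) * (1 / 8) ^ n)"
        by (simp add: \<epsilon>_def \<delta>_def power_add fun_eq_iff flip: power_mult_distrib)
      ultimately show ?thesis by simp
    qed
    with LIMSEQ_Suc[OF Q_lim[OF z(1)]]
    show "(\<lambda>n. Q (Suc n) z + \<epsilon> n) \<longlonglongrightarrow> \<Phi> z - (\<Sum>i. \<delta> i * d z (y i))"
      using tendsto_add by fastforce
    \<comment> \<open>Near-maximality of \<open>y n\<close> is passed to the limit point through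
      \<open>zlow\<close>; the tolerance then vanishes as n grows.\<close>
    have "Q n x \<le> Q (Suc n) z + \<epsilon> n" for n using near[OF x, of n] zlow[of n] by simp
    then show "\<exists>N. \<forall>n\<ge>N. Q n x \<le> Q (Suc n) z + \<epsilon> n" by blast
  qed
  then show ?thesis unfolding \<delta>_def using z(1) yX by blast
qed

section \<open>Coordinates on the dual ball\<close>

lemma tendsto_fun_iff:
  fixes f :: "'n \<Rightarrow> 'i \<Rightarrow> 'b::topological_space"
  shows "(f \<longlongrightarrow> l) F \<longleftrightarrow> (\<forall>i. ((\<lambda>n. f n i) \<longlongrightarrow> l i) F)"
  using limitin_componentwise[of "\<lambda>_. euclidean" UNIV f l F]
  by (simp add: euclidean_product_topology)

lemma limitin_weak_star_iff:
  "limitin weak_star U u F \<longleftrightarrow> (\<forall>x. ((\<lambda>n. blinfun_apply (U n) x) \<longlongrightarrow> blinfun_apply u x) F)"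
proof
  assume h: "limitin weak_star U u F"
  show "\<forall>x. ((\<lambda>n. blinfun_apply (U n) x) \<longlongrightarrow> blinfun_apply u x) F"
  proof
    fix x
    show "((\<lambda>n. blinfun_apply (U n) x) \<longlongrightarrow> blinfun_apply u x) F"
      using continuous_map_limit[OF strong_operator_topology_continuous_evaluation h, of x]
      by (simp add: o_def)
  qed
next
  assume "\<forall>x. ((\<lambda>n. blinfun_apply (U n) x) \<longlongrightarrow> blinfun_apply u x) F"
  then have lim: "((\<lambda>n. blinfun_apply (U n)) \<longlongrightarrow> blinfun_apply u) F" by (simp add: tendsto_fun_iff)
  show "limitin weak_star U u F"
    unfolding limitin_def
  proof (intro conjI allI impI)
    show "u \<in> topspace weak_star" by (simp add: strong_operator_topology_topspace)
    fix T assume T: "openin weak_star T \<and> u \<in> T"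
    then obtain V where V: "open V" "T = blinfun_apply -` V"
      unfolding strong_operator_topology_def openin_pullback_topology by auto
    then have "\<forall>\<^sub>F n in F. blinfun_apply (U n) \<in> V"
      using T by (intro topological_tendstoD[OF lim]) auto
    then show "\<forall>\<^sub>F n in F. U n \<in> T" by (simp add: V(2))
  qed
qed

lemma closedin_weak_star_halfspace:
  "closedin weak_star {u. blinfun_apply u x \<le> c}"
  using closedin_continuous_map_preimage[OF strong_operator_topology_continuous_evaluation, of "{..c}" x]
  by (simp add: strong_operator_topology_topspace)

lemma convex_halfspace: "convex {u :: 'e::real_normed_vector \<Rightarrow>\<^sub>L real. blinfun_apply u x \<le> c}"
  by (auto simp: convex_def blinfun.add_left blinfun.scaleR_left intro!: convex_bound_le)

lemma compact_box: "compact {p :: nat \<Rightarrow> real. \<forall>m. \<bar>p m\<bar> \<le> r m}"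
proof -
  have "compactin (product_topology (\<lambda>_. euclidean) UNIV) (PiE UNIV (\<lambda>m. {- r m..r m}))"
    by (simp add: compactin_PiE compactin_euclidean_iff)
  moreover have "PiE UNIV (\<lambda>m. {- r m..r m}) = {p. \<forall>m. \<bar>p m\<bar> \<le> r m}"
    by (auto simp: PiE_iff abs_le_iff minus_le_iff)
  ultimately show ?thesis by (simp add: euclidean_product_topology compactin_euclidean_iff)
qed

locale dual_coordinates =
  fixes z :: "nat \<Rightarrow> 'e::banach"
  assumes norm_z: "norm (z m) \<le> (1 / 2) ^ m"
    and dense_z: "e > 0 \<Longrightarrow> \<exists>m c. 0 < c \<and> norm (x - c *\<^sub>R z m) < e"
begin

definition coord :: "('e \<Rightarrow>\<^sub>L real) \<Rightarrow> nat \<Rightarrow> real" where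
  "coord u m = blinfun_apply u (z m)"

lemma coord_simps [simp]:
  "coord (u + v) m = coord u m + coord v m"
  "coord (u - v) m = coord u m - coord v m"
  "coord (c *\<^sub>R u) m = c * coord u m"
  "coord 0 m = 0"
  by (simp_all add: coord_def blinfun.add_left blinfun.diff_left blinfun.scaleR_left)

lemma abs_coord_le: "\<bar>coord u m\<bar> \<le> norm u * (1 / 2) ^ m"
proof -
  have "\<bar>coord u m\<bar> \<le> norm u * norm (z m)"
    unfolding coord_def using norm_blinfun[of u "z m"] by simp
  also have "\<dots> \<le> norm u * (1 / 2) ^ m" by (intro mult_left_mono norm_z) auto
  finally show ?thesis .
qed

lemma abs_coord_le': "norm u \<le> r \<Longrightarrow> \<bar>coord u m\<bar> \<le> r * (1 / 2) ^ m"
  using abs_coord_le[of u m] by (smt (verit) mult_right_mono zero_le_power zero_le_divide_1_iff)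

lemma coord_zero_imp:
  assumes "\<And>m. coord u m = 0"
  shows "u = 0"
proof (rule blinfun_eqI)
  fix x
  have "\<bar>blinfun_apply u x\<bar> \<le> 0 + e" if e: "e > 0" for e
  proof -
    have "e / (norm u + 1) > 0" using e by (simp add: add_nonneg_pos)
    then obtain m c where c: "norm (x - c *\<^sub>R z m) < e / (norm u + 1)" using dense_z by blast
    have "blinfun_apply u x = blinfun_apply u (x - c *\<^sub>R z m)"
      using assms[of m] by (simp add: blinfun.diff_right blinfun.scaleR_right coord_def)
    then have "\<bar>blinfun_apply u x\<bar> \<le> norm u * norm (x - c *\<^sub>R z m)"
      using norm_blinfun[of u "x - c *\<^sub>R z m"] by simp
    also have "\<dots> \<le> (norm u + 1) * (e / (norm u + 1))"
      using c by (intro mult_mono) auto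
    also have "\<dots> = e" by (simp add: add_nonneg_eq_0_iff)
    finally show ?thesis by simp
  qed
  then have "\<bar>blinfun_apply u x\<bar> \<le> 0" by (rule field_le_epsilon)
  then show "blinfun_apply u x = blinfun_apply 0 x" by simp
qed

lemma inj_coord: "inj coord"
proof (rule injI)
  fix u v assume "coord u = coord v"
  then have "u - v = 0" by (intro coord_zero_imp) simp
  then show "u = v" by simp
qed

text \<open>Convergence on the \<open>z m\<close> spreads to every \<open>x\<close> by density and
  the uniform bound, and the pointwise limit of bounded functionals is again one. No candidate for
  the limit has to be known in advance.\<close>

lemma coord_limit:
  assumes bnd: "\<And>n. norm (U n) \<le> r" and lim: "\<And>m. (\<lambda>n. coord (U n) m) \<longlonglongrightarrow> p m"
  shows "\<exists>u. norm u \<le> r \<and> coord u = p \<and> (\<forall>x. (\<lambda>n. blinfun_apply (U n) x) \<longlonglongrightarrow> blinfun_apply u x)"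
proof -
  have r: "0 \<le> r" using bnd[of 0] norm_ge_zero[of "U 0"] by linarith
  have Cauchy: "Cauchy (\<lambda>n. blinfun_apply (U n) x)" for x
  proof (rule metric_CauchyI)
    fix e :: real assume e: "e > 0"
    \<comment> \<open>Two approximation errors of e/4 and a coordinate difference below e/2 add up
      to less than e.\<close>
    then have "e / (4 * (r + 1)) > 0" using r by simp
    then obtain m c where c: "0 < c" "norm (x - c *\<^sub>R z m) < e / (4 * (r + 1))" using dense_z by blast
    have "Cauchy (\<lambda>n. coord (U n) m)" using lim[of m] LIMSEQ_imp_Cauchy by blast
    then obtain N where N: "\<And>k n. k \<ge> N \<Longrightarrow> n \<ge> N \<Longrightarrow> dist (coord (U k) m) (coord (U n) m) < e / (2 * c)"
      using metric_CauchyD[of "\<lambda>n. coord (U n) m" "e / (2 * c)"] e c(1) by auto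
    have small: "\<bar>blinfun_apply (U n) (x - c *\<^sub>R z m)\<bar> \<le> e / 4" for n
    proof -
      have "\<bar>blinfun_apply (U n) (x - c *\<^sub>R z m)\<bar> \<le> norm (U n) * norm (x - c *\<^sub>R z m)"
        using norm_blinfun[of "U n" "x - c *\<^sub>R z m"] by simp
      also have "\<dots> \<le> (r + 1) * (e / (4 * (r + 1)))"
        using c bnd[of n] r by (intro mult_mono) auto
      also have "\<dots> = e / 4" using r by (simp add: field_simps)
      finally show ?thesis .
    qed
    have split: "blinfun_apply (U n) x = blinfun_apply (U n) (x - c *\<^sub>R z m) + c * coord (U n) m" for n
      by (simp add: blinfun.diff_right blinfun.scaleR_right coord_def)
    have "dist (blinfun_apply (U k) x) (blinfun_apply (U n) x) < e" if "k \<ge> N" "n \<ge> N" for k n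
    proof -
      have "c * \<bar>coord (U k) m - coord (U n) m\<bar> < c * (e / (2 * c))"
        using N[OF that] c(1) by (intro mult_strict_left_mono) (auto simp: dist_real_def)
      also have "\<dots> = e / 2" using c(1) by simp
      finally have "\<bar>c * coord (U k) m - c * coord (U n) m\<bar> < e / 2"
        using c(1) by (simp add: abs_mult flip: right_diff_distrib)
      then show ?thesis
        using small[of k] small[of n] unfolding split[of k] split[of n] dist_real_def by linarith
    qed
    then show "\<exists>N. \<forall>k\<ge>N. \<forall>n\<ge>N. dist (blinfun_apply (U k) x) (blinfun_apply (U n) x) < e" by blast
  qed
  define f where "f x = lim (\<lambda>n. blinfun_apply (U n) x)" for x
  have f: "(\<lambda>n. blinfun_apply (U n) x) \<longlonglongrightarrow> f x" for x
    unfolding f_def using Cauchy Cauchy_convergent_iff convergent_LIMSEQ_iff by blast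
  have f_bound: "norm (f x) \<le> r * norm x" for x
  proof (rule LIMSEQ_le_const2[OF tendsto_norm[OF f]])
    have "norm (blinfun_apply (U n) x) \<le> r * norm x" for n
      using norm_blinfun[of "U n" x] mult_right_mono[OF bnd[of n] norm_ge_zero[of x]] by linarith
    then show "\<exists>N. \<forall>n\<ge>N. norm (blinfun_apply (U n) x) \<le> r * norm x" by blast
  qed
  have "bounded_linear f"
  proof (rule bounded_linear_intro[where K = r])
    show "f (x + y) = f x + f y" for x y
      using LIMSEQ_unique[OF f[of "x + y"]] tendsto_add[OF f[of x] f[of y]]
      by (simp add: blinfun.add_right)
    show "f (a *\<^sub>R x) = a *\<^sub>R f x" for a x
      using LIMSEQ_unique[OF f[of "a *\<^sub>R x"]] tendsto_mult_left[OF f[of x], of a]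
      by (simp add: blinfun.scaleR_right)
    show "norm (f x) \<le> norm x * r" for x using f_bound[of x] by (simp add: mult.commute)
  qed
  then have app: "blinfun_apply (Blinfun f) = f" by (rule bounded_linear_Blinfun_apply)
  have "norm (Blinfun f) \<le> r" using f_bound r by (intro norm_blinfun_bound) (auto simp: app)
  moreover have "coord (Blinfun f) = p"
  proof
    fix m show "coord (Blinfun f) m = p m"
      using LIMSEQ_unique[OF f[of "z m"]] lim[of m] by (simp add: coord_def app)
  qed
  ultimately show ?thesis using f app by auto
qed

lemma coord_limit_weak_star:
  assumes "\<And>n. norm (U n) \<le> r" and "\<And>m. (\<lambda>n. coord (U n) m) \<longlonglongrightarrow> coord u m"
  shows "limitin weak_star U u sequentially" and "norm u \<le> r"
proof -
  obtain v where v: "norm v \<le> r" "coord v = coord u"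
    "\<forall>x. (\<lambda>n. blinfun_apply (U n) x) \<longlonglongrightarrow> blinfun_apply v x"
    using coord_limit[OF assms] by blast
  have "v = u" using inj_coord v(2) by (rule injD)
  then show "limitin weak_star U u sequentially" "norm u \<le> r"
    using v by (simp_all add: limitin_weak_star_iff)
qed

text \<open>Sequential Banach-Alaoglu: the coordinates stay in a compact box, and
  \<open>coord_limit\<close> turns the limit of a subsequence into a functional, which belongs to
  the closed set \<open>F\<close>.\<close>

lemma compact_coord_image:
  assumes cl: "closedin weak_star F" and bnd: "\<And>u. u \<in> F \<Longrightarrow> norm u \<le> r"
  shows "compact (coord ` F)"
  unfolding compact_eq_seq_compact_metric seq_compact_def
proof (intro allI impI)
  fix q :: "nat \<Rightarrow> nat \<Rightarrow> real" assume "\<forall>n. q n \<in> coord ` F"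
  then have "\<forall>n. \<exists>u. u \<in> F \<and> q n = coord u" by blast
  then obtain U where U: "\<And>n. U n \<in> F" "\<And>n. q n = coord (U n)" by metis
  have "q n \<in> {p. \<forall>m. \<bar>p m\<bar> \<le> r * (1 / 2) ^ m}" for n
    using abs_coord_le'[OF bnd[OF U(1)]] by (simp add: U(2))
  then have box: "\<forall>n. q n \<in> {p. \<forall>m. \<bar>p m\<bar> \<le> r * (1 / 2) ^ m}" ..
  have "seq_compact {p. \<forall>m. \<bar>p m\<bar> \<le> r * (1 / 2) ^ m}"
    using compact_box by (simp add: compact_eq_seq_compact_metric)
  from seq_compactE[OF this box] obtain l s where s: "strict_mono s" "(q \<circ> s) \<longlonglongrightarrow> l" .
  then have "(\<lambda>n. coord (U (s n)) m) \<longlonglongrightarrow> l m" for m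
    by (simp add: tendsto_fun_iff U(2) o_def)
  from coord_limit[of "\<lambda>n. U (s n)", OF bnd[OF U(1)] this]
  obtain u where u: "coord u = l" "\<forall>x. (\<lambda>n. blinfun_apply (U (s n)) x) \<longlonglongrightarrow> blinfun_apply u x"
    by blast
  have "u \<in> F"
    by (rule limitin_closedin[of weak_star "\<lambda>n. U (s n)" u sequentially])
      (use u(2) cl U(1) in \<open>auto simp: limitin_weak_star_iff\<close>)
  then show "\<exists>l\<in>coord ` F. \<exists>s. strict_mono s \<and> (q \<circ> s) \<longlonglongrightarrow> l"
    using s u(1) by blast
qed

text \<open>Converse of \<open>compact_coord_image\<close>: \<open>coord\<close> is weak-star
  continuous and injective, so \<open>F\<close> is the preimage of a closed set.\<close>

lemma closedin_weak_starI:
  assumes "compact (coord ` F)"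
  shows "closedin weak_star F"
proof -
  have "continuous_map weak_star euclidean coord"
    unfolding coord_def[abs_def] euclidean_product_topology[symmetric] continuous_map_componentwise_UNIV
    by (intro allI strong_operator_topology_continuous_evaluation)
  from closedin_continuous_map_preimage[OF this, of "coord ` F"]
  have "closedin weak_star {u. coord u \<in> coord ` F}"
    using assms by (simp add: strong_operator_topology_topspace compact_imp_closed)
  moreover have "{u. coord u \<in> coord ` F} = F" using inj_coord by (auto simp: inj_image_mem_iff)
  ultimately show ?thesis by simp
qed

section \<open>The Hilbert structure pulled back from square summable sequences\<close>

definition inner_dual :: "('e \<Rightarrow>\<^sub>L real) \<Rightarrow> ('e \<Rightarrow>\<^sub>L real) \<Rightarrow> real" where
  "inner_dual u v = (\<Sum>m. coord u m * coord v m)"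

definition riesz :: "('e \<Rightarrow>\<^sub>L real) \<Rightarrow> 'e" where
  "riesz u = (\<Sum>m. coord u m *\<^sub>R z m)"

lemma coord_mult_le:
  assumes "norm u \<le> r" "norm v \<le> s"
  shows "\<bar>coord u m * coord v m\<bar> \<le> r * s * (1 / 4) ^ m"
proof -
  have "\<bar>coord u m\<bar> * \<bar>coord v m\<bar> \<le> (r * (1 / 2) ^ m) * (s * (1 / 2) ^ m)"
    using assms by (intro mult_mono abs_coord_le') (auto intro!: mult_nonneg_nonneg intro: order_trans[OF norm_ge_zero])
  also have "\<dots> = r * s * (1 / 4) ^ m"
    by (simp add: power_divide flip: power_mult_distrib)
  finally show ?thesis by (simp add: abs_mult)
qed

lemma summable_inner_dual: "summable (\<lambda>m. coord u m * coord v m)"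
proof (rule summable_comparison_test)
  show "summable (\<lambda>m. norm u * norm v * (1 / 4 :: real) ^ m)"
    by (intro summable_mult summable_geometric) simp
  show "\<exists>N. \<forall>m\<ge>N. norm (coord u m * coord v m) \<le> norm u * norm v * (1 / 4) ^ m"
    using coord_mult_le[of u "norm u" v "norm v"] by auto
qed

lemma apply_riesz: "blinfun_apply v (riesz u) = inner_dual u v"
proof -
  have "summable (\<lambda>m. coord u m *\<^sub>R z m)"
  proof (rule summable_comparison_test)
    show "summable (\<lambda>m. norm u * (1 / 4 :: real) ^ m)"
      by (intro summable_mult summable_geometric) simp
    have "norm (coord u m *\<^sub>R z m) \<le> norm u * (1 / 4) ^ m" for m
    proof -
      have "\<bar>coord u m\<bar> * norm (z m) \<le> (norm u * (1 / 2) ^ m) * (1 / 2) ^ m"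
        by (intro mult_mono abs_coord_le norm_z) auto
      also have "\<dots> = norm u * (1 / 4) ^ m" by (simp add: power_divide flip: power_mult_distrib)
      finally show ?thesis by simp
    qed
    then show "\<exists>N. \<forall>m\<ge>N. norm (coord u m *\<^sub>R z m) \<le> norm u * (1 / 4) ^ m" by blast
  qed
  then show ?thesis
    unfolding riesz_def inner_dual_def
    using bounded_linear.suminf[OF blinfun.bounded_linear_right, of "\<lambda>m. coord u m *\<^sub>R z m" v]
    by (simp add: blinfun.scaleR_right coord_def)
qed

lemma inner_dual_add_right: "inner_dual u (v + w) = inner_dual u v + inner_dual u w"
  and inner_dual_scaleR_right: "inner_dual u (c *\<^sub>R v) = c * inner_dual u v"
  and inner_dual_commute: "inner_dual u v = inner_dual v u"
  by (simp_all add: apply_riesz[symmetric] blinfun.add_left blinfun.scaleR_left)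
    (simp add: apply_riesz inner_dual_def mult.commute)

lemma inner_dual_self_nonneg: "0 \<le> inner_dual u u"
  unfolding inner_dual_def by (intro suminf_nonneg summable_inner_dual) auto

lemma inner_dual_self_le: "norm u \<le> r \<Longrightarrow> inner_dual u u \<le> 2 * r\<^sup>2"
proof -
  assume r: "norm u \<le> r"
  have "inner_dual u u \<le> (\<Sum>m. r * r * (1 / 4) ^ m)"
    unfolding inner_dual_def
    using coord_mult_le[OF r r] by (intro suminf_le summable_inner_dual summable_mult summable_geometric) (auto simp: abs_le_iff)
  \<comment> \<open>The geometric series of ratio 1/4; its sum is then rounded up to 2.\<close>
  also have "\<dots> = r * r * (4 / 3)"
    by (subst suminf_mult) (auto simp: suminf_geometric)
  also have "\<dots> \<le> 2 * r\<^sup>2" by (simp add: power2_eq_square)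
  finally show ?thesis .
qed

lemma coord_square_le: "(coord u m)\<^sup>2 \<le> inner_dual u u"
proof -
  have "(\<Sum>k\<in>{m}. coord u k * coord u k) \<le> inner_dual u u"
    unfolding inner_dual_def by (intro sum_le_suminf summable_inner_dual) auto
  then show ?thesis by (simp add: power2_eq_square)
qed

lemma inner_dual_self_eq_0: "inner_dual u u = 0 \<longleftrightarrow> u = 0"
proof
  assume "inner_dual u u = 0"
  then have "coord u m = 0" for m using coord_square_le[of u m] by simp
  then show "u = 0" by (rule coord_zero_imp)
qed (simp add: inner_dual_def)

text \<open>Tannery's theorem with the majorant r^2 4^-m. On bounded sets the quadratic form is
  therefore sequentially weak-star continuous, whereas the dual norm is in general only lower
  semicontinuous.\<close>

lemma inner_dual_self_tendsto:
  assumes bnd: "\<And>n. norm (U n) \<le> r" and lim: "\<And>m. (\<lambda>n. coord (U n) m) \<longlonglongrightarrow> coord u m"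
  shows "(\<lambda>n. inner_dual (U n) (U n)) \<longlonglongrightarrow> inner_dual u u"
proof -
  have "((\<lambda>n. suminf (\<lambda>m. coord (U n) m * coord (U n) m)) \<longlonglongrightarrow> suminf (\<lambda>m. coord u m * coord u m))"
  proof (rule tannerys_theorem[THEN conjunct2, THEN conjunct2])
    show "(\<lambda>n. coord (U n) k * coord (U n) k) \<longlonglongrightarrow> coord u k * coord u k" for k
      by (intro tendsto_mult lim)
    show "summable (\<lambda>m. r * r * (1 / 4 :: real) ^ m)" by (intro summable_mult summable_geometric) simp
    have "norm (coord (U n) k * coord (U n) k) \<le> r * r * (1 / 4) ^ k" for k n
      using coord_mult_le[OF bnd[of n] bnd[of n], of k] by simp
    then show "\<forall>\<^sub>F (k, n) in sequentially \<times>\<^sub>F sequentially. norm (coord (U n) k * coord (U n) k) \<le> r * r * (1 / 4) ^ k"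
      by (intro always_eventually allI) (simp only: case_prod_beta)
  qed simp
  then show ?thesis by (simp add: inner_dual_def)
qed

lemma inner_dual_self_add:
  "inner_dual (u + v) (u + v) = inner_dual u u + 2 * inner_dual u v + inner_dual v v"
  using inner_dual_commute[of u v] by (simp add: inner_dual_add_right inner_dual_commute[of "u + v"])

end

section \<open>Weak-star closed convex hulls: sequences, separation, extreme points\<close>

context dual_coordinates
begin

abbreviation hull_closed :: "('e \<Rightarrow>\<^sub>L real) set \<Rightarrow> ('e \<Rightarrow>\<^sub>L real) set" where
  "hull_closed \<equiv> weak_star_closed_convex_hull"

lemma closedin_hull_closed: "closedin weak_star (hull_closed C)"
  unfolding weak_star_closed_convex_hull_def by simp

lemma hull_subset_hull_closed: "convex hull C \<subseteq> hull_closed C"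
  unfolding weak_star_closed_convex_hull_def
  by (rule closure_of_subset) (simp add: strong_operator_topology_topspace)

lemma subset_hull_closed: "C \<subseteq> hull_closed C"
  using hull_subset[of C convex] hull_subset_hull_closed by blast

lemma hull_closed_minimal: "C \<subseteq> D \<Longrightarrow> convex D \<Longrightarrow> closedin weak_star D \<Longrightarrow> hull_closed C \<subseteq> D"
  unfolding weak_star_closed_convex_hull_def by (intro closure_of_minimal hull_minimal)

lemma hull_closed_mono: "C \<subseteq> D \<Longrightarrow> hull_closed C \<subseteq> hull_closed D"
  unfolding weak_star_closed_convex_hull_def by (intro closure_of_mono hull_mono)

lemma hull_closed_empty [simp]: "hull_closed {} = {}"
  by (simp add: weak_star_closed_convex_hull_def)

lemma hull_closed_halfspace:
  assumes "\<And>u. u \<in> C \<Longrightarrow> blinfun_apply u x \<le> c" and "v \<in> hull_closed C"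
  shows "blinfun_apply v x \<le> c"
  using hull_closed_minimal[of C "{u. blinfun_apply u x \<le> c}"] assms
    convex_halfspace[of x c] closedin_weak_star_halfspace[of x c] by blast

text \<open>The neighbourhoods that control the first n + 1 coordinates up to 1/(n+1) already
  produce the sequence. It becomes weak-star convergent once \<open>C\<close> is bounded, by
  \<open>coord_limit_weak_star\<close>.\<close>

lemma hull_closed_sequence:
  assumes "u \<in> hull_closed C"
  shows "\<exists>U. (\<forall>n. U n \<in> convex hull C) \<and> (\<forall>m. (\<lambda>n. coord (U n) m) \<longlonglongrightarrow> coord u m)"
proof -
  have "\<exists>v. v \<in> convex hull C \<and> (\<forall>m\<le>n. \<bar>coord v m - coord u m\<bar> < 1 / Suc n)" for n
  proof -
    define T where "T = {f. \<forall>m\<in>{..n}. blinfun_apply f (z m) \<in> ball (coord u m) (1 / Suc n)}"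
    have "openin weak_star T" unfolding T_def by (intro strong_operator_topology_basis) auto
    moreover have "u \<in> T" by (simp add: T_def coord_def)
    ultimately obtain v where v: "v \<in> convex hull C" "v \<in> T"
      using assms unfolding weak_star_closed_convex_hull_def in_closure_of by blast
    have "\<bar>coord v m - coord u m\<bar> < 1 / Suc n" if "m \<le> n" for m
      using v(2) that by (auto simp: T_def coord_def dist_real_def abs_minus_commute)
    then show ?thesis using v(1) by (intro exI[of _ v]) simp
  qed
  then obtain U where U: "\<And>n. U n \<in> convex hull C" "\<And>n m. m \<le> n \<Longrightarrow> \<bar>coord (U n) m - coord u m\<bar> < 1 / Suc n"
    by metis
  have "(\<lambda>n. coord (U n) m) \<longlonglongrightarrow> coord u m" for m
  proof (rule LIM_zero_cancel, rule Lim_null_comparison)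
    show "\<forall>\<^sub>F n in sequentially. norm (coord (U n) m - coord u m) \<le> 1 / Suc n"
      by (rule eventually_mono[OF eventually_ge_at_top[of m]]) (use U(2) in \<open>auto intro: less_imp_le\<close>)
    show "(\<lambda>n. 1 / real (Suc n)) \<longlonglongrightarrow> 0" by (rule LIMSEQ_Suc[OF lim_const_over_n])
  qed
  then show ?thesis using U(1) by blast
qed

lemma norm_convex_hull_le:
  assumes "\<And>u. u \<in> C \<Longrightarrow> norm u \<le> r" and "v \<in> convex hull C"
  shows "norm v \<le> r"
proof -
  have "convex hull C \<subseteq> cball 0 r" using assms(1) by (intro hull_minimal) auto
  then show ?thesis using assms(2) by auto
qed

lemma norm_hull_closed_le:
  assumes bnd: "\<And>u. u \<in> C \<Longrightarrow> norm u \<le> r" and "v \<in> hull_closed C"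
  shows "norm v \<le> r"
proof -
  obtain U where U: "\<forall>n. U n \<in> convex hull C" "\<forall>m. (\<lambda>n. coord (U n) m) \<longlonglongrightarrow> coord v m"
    using hull_closed_sequence[OF assms(2)] by blast
  show ?thesis
    by (rule coord_limit_weak_star(2)[of U]) (use U norm_convex_hull_le[OF bnd] in auto)
qed

lemma hull_closedI:
  assumes bnd: "\<And>u. u \<in> C \<Longrightarrow> norm u \<le> r" and U: "\<And>n. U n \<in> hull_closed C"
    and lim: "\<And>m. (\<lambda>n. coord (U n) m) \<longlonglongrightarrow> coord v m"
  shows "v \<in> hull_closed C"
proof (rule limitin_closedin)
  show "limitin weak_star U v sequentially"
    by (rule coord_limit_weak_star(1)[OF norm_hull_closed_le[OF bnd U] lim])
  show "\<forall>\<^sub>F n in sequentially. U n \<in> hull_closed C" using U by simp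
qed (auto intro: closedin_hull_closed)

lemma compact_coord_hull:
  assumes "\<And>u. u \<in> C \<Longrightarrow> norm u \<le> r"
  shows "compact (coord ` hull_closed C)"
  using closedin_hull_closed norm_hull_closed_le[OF assms] by (rule compact_coord_image)

lemma convex_hull_closed:
  assumes bnd: "\<And>u. u \<in> C \<Longrightarrow> norm u \<le> r"
  shows "convex (hull_closed C)"
proof (rule convexI)
  fix u v and a b :: real
  assume u: "u \<in> hull_closed C" and v: "v \<in> hull_closed C" and ab: "0 \<le> a" "0 \<le> b" "a + b = 1"
  obtain U where U: "\<forall>n. U n \<in> convex hull C" "\<forall>m. (\<lambda>n. coord (U n) m) \<longlonglongrightarrow> coord u m"
    using hull_closed_sequence[OF u] by blast
  obtain V where V: "\<forall>n. V n \<in> convex hull C" "\<forall>m. (\<lambda>n. coord (V n) m) \<longlonglongrightarrow> coord v m"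
    using hull_closed_sequence[OF v] by blast
  show "a *\<^sub>R u + b *\<^sub>R v \<in> hull_closed C"
  proof (rule hull_closedI[OF bnd])
    show "a *\<^sub>R U n + b *\<^sub>R V n \<in> hull_closed C" for n
      using convexD[OF convex_convex_hull, of "U n" C "V n" a b] U(1) V(1) ab hull_subset_hull_closed by blast
    show "(\<lambda>n. coord (a *\<^sub>R U n + b *\<^sub>R V n) m) \<longlonglongrightarrow> coord (a *\<^sub>R u + b *\<^sub>R v) m" for m
      using U(2) V(2) by (auto intro!: tendsto_intros)
  qed
qed

text \<open>The squared distance is continuous on the compact coordinate image of the hull, where it
  is read through \<open>inv coord\<close>.\<close>

lemma nearest_point_hull_closed:
  assumes bnd: "\<And>u. u \<in> C \<Longrightarrow> norm u \<le> r" and ne: "hull_closed C \<noteq> {}"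
  shows "\<exists>p\<in>hull_closed C. \<forall>v\<in>hull_closed C. inner_dual (p - y) (p - y) \<le> inner_dual (v - y) (v - y)"
proof -
  let ?K = "hull_closed C"
  define g where "g q = inner_dual (inv coord q - y) (inv coord q - y)" for q
  have g: "g (coord u) = inner_dual (u - y) (u - y)" for u
    using inv_f_f[OF inj_coord] by (simp add: g_def)
  have "continuous_on (coord ` ?K) g"
    unfolding continuous_on_sequentially
  proof (intro allI ballI impI)
    fix x a assume a: "a \<in> coord ` ?K" and x: "(\<forall>n. x n \<in> coord ` ?K) \<and> x \<longlonglongrightarrow> a"
    obtain u where u: "u \<in> ?K" "a = coord u" using a by blast
    have "\<forall>n. \<exists>w. w \<in> ?K \<and> x n = coord w" using x by blast
    then obtain U where U: "\<And>n. U n \<in> ?K" "\<And>n. x n = coord (U n)" by metis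
    have "(\<lambda>n. inner_dual (U n - y) (U n - y)) \<longlonglongrightarrow> inner_dual (u - y) (u - y)"
    proof (rule inner_dual_self_tendsto)
      show "norm (U n - y) \<le> r + norm y" for n
        using norm_triangle_ineq4[of "U n" y] norm_hull_closed_le[OF bnd U(1)[of n]] by linarith
      show "(\<lambda>n. coord (U n - y) m) \<longlonglongrightarrow> coord (u - y) m" for m
        using x by (auto simp: tendsto_fun_iff U(2) u(2) intro!: tendsto_intros)
    qed
    then show "(g \<circ> x) \<longlonglongrightarrow> g a" by (simp add: o_def U(2) u(2) g)
  qed
  from continuous_attains_inf[OF compact_coord_hull[OF bnd] _ this]
  obtain a where a: "a \<in> coord ` ?K" "\<forall>b\<in>coord ` ?K. g a \<le> g b" using ne by auto
  then obtain p where p: "p \<in> ?K" "a = coord p" by blast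
  have "g (coord p) \<le> g (coord v)" if "v \<in> ?K" for v using a(2) that unfolding p(2) by blast
  then show ?thesis using p(1) unfolding g by blast
qed

text \<open>The separating functional is the gradient of the distance at the nearest point; \<open>riesz\<close> shows
  that it is the evaluation at a point of the predual.\<close>

lemma hull_closed_separation:
  assumes bnd: "\<And>u. u \<in> C \<Longrightarrow> norm u \<le> r" and y: "y \<notin> hull_closed C"
  shows "\<exists>m. \<exists>\<gamma>>0. \<forall>v\<in>hull_closed C. coord v m \<le> coord y m - \<gamma>"
proof (cases "hull_closed C = {}")
  case True
  then show ?thesis by (auto intro: exI[of _ "1::real"])
next
  case False
  let ?K = "hull_closed C"
  obtain p where p: "p \<in> ?K" "\<And>v. v \<in> ?K \<Longrightarrow> inner_dual (p - y) (p - y) \<le> inner_dual (v - y) (v - y)"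
    using nearest_point_hull_closed[OF bnd False, of y] by blast
  define a where "a = p - y"
  define g where "g = inner_dual a a"
  have "a \<noteq> 0" using p(1) y by (auto simp: a_def)
  then have g: "g > 0"
    using inner_dual_self_nonneg[of a] inner_dual_self_eq_0[of a] by (simp add: g_def less_le)
  have var: "0 \<le> inner_dual a (v - p)" if v: "v \<in> ?K" for v
  proof -
    define b where "b = v - p"
    define B where "B = inner_dual a b"
    define V where "V = inner_dual b b"
    \<comment> \<open>First variation at the nearest point: along the segment towards
      \<open>v\<close> the square is expanded and divided by s, and s is then sent to 0.\<close>
    have "0 \<le> 2 * B + s * V" if s: "0 < s" "s \<le> 1" for s
    proof -
      have "p + s *\<^sub>R b \<in> ?K"
      proof -
        have "(1 - s) *\<^sub>R p + s *\<^sub>R v \<in> ?K"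
          using convexD[OF convex_hull_closed[OF bnd] p(1) v] s by simp
        then show ?thesis by (simp add: b_def algebra_simps)
      qed
      from p(2)[OF this] have "inner_dual a a \<le> inner_dual (a + s *\<^sub>R b) (a + s *\<^sub>R b)"
        by (simp add: a_def algebra_simps)
      also have "\<dots> = inner_dual a a + 2 * (s * B) + s * (s * V)"
        unfolding inner_dual_self_add B_def V_def
        by (simp add: inner_dual_scaleR_right inner_dual_commute[of "s *\<^sub>R b" "s *\<^sub>R b"] inner_dual_commute[of "s *\<^sub>R b" b])
      finally have "0 \<le> s * (2 * B + s * V)" by (simp add: algebra_simps)
      then show ?thesis using s by (simp add: zero_le_mult_iff)
    qed
    then have lim: "0 \<le> 2 * B + inverse (real (Suc n)) * V" for n by (simp add: inverse_le_1_iff)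
    have "(\<lambda>n. 2 * B + inverse (real (Suc n)) * V) \<longlonglongrightarrow> 2 * B + 0 * V"
      by (intro tendsto_intros LIMSEQ_inverse_real_of_nat)
    then have "0 \<le> 2 * B + 0 * V" by (rule LIMSEQ_le_const) (use lim in blast)
    then show ?thesis by (simp add: B_def b_def)
  qed
  \<comment> \<open>The sign turns the lower bound for \<open>inner_dual a\<close> on the hull into
    an upper bound; the gap g is the squared distance from \<open>y\<close> to the hull.\<close>
  define x where "x = - riesz a"
  have ev: "blinfun_apply v x = - inner_dual a v" for v by (simp add: x_def apply_riesz blinfun.minus_right)
  have gap: "blinfun_apply v x \<le> blinfun_apply y x - g" if v: "v \<in> ?K" for v
  proof -
    have "inner_dual a v = inner_dual a (v - p) + inner_dual a (p - y) + inner_dual a y"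
      by (simp flip: inner_dual_add_right)
    then show ?thesis using var[OF v] by (simp add: ev g_def a_def)
  qed
  have r: "0 \<le> r" using norm_hull_closed_le[OF bnd p(1)] norm_ge_zero[of p] by linarith
  \<comment> \<open>Replacing \<open>x\<close> by the multiple \<open>c *\<^sub>R z m\<close> costs
    at most \<open>(r + norm y) * e\<close>, and e is chosen to make this at most g/2. Half of the
    gap remains, and division by the positive c turns it into a gap in coordinate m.\<close>
  define k where "k = r + norm y + 1"
  have k: "k > 0" using r by (simp add: k_def add_nonneg_pos)
  define e where "e = g / (2 * k)"
  have e: "e > 0" using g k by (simp add: e_def)
  have "(r + norm y) * e \<le> k * e" using e by (simp add: k_def)
  also have "\<dots> = g / 2" using k by (simp add: e_def)
  finally have e2: "r * e + norm y * e \<le> g / 2" by (simp add: distrib_right)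
  obtain m c where c: "0 < c" "norm (x - c *\<^sub>R z m) < e" using dense_z[OF e] by blast
  have close: "\<bar>blinfun_apply v x - c * coord v m\<bar> \<le> norm v * e" for v
  proof -
    have "\<bar>blinfun_apply v (x - c *\<^sub>R z m)\<bar> \<le> norm v * norm (x - c *\<^sub>R z m)"
      using norm_blinfun[of v "x - c *\<^sub>R z m"] by simp
    also have "\<dots> \<le> norm v * e" using c(2) by (intro mult_left_mono) auto
    finally show ?thesis by (simp add: blinfun.diff_right blinfun.scaleR_right coord_def)
  qed
  have "coord v m \<le> coord y m - g / (2 * c)" if v: "v \<in> ?K" for v
  proof -
    have "norm v * e \<le> r * e" using norm_hull_closed_le[OF bnd v] e by (intro mult_right_mono) auto
    then have "c * coord v m \<le> blinfun_apply v x + r * e" using close[of v] by linarith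
    also have "\<dots> \<le> blinfun_apply y x - g + r * e" using gap[OF v] by simp
    also have "\<dots> \<le> c * coord y m + norm y * e - g + r * e" using close[of y] by linarith
    also have "\<dots> \<le> c * coord y m - g / 2" using e2 by simp
    also have "\<dots> = c * (coord y m - g / (2 * c))" using c(1) by (simp add: field_simps)
    finally show ?thesis using c(1) by simp
  qed
  moreover have "g / (2 * c) > 0" using g c(1) by simp
  ultimately show ?thesis by blast
qed

lemma bdd_above_coord:
  assumes "\<And>u. u \<in> C \<Longrightarrow> norm u \<le> r"
  shows "bdd_above ((\<lambda>u. coord u m) ` C)"
proof (rule bdd_aboveI2)
  fix u assume "u \<in> C"
  then show "coord u m \<le> r * (1 / 2) ^ m" using abs_coord_le'[OF assms, of u m] by (simp add: abs_le_iff)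
qed

lemma mem_hull_closed_iff:
  assumes bnd: "\<And>u. u \<in> C \<Longrightarrow> norm u \<le> r" and ne: "C \<noteq> {}"
  shows "y \<in> hull_closed C \<longleftrightarrow> (\<forall>m. coord y m \<le> (SUP u\<in>C. coord u m))"
proof (intro iffI allI)
  fix m assume y: "y \<in> hull_closed C"
  have "blinfun_apply u (z m) \<le> (SUP u\<in>C. coord u m)" if "u \<in> C" for u
    using cSUP_upper[OF that bdd_above_coord[OF bnd]] by (simp add: coord_def)
  from hull_closed_halfspace[OF this y] show "coord y m \<le> (SUP u\<in>C. coord u m)" by (simp add: coord_def)
next
  assume h: "\<forall>m. coord y m \<le> (SUP u\<in>C. coord u m)"
  show "y \<in> hull_closed C"
  proof (rule ccontr)
    assume "y \<notin> hull_closed C"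
    from hull_closed_separation[OF bnd this]
    obtain m \<gamma> where m: "\<gamma> > 0" "\<forall>v\<in>hull_closed C. coord v m \<le> coord y m - \<gamma>" by blast
    have "(SUP u\<in>C. coord u m) \<le> coord y m - \<gamma>"
      using m(2) subset_hull_closed by (intro cSUP_least ne) blast
    then show False using h[rule_format, of m] m(1) by simp
  qed
qed

text \<open>The join \<open>D\<close> of the two closed hulls is convex, and it is compact in
  coordinates as a continuous image of a product of compact sets. So it is closed and contains the
  hull of the union.\<close>

lemma hull_closed_Un:
  assumes A: "\<And>u. u \<in> A \<Longrightarrow> norm u \<le> r" "A \<noteq> {}" and B: "\<And>u. u \<in> B \<Longrightarrow> norm u \<le> r" "B \<noteq> {}"
    and y: "y \<in> hull_closed (A \<union> B)"
  shows "\<exists>s a b. 0 \<le> s \<and> s \<le> 1 \<and> a \<in> hull_closed A \<and> b \<in> hull_closed B \<and> y = s *\<^sub>R a + (1 - s) *\<^sub>R b"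
proof -
  let ?A = "hull_closed A" and ?B = "hull_closed B"
  define D where "D = {s *\<^sub>R a + (1 - s) *\<^sub>R b | s a b. 0 \<le> s \<and> s \<le> 1 \<and> a \<in> ?A \<and> b \<in> ?B}"
  have D_I: "s *\<^sub>R a + (1 - s) *\<^sub>R b \<in> D" if "0 \<le> s" "s \<le> 1" "a \<in> ?A" "b \<in> ?B" for s a b
    unfolding D_def using that by blast
  have D_E: "\<exists>s a b. 0 \<le> s \<and> s \<le> 1 \<and> a \<in> ?A \<and> b \<in> ?B \<and> y = s *\<^sub>R a + (1 - s) *\<^sub>R b" if "y \<in> D" for y
    using that unfolding D_def by blast
  have "convex D"
  proof (rule convexI)
    fix x y and u v :: real
    assume xy: "x \<in> D" "y \<in> D" and uv: "0 \<le> u" "0 \<le> v" "u + v = 1"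
    obtain s a b where 1: "0 \<le> s" "s \<le> 1" "a \<in> ?A" "b \<in> ?B" "x = s *\<^sub>R a + (1 - s) *\<^sub>R b" using D_E[OF xy(1)] by blast
    obtain t c d where 2: "0 \<le> t" "t \<le> 1" "c \<in> ?A" "d \<in> ?B" "y = t *\<^sub>R c + (1 - t) *\<^sub>R d" using D_E[OF xy(2)] by blast
    \<comment> \<open>A nonnegative combination of two points of a convex set is the total weight
      times one point of the set. Zero total weight is apart, as it forbids normalising.\<close>
    have comb: "\<exists>w\<in>hull_closed S. \<alpha> *\<^sub>R x + \<beta> *\<^sub>R y = (\<alpha> + \<beta>) *\<^sub>R w"
      if "x \<in> hull_closed S" "y \<in> hull_closed S" "0 \<le> \<alpha>" "0 \<le> \<beta>" "\<And>u. u \<in> S \<Longrightarrow> norm u \<le> r" for S x y \<alpha> \<beta>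
    proof (cases "\<alpha> + \<beta> = 0")
      case True
      then have "\<alpha> = 0" "\<beta> = 0" using that by linarith+
      then show ?thesis using that(1) by auto
    next
      case False
      then have pos: "\<alpha> + \<beta> > 0" using that by linarith
      have "(\<alpha> / (\<alpha> + \<beta>)) *\<^sub>R x + (\<beta> / (\<alpha> + \<beta>)) *\<^sub>R y \<in> hull_closed S"
        using convexD[OF convex_hull_closed[OF that(5)] that(1,2)] that(3,4) pos
        by (simp flip: add_divide_distrib)
      moreover have "\<alpha> *\<^sub>R x + \<beta> *\<^sub>R y = (\<alpha> + \<beta>) *\<^sub>R ((\<alpha> / (\<alpha> + \<beta>)) *\<^sub>R x + (\<beta> / (\<alpha> + \<beta>)) *\<^sub>R y)"
        using pos by (simp add: scaleR_add_right)
      ultimately show ?thesis by blast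
    qed
    define \<sigma> where "\<sigma> = u * s + v * t"
    have \<sigma>: "u * (1 - s) + v * (1 - t) = 1 - \<sigma>" using uv by (simp add: \<sigma>_def algebra_simps)
    have \<sigma>01: "0 \<le> \<sigma>" "\<sigma> \<le> 1"
    proof -
      show "0 \<le> \<sigma>" using uv 1 2 by (simp add: \<sigma>_def)
      have "0 \<le> u * (1 - s) + v * (1 - t)" using uv 1 2 by (intro add_nonneg_nonneg mult_nonneg_nonneg) auto
      then show "\<sigma> \<le> 1" using \<sigma> by simp
    qed
    obtain w where w: "w \<in> ?A" "(u * s) *\<^sub>R a + (v * t) *\<^sub>R c = \<sigma> *\<^sub>R w"
      using comb[OF 1(3) 2(3) _ _ A(1), of "u * s" "v * t"] uv 1 2 by (auto simp: \<sigma>_def)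
    obtain w' where w': "w' \<in> ?B" "(u * (1 - s)) *\<^sub>R b + (v * (1 - t)) *\<^sub>R d = (1 - \<sigma>) *\<^sub>R w'"
      using comb[OF 1(4) 2(4) _ _ B(1), of "u * (1 - s)" "v * (1 - t)"] uv 1 2 unfolding \<sigma> by auto
    have "u *\<^sub>R x + v *\<^sub>R y = ((u * s) *\<^sub>R a + (v * t) *\<^sub>R c) + ((u * (1 - s)) *\<^sub>R b + (v * (1 - t)) *\<^sub>R d)"
      by (simp add: 1(5) 2(5) scaleR_add_right)
    then show "u *\<^sub>R x + v *\<^sub>R y \<in> D" unfolding w(2) w'(2) using D_I[OF \<sigma>01 w(1) w'(1)] by simp
  qed
  moreover have "closedin weak_star D"
  proof (rule closedin_weak_starI)
    define F where "F = (\<lambda>w :: real \<times> (nat \<Rightarrow> real) \<times> (nat \<Rightarrow> real). \<lambda>m. fst w * fst (snd w) m + (1 - fst w) * snd (snd w) m)"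
    have fs: "continuous_on UNIV (\<lambda>w :: real \<times> (nat \<Rightarrow> real) \<times> (nat \<Rightarrow> real). fst (snd w))"
      and ss: "continuous_on UNIV (\<lambda>w :: real \<times> (nat \<Rightarrow> real) \<times> (nat \<Rightarrow> real). snd (snd w))"
      and f: "continuous_on UNIV (\<lambda>w :: real \<times> (nat \<Rightarrow> real) \<times> (nat \<Rightarrow> real). fst w)"
      by (intro continuous_on_fst continuous_on_snd continuous_on_id)+
    have "continuous_on UNIV F"
      unfolding F_def
      by (rule continuous_on_coordinatewise_then_product)
        (intro continuous_on_add continuous_on_mult continuous_on_diff continuous_on_const f
          continuous_on_product_then_coordinatewise[OF fs] continuous_on_product_then_coordinatewise[OF ss])
    then have "compact (F ` ({0..1} \<times> coord ` ?A \<times> coord ` ?B))"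
      by (intro compact_continuous_image compact_Times compact_coord_hull[of _ r] A B compact_Icc)
        (auto intro: continuous_on_subset)
    also have "F ` ({0..1} \<times> coord ` ?A \<times> coord ` ?B) = coord ` D"
    proof -
      have F: "F (s, coord a, coord b) = coord (s *\<^sub>R a + (1 - s) *\<^sub>R b)" for s a b
        by (auto simp: F_def)
      show ?thesis
      proof (intro subset_antisym subsetI)
        fix q assume "q \<in> F ` ({0..1} \<times> coord ` ?A \<times> coord ` ?B)"
        then obtain s a b where "s \<in> {0..1}" "a \<in> ?A" "b \<in> ?B" "q = F (s, coord a, coord b)" by blast
        then show "q \<in> coord ` D" unfolding F using D_I[of s a b] by auto
      next
        fix q assume "q \<in> coord ` D"
        then obtain y where "y \<in> D" and q: "q = coord y" by blast
        then obtain s a b where "0 \<le> s" "s \<le> 1" "a \<in> ?A" "b \<in> ?B" "y = s *\<^sub>R a + (1 - s) *\<^sub>R b"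
          using D_E[of y] by blast
        then show "q \<in> F ` ({0..1} \<times> coord ` ?A \<times> coord ` ?B)"
          unfolding q by (intro image_eqI[of _ _ "(s, coord a, coord b)"]) (auto simp: F)
      qed
    qed
    finally show "compact (coord ` D)" .
  qed
  moreover have "A \<union> B \<subseteq> D"
  proof -
    obtain a0 b0 where "a0 \<in> ?A" "b0 \<in> ?B" using A(2) B(2) subset_hull_closed by blast
    then show ?thesis
      using D_I[of 1 _ b0] D_I[of 0 a0] subset_hull_closed[of A] subset_hull_closed[of B] by auto
  qed
  ultimately have "hull_closed (A \<union> B) \<subseteq> D" by (intro hull_closed_minimal)
  then show ?thesis using D_E y by blast
qed

text \<open>By \<open>hull_closed_Un\<close> the point lies on a segment between the two hulls;
  being extreme it is an end of it, and the end in \<open>hull_closed A\<close> is excluded.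
  Extremality passes to the smaller set.\<close>

lemma extreme_point_hull_closed_Un:
  assumes bnd: "\<And>u. u \<in> A \<union> B \<Longrightarrow> norm u \<le> r"
    and y: "y extreme_point_of hull_closed (A \<union> B)" and nA: "y \<notin> hull_closed A"
  shows "y extreme_point_of hull_closed B"
proof (cases "A = {} \<or> B = {}")
  case True
  then show ?thesis using y nA by (auto simp: extreme_point_of_def)
next
  case False
  have yK: "y \<in> hull_closed (A \<union> B)" using y by (simp add: extreme_point_of_def)
  obtain s a b where s: "0 \<le> s" "s \<le> 1" "a \<in> hull_closed A" "b \<in> hull_closed B" "y = s *\<^sub>R a + (1 - s) *\<^sub>R b"
    using hull_closed_Un[OF _ _ _ _ yK, of r] bnd False by blast
  have sub: "hull_closed A \<subseteq> hull_closed (A \<union> B)" "hull_closed B \<subseteq> hull_closed (A \<union> B)"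
    by (intro hull_closed_mono; blast)+
  have "y \<notin> open_segment b a" using y s sub unfolding extreme_point_of_def by blast
  moreover have "y \<in> closed_segment b a" unfolding closed_segment_def using s by (auto simp: add.commute)
  ultimately have "y = a \<or> y = b" unfolding open_segment_def by blast
  then have "y = b" using nA s(3) by blast
  then show ?thesis using y s(4) sub(2) unfolding extreme_point_of_def by blast
qed

text \<open>The converse of Milman: if two closed pieces cover \<open>C\<close>, an extreme point of the hull of \<open>C\<close> lies in
  the hull of one of them.  Cutting along coordinate hyperplanes close to the point, the outer pieces
  are ruled out, so \<open>C\<close> meets every neighbourhood of the point.\<close>

lemma extreme_point_hull_closed_near:
  assumes bnd: "\<And>u. u \<in> C \<Longrightarrow> norm u \<le> r" and y: "y extreme_point_of hull_closed C" and e: "e > 0"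
  shows "y extreme_point_of hull_closed {u \<in> C. \<forall>m<n. \<bar>coord u m - coord y m\<bar> \<le> e}"
proof (induction n)
  case (Suc n)
  define C' where "C' = {u \<in> C. \<forall>m<n. \<bar>coord u m - coord y m\<bar> \<le> e}"
  \<comment> \<open>\<open>L\<close> and \<open>GL\<close> are the outer pieces at coordinate n and
    \<open>GG\<close> is the slab between. Each outer piece lies in a closed half-space that misses
    \<open>y\<close>, hence so does its hull.\<close>
  define L where "L = {u \<in> C'. coord u n \<le> coord y n - e}"
  define G where "G = {u \<in> C'. coord u n \<ge> coord y n - e}"
  define GL where "GL = {u \<in> G. coord y n + e \<le> coord u n}"
  define GG where "GG = {u \<in> G. coord u n \<le> coord y n + e}"
  have C': "C' = L \<union> G" and G: "G = GL \<union> GG" by (auto simp: L_def G_def GL_def GG_def)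
  have bnd': "norm u \<le> r" if "u \<in> C'" for u using that bnd by (simp add: C'_def)
  have nL: "y \<notin> hull_closed L"
    using hull_closed_halfspace[of L "z n" "coord y n - e" y] e by (auto simp: L_def coord_def)
  have nGL: "y \<notin> hull_closed GL"
    using hull_closed_halfspace[of GL "- z n" "- coord y n - e" y] e
    by (auto simp: GL_def coord_def blinfun.minus_right)
  have "y extreme_point_of hull_closed (L \<union> G)" using Suc unfolding C'[symmetric] C'_def .
  then have "y extreme_point_of hull_closed G"
    by (rule extreme_point_hull_closed_Un[where r = r, rotated]) (use nL bnd' in \<open>auto simp: C'\<close>)
  then have "y extreme_point_of hull_closed (GL \<union> GG)" unfolding G[symmetric] .
  then have "y extreme_point_of hull_closed GG"
    by (rule extreme_point_hull_closed_Un[where r = r, rotated]) (use nGL bnd' in \<open>auto simp: C' G\<close>)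
  moreover have "GG = {u \<in> C. \<forall>m<Suc n. \<bar>coord u m - coord y m\<bar> \<le> e}"
    by (auto simp: GG_def G_def C'_def less_Suc_eq abs_le_iff)
  ultimately show ?case by simp
qed (use y in simp)

text \<open>No slab around \<open>y\<close> is empty, since the hull of the empty set has no extreme
  point. Points of \<open>C\<close> from slabs of width 1/(n+1) in the first n coordinates converge
  to \<open>y\<close>.\<close>

theorem extreme_point_hull_closed_mem:
  assumes cl: "closedin weak_star C" and bnd: "\<And>u. u \<in> C \<Longrightarrow> norm u \<le> r"
    and y: "y extreme_point_of hull_closed C"
  shows "y \<in> C"
proof -
  have "{u \<in> C. \<forall>m<n. \<bar>coord u m - coord y m\<bar> \<le> 1 / Suc n} \<noteq> {}" for n
  proof
    assume "{u \<in> C. \<forall>m<n. \<bar>coord u m - coord y m\<bar> \<le> 1 / Suc n} = {}"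
    moreover have "y extreme_point_of hull_closed {u \<in> C. \<forall>m<n. \<bar>coord u m - coord y m\<bar> \<le> 1 / Suc n}"
      by (rule extreme_point_hull_closed_near[OF bnd y]) simp_all
    ultimately have "y extreme_point_of {}" by (simp only: hull_closed_empty)
    then show False by (simp add: extreme_point_of_def)
  qed
  then have "\<forall>n. \<exists>u. u \<in> C \<and> (\<forall>m<n. \<bar>coord u m - coord y m\<bar> \<le> 1 / Suc n)" by blast
  then obtain U where U: "\<And>n. U n \<in> C" "\<And>n m. m < n \<Longrightarrow> \<bar>coord (U n) m - coord y m\<bar> \<le> 1 / Suc n"
    by metis
  have "(\<lambda>n. coord (U n) m) \<longlonglongrightarrow> coord y m" for m
  proof (rule LIM_zero_cancel, rule Lim_null_comparison)
    show "\<forall>\<^sub>F n in sequentially. norm (coord (U n) m - coord y m) \<le> 1 / Suc n"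
      by (rule eventually_mono[OF eventually_gt_at_top[of m]]) (use U(2) in auto)
    show "(\<lambda>n. 1 / real (Suc n)) \<longlonglongrightarrow> 0" by (rule LIMSEQ_Suc[OF lim_const_over_n])
  qed
  from coord_limit_weak_star(1)[OF bnd[OF U(1)] this]
  have "limitin weak_star U y sequentially" .
  then show ?thesis by (rule limitin_closedin[OF _ cl]) (use U(1) in auto)
qed

end

section \<open>Bounded multifunctions\<close>

context dual_coordinates
begin

text \<open>Every \<open>x\<close> is a limit of multiples of the \<open>z m\<close>, so evaluation
  at \<open>x\<close> is a pointwise limit of multiples of coordinates.\<close>

lemma weak_star_scalarly_measurable_iff:
  "weak_star_scalarly_measurable M h \<longleftrightarrow> (\<forall>m. (\<lambda>t. coord (h t) m) \<in> borel_measurable M)"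
proof
  assume "weak_star_scalarly_measurable M h"
  then show "\<forall>m. (\<lambda>t. coord (h t) m) \<in> borel_measurable M"
    by (simp add: weak_star_scalarly_measurable_def coord_def)
next
  assume meas: "\<forall>m. (\<lambda>t. coord (h t) m) \<in> borel_measurable M"
  show "weak_star_scalarly_measurable M h"
    unfolding weak_star_scalarly_measurable_def
  proof
    fix x
    have "\<forall>i. \<exists>m c. norm (x - c *\<^sub>R z m) < 1 / real (Suc i)"
      using dense_z by (metis of_nat_0_less_iff zero_less_Suc zero_less_divide_1_iff)
    then obtain m c where mc: "\<And>i. norm (x - c i *\<^sub>R z (m i)) < 1 / real (Suc i)" by metis
    have lim0: "(\<lambda>i. x - c i *\<^sub>R z (m i)) \<longlonglongrightarrow> 0"
    proof (rule Lim_null_comparison)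
      show "\<forall>\<^sub>F i in sequentially. norm (x - c i *\<^sub>R z (m i)) \<le> 1 / real (Suc i)"
        using mc by (intro always_eventually allI less_imp_le)
      show "(\<lambda>i. 1 / real (Suc i)) \<longlonglongrightarrow> 0" by (rule LIMSEQ_Suc[OF lim_const_over_n])
    qed
    show "(\<lambda>t. blinfun_apply (h t) x) \<in> borel_measurable M"
    proof (rule borel_measurable_LIMSEQ_real)
      show "(\<lambda>t. c i * coord (h t) (m i)) \<in> borel_measurable M" for i
        using meas by (intro borel_measurable_times borel_measurable_const) blast
      fix t
      have "(\<lambda>i. blinfun_apply (h t) (x - c i *\<^sub>R z (m i))) \<longlonglongrightarrow> blinfun_apply (h t) 0"
        by (intro blinfun.tendsto tendsto_const lim0)
      then have "(\<lambda>i. blinfun_apply (h t) x - blinfun_apply (h t) (x - c i *\<^sub>R z (m i))) \<longlonglongrightarrow> blinfun_apply (h t) x - 0"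
        by (intro tendsto_diff tendsto_const) simp
      then show "(\<lambda>i. c i * coord (h t) (m i)) \<longlonglongrightarrow> blinfun_apply (h t) x"
        by (simp add: blinfun.diff_right blinfun.scaleR_right coord_def)
    qed
  qed
qed

lemma closedin_weak_star_cball: "closedin weak_star (cball (0 :: 'e \<Rightarrow>\<^sub>L real) r)"
proof (cases "0 \<le> r")
  case True
  have "cball (0 :: 'e \<Rightarrow>\<^sub>L real) r = (\<Inter>x. {u. blinfun_apply u x \<le> r * norm x})"
  proof (intro set_eqI iffI)
    fix u :: "'e \<Rightarrow>\<^sub>L real" assume u: "u \<in> cball 0 r"
    have "blinfun_apply u x \<le> r * norm x" for x
      using norm_blinfun[of u x] mult_right_mono[of "norm u" r "norm x"] u by (simp add: abs_le_iff)
    then show "u \<in> (\<Inter>x. {u. blinfun_apply u x \<le> r * norm x})" by blast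
  next
    fix u :: "'e \<Rightarrow>\<^sub>L real" assume u: "u \<in> (\<Inter>x. {u. blinfun_apply u x \<le> r * norm x})"
    have "norm (blinfun_apply u x) \<le> r * norm x" for x
    proof -
      have "blinfun_apply u x \<le> r * norm x" "blinfun_apply u (- x) \<le> r * norm (- x)" using u by blast+
      then show ?thesis by (simp add: blinfun.minus_right abs_le_iff)
    qed
    then have "norm u \<le> r" by (rule norm_blinfun_bound[OF True])
    then show "u \<in> cball 0 r" by simp
  qed
  then show ?thesis
    by (simp only:) (rule closedin_Inter; use closedin_weak_star_halfspace in auto)
qed simp

lemma compact_coord_cball: "compact (coord ` cball 0 r)"
  by (rule compact_coord_image[OF closedin_weak_star_cball, of _ r]) simp

definition decode :: "real \<Rightarrow> (nat \<Rightarrow> real) \<Rightarrow> ('e \<Rightarrow>\<^sub>L real)" where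
  "decode r p = (if p \<in> coord ` cball 0 r then inv coord p else 0)"

lemma decode_coord: "norm u \<le> r \<Longrightarrow> decode r (coord u) = u"
  using inv_f_f[OF inj_coord] by (simp add: decode_def)

text \<open>This moves the graph from the weak-star Borel structure to the metric space of
  sequences, where projection applies. On the coded ball, the preimage of an open set is a
  difference of two compact images; outside it the default value 0 decides.\<close>

lemma measurable_decode: "decode r \<in> borel \<rightarrow>\<^sub>M borel_weak_star"
  unfolding borel_weak_star_def
proof (rule measurable_measure_of)
  fix U :: "('e \<Rightarrow>\<^sub>L real) set" assume "U \<in> {U. openin weak_star U}"
  then have U: "openin weak_star U" by simp
  let ?B = "cball (0 :: 'e \<Rightarrow>\<^sub>L real) r"
  have "closedin weak_star (?B - U)"
    by (rule closedin_diff[OF closedin_weak_star_cball U])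
  then have "compact (coord ` (?B - U))" by (rule compact_coord_image[of _ r]) simp
  then have "coord ` (?B - U) \<in> sets borel" by (intro borel_closed compact_imp_closed)
  moreover have "coord ` ?B \<in> sets borel" by (intro borel_closed compact_imp_closed compact_coord_cball)
  ultimately have sets: "coord ` ?B - coord ` (?B - U) \<in> sets borel" "- (coord ` ?B) \<in> sets borel" by auto
  have "p \<in> decode r -` U \<longleftrightarrow> p \<in> (coord ` ?B - coord ` (?B - U)) \<union> (if 0 \<in> U then - (coord ` ?B) else {})" for p
  proof (cases "p \<in> coord ` ?B")
    case True
    then obtain u where u: "u \<in> ?B" "p = coord u" by blast
    then have "decode r p = u" using decode_coord by simp
    moreover have "coord u \<in> coord ` (?B - U) \<longleftrightarrow> u \<in> ?B - U" by (rule inj_image_mem_iff[OF inj_coord])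
    ultimately show ?thesis using u True by auto
  next
    case False
    then have "decode r p = 0" by (simp add: decode_def)
    then show ?thesis using False by auto
  qed
  then have "decode r -` U \<inter> space borel = (coord ` ?B - coord ` (?B - U)) \<union> (if 0 \<in> U then - (coord ` ?B) else {})"
    by auto
  then show "decode r -` U \<inter> space borel \<in> sets borel" using sets by simp
qed auto

end

locale bounded_multifunction = dual_coordinates z + finite_measure M + complete_measure M
  for z :: "nat \<Rightarrow> 'e::banach" and M :: "'a measure" +
  fixes \<Gamma> :: "'a \<Rightarrow> ('e \<Rightarrow>\<^sub>L real) set" and \<phi> :: "'a \<Rightarrow> real"
  assumes saturated: "saturated M"
    and multifunction: "multifunction M \<Gamma>"
    and integrable_\<phi>: "integrable M \<phi>"
    and norm_\<Gamma>_le: "t \<in> space M \<Longrightarrow> u \<in> \<Gamma> t \<Longrightarrow> norm u \<le> \<phi> t"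
    and graph_measurable: "gph M \<Gamma> \<in> sets (M \<Otimes>\<^sub>M borel_weak_star)"
begin

abbreviation hull_at :: "'a \<Rightarrow> ('e \<Rightarrow>\<^sub>L real) set" where
  "hull_at t \<equiv> weak_star_closed_convex_hull (\<Gamma> t)"

definition support_at :: "nat \<Rightarrow> 'a \<Rightarrow> real" where
  "support_at m t = (SUP u\<in>\<Gamma> t. coord u m)"

lemma \<Gamma>_nonempty: "t \<in> space M \<Longrightarrow> \<Gamma> t \<noteq> {}"
  using multifunction by (simp add: multifunction_def)

lemma \<phi>_nonneg: "t \<in> space M \<Longrightarrow> 0 \<le> \<phi> t"
  using \<Gamma>_nonempty norm_\<Gamma>_le norm_ge_zero by (metis all_not_in_conv order_trans)

lemma norm_hull_at_le: "t \<in> space M \<Longrightarrow> u \<in> hull_at t \<Longrightarrow> norm u \<le> \<phi> t"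
  using norm_hull_closed_le[OF norm_\<Gamma>_le] by blast

lemma mem_hull_at_iff: "t \<in> space M \<Longrightarrow> u \<in> hull_at t \<longleftrightarrow> (\<forall>m. coord u m \<le> support_at m t)"
  unfolding support_at_def using mem_hull_closed_iff[OF norm_\<Gamma>_le \<Gamma>_nonempty] by blast

lemma convex_hull_at: "t \<in> space M \<Longrightarrow> convex (hull_at t)"
  using convex_hull_closed[OF norm_\<Gamma>_le] by blast

text \<open>A superlevel set is a projection of the decoded graph. As \<open>\<phi> t\<close> varies
  with \<open>t\<close>, no single compact set holds all sections, so projections along the balls of
  integer radius are united.\<close>

lemma measurable_support_at [measurable]: "support_at m \<in> borel_measurable M"
proof -
  have "{t \<in> space M. c < support_at m t} \<in> sets M" for c
  proof -
    define G where "G n = {w \<in> space (M \<Otimes>\<^sub>M (borel :: (nat \<Rightarrow> real) measure)).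
      (fst w, decode (real n) (snd w)) \<in> gph M \<Gamma> \<and> c < snd w m}" for n
    have G: "G n \<in> sets (M \<Otimes>\<^sub>M borel)" for n
    proof -
      have "(\<lambda>w. (fst w, decode (real n) (snd w))) \<in> M \<Otimes>\<^sub>M borel \<rightarrow>\<^sub>M M \<Otimes>\<^sub>M borel_weak_star"
        by (intro measurable_Pair measurable_fst measurable_compose[OF measurable_snd measurable_decode])
      from measurable_sets[OF this graph_measurable]
      have "{w \<in> space (M \<Otimes>\<^sub>M borel). (fst w, decode (real n) (snd w)) \<in> gph M \<Gamma>} \<in> sets (M \<Otimes>\<^sub>M borel)"
        by (simp add: vimage_def Int_def conj_commute)
      moreover have "{w \<in> space (M \<Otimes>\<^sub>M (borel :: (nat \<Rightarrow> real) measure)). c < snd w m} \<in> sets (M \<Otimes>\<^sub>M borel)"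
        by measurable
      ultimately have "{w \<in> space (M \<Otimes>\<^sub>M borel). (fst w, decode (real n) (snd w)) \<in> gph M \<Gamma>} \<inter>
        {w \<in> space (M \<Otimes>\<^sub>M borel). c < snd w m} \<in> sets (M \<Otimes>\<^sub>M (borel :: (nat \<Rightarrow> real) measure))"
        by (rule sets.Int)
      also have "{w \<in> space (M \<Otimes>\<^sub>M borel). (fst w, decode (real n) (snd w)) \<in> gph M \<Gamma>} \<inter>
        {w \<in> space (M \<Otimes>\<^sub>M borel). c < snd w m} = G n"
        by (auto simp: G_def)
      finally show ?thesis .
    qed
    have "{t \<in> space M. c < support_at m t} =
      (\<Union>n. {t \<in> space M. \<exists>p\<in>coord ` cball 0 (real n). (t, p) \<in> G n})" (is "?L = ?R")
    proof (intro set_eqI iffI)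
      fix t assume "t \<in> ?L"
      then have t: "t \<in> space M" "c < (SUP u\<in>\<Gamma> t. coord u m)" by (auto simp: support_at_def)
      then obtain u where u: "u \<in> \<Gamma> t" "c < coord u m"
        using less_cSUP_iff[OF \<Gamma>_nonempty bdd_above_coord[OF norm_\<Gamma>_le]] by blast
      obtain n where n: "norm u \<le> real n" using real_arch_simple by blast
      then have "coord u \<in> coord ` cball 0 (real n)" by simp
      moreover have "(t, coord u) \<in> G n"
        using t(1) u n by (simp add: G_def space_pair_measure gph_def decode_coord)
      ultimately show "t \<in> ?R" using t(1) by blast
    next
      fix t assume "t \<in> ?R"
      then obtain n u where t: "t \<in> space M" and u: "norm u \<le> real n" "(t, coord u) \<in> G n" by auto
      then have "u \<in> \<Gamma> t" "c < coord u m" by (auto simp: G_def gph_def decode_coord)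
      then show "t \<in> ?L"
        using t less_cSUP_iff[OF \<Gamma>_nonempty bdd_above_coord[OF norm_\<Gamma>_le]] by (auto simp: support_at_def)
    qed
    moreover have "{t \<in> space M. \<exists>p\<in>coord ` cball 0 (real n). (t, p) \<in> G n} \<in> sets M" for n
      by (rule measurable_projection[OF finite_measure_axioms complete_measure_axioms G compact_coord_cball])
    ultimately show ?thesis by simp
  qed
  then show ?thesis by (simp add: borel_measurable_iff_greater)
qed

text \<open>Extremality tested by symmetric perturbations only; in this form its failure is
  witnessed by one vector, which can be selected measurably.\<close>

lemma extreme_point_hull_atI:
  assumes t: "t \<in> space M" and h: "h \<in> hull_at t"
    and no: "\<And>w. h + w \<in> hull_at t \<Longrightarrow> h - w \<in> hull_at t \<Longrightarrow> w = 0"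
  shows "h extreme_point_of hull_at t"
  unfolding extreme_point_of_def
proof (intro conjI ballI notI)
  show "h \<in> hull_at t" by fact
  fix a b assume ab: "a \<in> hull_at t" "b \<in> hull_at t" and "h \<in> open_segment a b"
  then obtain s where s: "0 < s" "s < 1" "h = (1 - s) *\<^sub>R a + s *\<^sub>R b" "a \<noteq> b"
    by (auto simp: in_segment)
  define d where "d = min s (1 - s)"
  have d: "d > 0" "d \<le> s" "d \<le> 1 - s" using s by (auto simp: d_def)
  have in_hull: "(1 - r) *\<^sub>R a + r *\<^sub>R b \<in> hull_at t" if "0 \<le> r" "r \<le> 1" for r
    using convexD[OF convex_hull_at[OF t] ab, of "1 - r" r] that by simp
  have "d *\<^sub>R (b - a) = 0"
  proof (rule no)
    have "h + d *\<^sub>R (b - a) = (1 - (s + d)) *\<^sub>R a + (s + d) *\<^sub>R b"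
      unfolding s(3) by (simp add: algebra_simps)
    then show "h + d *\<^sub>R (b - a) \<in> hull_at t" using in_hull[of "s + d"] d s by simp
    have "h - d *\<^sub>R (b - a) = (1 - (s - d)) *\<^sub>R a + (s - d) *\<^sub>R b"
      unfolding s(3) by (simp add: algebra_simps)
    then show "h - d *\<^sub>R (b - a) \<in> hull_at t" using in_hull[of "s - d"] d s by simp
  qed
  then show False using d s by simp
qed

text \<open>The points where \<open>h t\<close> is not extreme are covered, up to a null set, by
  countably many projections \<open>A n j k\<close>; one of them has positive measure and carries a
  measurable witness.\<close>

lemma nonextreme_selection:
  assumes h: "weak_star_scalarly_measurable M h" and hK: "AE t in M. h t \<in> hull_at t"
    and ne: "\<not> (AE t in M. h t extreme_point_of hull_at t)"
  shows "\<exists>A w. A \<in> sets M \<and> measure M A > 0 \<and> weak_star_scalarly_measurable M w \<and>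
    (\<forall>t. t \<notin> A \<longrightarrow> w t = 0) \<and>
    (\<forall>t\<in>A. w t \<noteq> 0 \<and> h t + w t \<in> hull_at t \<and> h t - w t \<in> hull_at t)"
proof -
  have [measurable]: "(\<lambda>t. coord (h t) m) \<in> borel_measurable M" for m
    using h by (simp add: weak_star_scalarly_measurable_iff)
  \<comment> \<open>Asking for coordinate j to be at least 1/(k+1) forces the perturbation to be
    nonzero and keeps the sections closed, as selection requires; \<open>w \<noteq> 0\<close> alone
    would not.\<close>
  define G where "G j k = {w \<in> space (M \<Otimes>\<^sub>M (borel :: (nat \<Rightarrow> real) measure)).
    (\<forall>m. coord (h (fst w)) m + snd w m \<le> support_at m (fst w) \<and>
      coord (h (fst w)) m - snd w m \<le> support_at m (fst w)) \<and> 1 / real (Suc k) \<le> snd w j}" for j k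
  have G: "G j k \<in> sets (M \<Otimes>\<^sub>M borel)" for j k unfolding G_def by measurable
  have G_iff: "(t, coord w) \<in> G j k \<longleftrightarrow>
      h t + w \<in> hull_at t \<and> h t - w \<in> hull_at t \<and> 1 / real (Suc k) \<le> coord w j"
    if "t \<in> space M" for t w j k
    unfolding G_def using mem_hull_at_iff[OF that] that by (auto simp: space_pair_measure)
  define A where "A n j k = {t \<in> space M. \<exists>p\<in>coord ` cball 0 (real n). (t, p) \<in> G j k}" for n j k
  have A: "A n j k \<in> sets M" for n j k
    unfolding A_def
    by (rule measurable_projection[OF finite_measure_axioms complete_measure_axioms G compact_coord_cball])
  have "\<exists>n j k. measure M (A n j k) > 0"
  proof (rule ccontr)
    assume "\<nexists>n j k. measure M (A n j k) > 0"
    then have "measure M (A n j k) = 0" for n j k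
      using measure_nonneg[of M "A n j k"] by (metis less_le)
    then have "A n j k \<in> null_sets M" for n j k
      using A by (auto simp: null_sets_def emeasure_eq_measure)
    then have "AE t in M. \<forall>n j k. t \<notin> A n j k"
      by (simp add: AE_all_countable AE_not_in)
    with hK AE_space have "AE t in M. h t extreme_point_of hull_at t"
    proof eventually_elim
      case (elim t)
      show ?case
      proof (rule extreme_point_hull_atI)
        fix w assume w: "h t + w \<in> hull_at t" "h t - w \<in> hull_at t"
        show "w = 0"
        proof (rule coord_zero_imp, rule ccontr)
          fix j assume j: "coord w j \<noteq> 0"
          \<comment> \<open>Admissible perturbations are symmetric, so a nonzero coordinate may be
            taken positive.\<close>
          define v where "v = (if coord w j > 0 then w else - w)"
          have v: "h t + v \<in> hull_at t" "h t - v \<in> hull_at t" "coord v j > 0"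
            using w j coord_simps(3)[of "-1" w j] by (auto simp: v_def)
          obtain k where "1 / real (Suc k) < coord v j" using nat_approx_posE[OF v(3)] .
          then have "(t, coord v) \<in> G j k" using v elim by (simp add: G_iff)
          moreover obtain n where "norm v \<le> real n" using real_arch_simple by blast
          ultimately have "t \<in> A n j k" using elim by (auto simp: A_def)
          then show False using elim by blast
        qed
      qed (use elim in auto)
    qed
    then show False using ne by blast
  qed
  then obtain n j k where pos: "measure M (A n j k) > 0" by blast
  have sec: "closed {p \<in> coord ` cball 0 (real n). (t, p) \<in> G j k}" if t: "t \<in> space M" for t
  proof -
    have "{p \<in> coord ` cball 0 (real n). (t, p) \<in> G j k} = coord ` cball 0 (real n) \<inter>
      ((\<Inter>m. {p. coord (h t) m + p m \<le> support_at m t} \<inter> {p. coord (h t) m - p m \<le> support_at m t})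
        \<inter> {p. 1 / real (Suc k) \<le> p j})"
      using t by (auto simp: G_def space_pair_measure)
    also have "closed \<dots>"
      by (intro closed_Int closed_INT ballI compact_imp_closed[OF compact_coord_cball] closed_Collect_le
          continuous_on_add continuous_on_diff continuous_on_coordinate continuous_on_const)
    finally show ?thesis .
  qed
  obtain s where s: "\<forall>m. (\<lambda>t. s t m) \<in> borel_measurable M"
    "\<forall>t\<in>space M. (\<exists>p\<in>coord ` cball 0 (real n). (t, p) \<in> G j k) \<longrightarrow>
      s t \<in> coord ` cball 0 (real n) \<and> (t, s t) \<in> G j k"
    using compact_measurable_selection[OF finite_measure_axioms complete_measure_axioms G compact_coord_cball sec]
    by blast
  define w where "w t = (if t \<in> A n j k then decode (real n) (s t) else 0)" for t
  have sw: "coord (w t) = s t" "(t, s t) \<in> G j k" "t \<in> space M" if t: "t \<in> A n j k" for t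
  proof -
    show "t \<in> space M" "(t, s t) \<in> G j k" using t s(2) by (auto simp: A_def)
    have "s t \<in> coord ` cball 0 (real n)" using t s(2) by (auto simp: A_def)
    then obtain u where "norm u \<le> real n" "s t = coord u" by auto
    then show "coord (w t) = s t" using t by (simp add: w_def decode_coord)
  qed
  have "weak_star_scalarly_measurable M w"
    unfolding weak_star_scalarly_measurable_iff
  proof
    fix m
    have "(\<lambda>t. indicator (A n j k) t * s t m) \<in> borel_measurable M"
      by (intro borel_measurable_times borel_measurable_indicator A s(1)[rule_format])
    moreover have "(\<lambda>t. indicator (A n j k) t * s t m) = (\<lambda>t. coord (w t) m)"
      using sw(1) by (auto simp: w_def indicator_def fun_eq_iff)
    ultimately show "(\<lambda>t. coord (w t) m) \<in> borel_measurable M" by simp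
  qed
  moreover have "w t \<noteq> 0 \<and> h t + w t \<in> hull_at t \<and> h t - w t \<in> hull_at t" if t: "t \<in> A n j k" for t
  proof -
    have "h t + w t \<in> hull_at t \<and> h t - w t \<in> hull_at t \<and> 1 / real (Suc k) \<le> coord (w t) j"
      using sw[OF t] G_iff[of t "w t" j k] by simp
    moreover have "1 / real (Suc k) > 0" by simp
    ultimately show ?thesis by fastforce
  qed
  ultimately show ?thesis
    using A pos by (intro exI[of _ "A n j k"] exI[of _ w]) (auto simp: w_def)
qed

end

section \<open>The bang-bang principle\<close>

context bounded_multifunction
begin

text \<open>The weight makes the energy finite, because \<open>\<phi>\<close> is integrable but need not be square integrable.\<close>

definition energy_at :: "'a \<Rightarrow> ('e \<Rightarrow>\<^sub>L real) \<Rightarrow> real" where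
  "energy_at t u = inner_dual u u / (1 + \<phi> t)\<^sup>2"

definition energy :: "('a \<Rightarrow> ('e \<Rightarrow>\<^sub>L real)) \<Rightarrow> real" where
  "energy h = (\<integral>t. energy_at t (h t) \<partial>M)"

text \<open>The factor k lets selections (k = 1) and their differences (k = 2) share the energy
  estimates.\<close>

definition dominated :: "real \<Rightarrow> ('a \<Rightarrow> ('e \<Rightarrow>\<^sub>L real)) \<Rightarrow> bool" where
  "dominated k h \<longleftrightarrow> weak_star_scalarly_measurable M h \<and> (AE t in M. norm (h t) \<le> k * \<phi> t)"

lemma measurable_\<phi> [measurable]: "\<phi> \<in> borel_measurable M"
  using integrable_\<phi> by blast

lemma measurable_coord_apply: "weak_star_scalarly_measurable M h \<Longrightarrow> (\<lambda>t. coord (h t) m) \<in> borel_measurable M"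
  by (simp add: weak_star_scalarly_measurable_iff)

lemma measurable_energy_density:
  assumes "weak_star_scalarly_measurable M h"
  shows "(\<lambda>t. energy_at t (h t)) \<in> borel_measurable M"
proof -
  have [measurable]: "(\<lambda>t. coord (h t) m) \<in> borel_measurable M" for m
    using assms by (rule measurable_coord_apply)
  show ?thesis unfolding energy_at_def inner_dual_def by measurable
qed

lemma energy_density_bound:
  assumes "t \<in> space M" "norm u \<le> k * \<phi> t"
  shows "0 \<le> energy_at t u" "energy_at t u \<le> 2 * k\<^sup>2"
proof -
  have \<phi>: "0 \<le> \<phi> t" using assms(1) by (rule \<phi>_nonneg)
  show "0 \<le> energy_at t u" using inner_dual_self_nonneg[of u] by (simp add: energy_at_def)
  have "inner_dual u u \<le> 2 * (k * \<phi> t)\<^sup>2" by (rule inner_dual_self_le[OF assms(2)])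
  also have "\<dots> = 2 * k\<^sup>2 * (\<phi> t)\<^sup>2" by (simp add: power_mult_distrib)
  also have "\<dots> \<le> 2 * k\<^sup>2 * (1 + \<phi> t)\<^sup>2" using \<phi> by (intro mult_left_mono power_mono) auto
  finally show "energy_at t u \<le> 2 * k\<^sup>2" using \<phi> by (simp add: energy_at_def divide_le_eq add_nonneg_eq_0_iff)
qed

lemma integrable_energy:
  assumes "dominated k h"
  shows "integrable M (\<lambda>t. energy_at t (h t))"
proof (rule integrable_const_bound[where B = "2 * k\<^sup>2"])
  have "AE t in M. norm (h t) \<le> k * \<phi> t" using assms by (simp add: dominated_def)
  then show "AE t in M. norm (energy_at t (h t)) \<le> 2 * k\<^sup>2"
    using AE_space by eventually_elim (simp add: energy_density_bound)
  show "(\<lambda>t. energy_at t (h t)) \<in> borel_measurable M"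
    using assms by (intro measurable_energy_density) (simp add: dominated_def)
qed

lemma energy_nonneg: "0 \<le> energy h"
  unfolding energy_def using inner_dual_self_nonneg by (intro integral_nonneg_AE) (simp add: energy_at_def)

lemma energy_le:
  assumes "dominated k h"
  shows "energy h \<le> 2 * k\<^sup>2 * measure M (space M)"
proof -
  have "AE t in M. norm (h t) \<le> k * \<phi> t" using assms by (simp add: dominated_def)
  then have "AE t in M. energy_at t (h t) \<le> 2 * k\<^sup>2"
    using AE_space by eventually_elim (rule energy_density_bound)
  then have "energy h \<le> (\<integral>t. 2 * k\<^sup>2 \<partial>M)"
    unfolding energy_def by (intro integral_mono_AE integrable_energy[OF assms]) simp_all
  then show ?thesis by (simp add: mult_ac)
qed

lemma dominated_add:
  assumes "dominated k g" "dominated l h"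
  shows "dominated (k + l) (\<lambda>t. g t + h t)" "dominated (k + l) (\<lambda>t. g t - h t)"
proof -
  have m: "weak_star_scalarly_measurable M (\<lambda>t. g t + h t)" "weak_star_scalarly_measurable M (\<lambda>t. g t - h t)"
    using assms unfolding dominated_def weak_star_scalarly_measurable_iff
    by (auto intro!: borel_measurable_add borel_measurable_diff)
  have "AE t in M. norm (g t) \<le> k * \<phi> t" "AE t in M. norm (h t) \<le> l * \<phi> t"
    using assms by (auto simp: dominated_def)
  then have "AE t in M. norm (g t + h t) \<le> (k + l) * \<phi> t \<and> norm (g t - h t) \<le> (k + l) * \<phi> t"
  proof eventually_elim
    case (elim t)
    then show ?case
      using norm_triangle_ineq[of "g t" "h t"] norm_triangle_ineq4[of "g t" "h t"] by (simp add: distrib_right)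
  qed
  then show "dominated (k + l) (\<lambda>t. g t + h t)" "dominated (k + l) (\<lambda>t. g t - h t)"
    using m by (auto simp: dominated_def)
qed

lemma energy_parallelogram:
  assumes g: "dominated k g" and h: "dominated l h"
  shows "energy (\<lambda>t. g t + h t) + energy (\<lambda>t. g t - h t) = 2 * energy g + 2 * energy h"
proof -
  have pt: "inner_dual (u + v) (u + v) + inner_dual (u - v) (u - v) = 2 * inner_dual u u + 2 * inner_dual v v" for u v
  proof -
    have "inner_dual (u - v) (u - v) = inner_dual (u + (-1) *\<^sub>R v) (u + (-1) *\<^sub>R v)" by simp
    also have "\<dots> = inner_dual u u - 2 * inner_dual u v + inner_dual v v"
      unfolding inner_dual_self_add
      using inner_dual_scaleR_right[of "(-1) *\<^sub>R v" "-1" v] inner_dual_scaleR_right[of u "-1" v]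
        inner_dual_scaleR_right[of v "-1" v] inner_dual_commute[of "(-1) *\<^sub>R v" v] by simp
    finally show ?thesis by (simp add: inner_dual_self_add)
  qed
  have "energy (\<lambda>t. g t + h t) + energy (\<lambda>t. g t - h t) =
    (\<integral>t. energy_at t (g t + h t) + energy_at t (g t - h t) \<partial>M)"
    unfolding energy_def
    by (intro Bochner_Integration.integral_add[symmetric] integrable_energy[OF dominated_add(1)[OF g h]]
        integrable_energy[OF dominated_add(2)[OF g h]])
  also have "\<dots> = (\<integral>t. 2 * (energy_at t (g t)) + 2 * (energy_at t (h t)) \<partial>M)"
    by (intro Bochner_Integration.integral_cong refl) (simp add: energy_at_def pt flip: add_divide_distrib)
  also have "\<dots> = 2 * energy g + 2 * energy h"
    unfolding energy_def using integrable_energy[OF g] integrable_energy[OF h]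
    by (subst Bochner_Integration.integral_add) auto
  finally show ?thesis .
qed

lemma energy_tendsto:
  assumes U: "\<And>n. weak_star_scalarly_measurable M (U n)" and u: "weak_star_scalarly_measurable M u"
    and lim: "AE t in M. (\<forall>n. norm (U n t) \<le> k * \<phi> t) \<and> (\<forall>m. (\<lambda>n. coord (U n t) m) \<longlonglongrightarrow> coord (u t) m)"
  shows "(\<lambda>n. energy (U n)) \<longlonglongrightarrow> energy u"
  unfolding energy_def
proof (rule integral_dominated_convergence)
  show "(\<lambda>t. energy_at t (u t)) \<in> borel_measurable M" by (rule measurable_energy_density[OF u])
  show "(\<lambda>t. energy_at t (U n t)) \<in> borel_measurable M" for n by (rule measurable_energy_density[OF U])
  show "integrable M (\<lambda>t. 2 * k\<^sup>2)" by simp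
  show "AE t in M. (\<lambda>n. energy_at t (U n t)) \<longlonglongrightarrow> energy_at t (u t)"
    using lim AE_space
  proof eventually_elim
    case (elim t)
    then have "(\<lambda>n. inner_dual (U n t) (U n t)) \<longlonglongrightarrow> inner_dual (u t) (u t)"
      by (intro inner_dual_self_tendsto) auto
    moreover have "(1 + \<phi> t)\<^sup>2 \<noteq> 0" using \<phi>_nonneg[of t] elim by (simp add: add_nonneg_eq_0_iff)
    ultimately show ?case unfolding energy_at_def by (intro tendsto_divide tendsto_const)
  qed
  show "AE t in M. norm (energy_at t (U n t)) \<le> 2 * k\<^sup>2" for n
    using lim AE_space
  proof eventually_elim
    case (elim t)
    then show ?case using energy_density_bound[of t "U n t" k] by simp
  qed
qed

section \<open>Hull selections with a prescribed integral\<close>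

definition hull_selections :: "('e \<Rightarrow>\<^sub>L real) \<Rightarrow> ('a \<Rightarrow> ('e \<Rightarrow>\<^sub>L real)) set" where
  "hull_selections y = {h. weak_star_scalarly_measurable M h \<and> (AE t in M. h t \<in> hull_at t) \<and>
     (\<forall>x. (\<integral>t. blinfun_apply (h t) x \<partial>M) = blinfun_apply y x)}"

lemma hull_selectionsD:
  assumes "h \<in> hull_selections y"
  shows "weak_star_scalarly_measurable M h" "AE t in M. h t \<in> hull_at t"
    "(\<integral>t. blinfun_apply (h t) x \<partial>M) = blinfun_apply y x"
    "AE t in M. norm (h t) \<le> \<phi> t" "dominated 1 h"
proof -
  show m: "weak_star_scalarly_measurable M h" and K: "AE t in M. h t \<in> hull_at t"
    and "(\<integral>t. blinfun_apply (h t) x \<partial>M) = blinfun_apply y x"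
    using assms by (auto simp: hull_selections_def)
  show n: "AE t in M. norm (h t) \<le> \<phi> t"
    using K AE_space by eventually_elim (rule norm_hull_at_le)
  show "dominated 1 h" using m n by (simp add: dominated_def)
qed

lemma integrable_apply:
  assumes "weak_star_scalarly_measurable M h" "AE t in M. norm (h t) \<le> \<phi> t"
  shows "integrable M (\<lambda>t. blinfun_apply (h t) x)"
proof (rule Bochner_Integration.integrable_bound)
  show "integrable M (\<lambda>t. \<phi> t * norm x)" using integrable_\<phi> by simp
  show "(\<lambda>t. blinfun_apply (h t) x) \<in> borel_measurable M"
    using assms(1) by (simp add: weak_star_scalarly_measurable_def)
  show "AE t in M. norm (blinfun_apply (h t) x) \<le> norm (\<phi> t * norm x)"
    using assms(2) AE_space
  proof eventually_elim
    case (elim t)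
    have "norm (blinfun_apply (h t) x) \<le> norm (h t) * norm x" by (rule norm_blinfun)
    also have "\<dots> \<le> \<phi> t * norm x" using elim by (intro mult_right_mono) auto
    finally show ?case using \<phi>_nonneg[of t] elim by simp
  qed
qed

text \<open>The limit is formed pointwise in coordinates: it stays in the hull because the hull is
  closed, and it keeps the integral by dominated convergence with majorant
  \<open>\<phi> t * norm x\<close>.\<close>

lemma hull_selections_limit:
  assumes Y: "\<And>n. Y n \<in> hull_selections y"
    and conv: "AE t in M. \<forall>m. convergent (\<lambda>n. coord (Y n t) m)"
  shows "\<exists>h\<in>hull_selections y. AE t in M. (\<forall>n. norm (Y n t) \<le> \<phi> t) \<and> (\<forall>m. (\<lambda>n. coord (Y n t) m) \<longlonglongrightarrow> coord (h t) m)"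
proof -
  have "AE t in M. \<forall>n. Y n t \<in> hull_at t" using hull_selectionsD(2)[OF Y] by (simp add: AE_all_countable)
  then have good: "AE t in M. (\<forall>n. Y n t \<in> hull_at t) \<and> (\<forall>m. convergent (\<lambda>n. coord (Y n t) m))"
    using conv by eventually_elim simp
  from AE_E3[OF good] obtain N where N: "N \<in> null_sets M"
    "\<And>t. t \<in> space M - N \<Longrightarrow> (\<forall>n. Y n t \<in> hull_at t) \<and> (\<forall>m. convergent (\<lambda>n. coord (Y n t) m))"
    by auto
  have ex: "\<exists>u. u \<in> hull_at t \<and> (\<forall>m. (\<lambda>n. coord (Y n t) m) \<longlonglongrightarrow> coord u m)" if t: "t \<in> space M" "t \<notin> N" for t
  proof -
    have lim: "(\<lambda>n. coord (Y n t) m) \<longlonglongrightarrow> lim (\<lambda>n. coord (Y n t) m)" for m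
      using N(2)[of t] t by (simp add: convergent_LIMSEQ_iff)
    have Yt: "Y n t \<in> hull_at t" for n using N(2)[of t] t by blast
    obtain u where u: "coord u = (\<lambda>m. lim (\<lambda>n. coord (Y n t) m))"
      using coord_limit[of "\<lambda>n. Y n t", OF norm_hull_at_le[OF t(1) Yt] lim] by blast
    have lim_u: "(\<lambda>n. coord (Y n t) m) \<longlonglongrightarrow> coord u m" for m using lim u by simp
    have "u \<in> hull_at t" by (rule hull_closedI[OF norm_\<Gamma>_le[OF t(1)] Yt lim_u])
    then show ?thesis using lim_u by blast
  qed
  \<comment> \<open>The value 0 on the exceptional set matches the indicator that multiplies
    \<open>Y n\<close> in the measurability proof below.\<close>
  define h where "h t = (if t \<in> space M - N then SOME u. u \<in> hull_at t \<and> (\<forall>m. (\<lambda>n. coord (Y n t) m) \<longlonglongrightarrow> coord u m) else 0)" for t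
  have h: "h t \<in> hull_at t" "(\<lambda>n. coord (Y n t) m) \<longlonglongrightarrow> coord (h t) m" if t: "t \<in> space M" "t \<notin> N" for t m
  proof -
    have "h t \<in> hull_at t \<and> (\<forall>m. (\<lambda>n. coord (Y n t) m) \<longlonglongrightarrow> coord (h t) m)"
      using someI_ex[OF ex[OF t]] t by (simp add: h_def)
    then show "h t \<in> hull_at t" "(\<lambda>n. coord (Y n t) m) \<longlonglongrightarrow> coord (h t) m" by auto
  qed
  have "weak_star_scalarly_measurable M h"
    unfolding weak_star_scalarly_measurable_iff
  proof
    fix m
    show "(\<lambda>t. coord (h t) m) \<in> borel_measurable M"
    proof (rule borel_measurable_LIMSEQ_real)
      show "(\<lambda>t. indicator (space M - N) t * coord (Y n t) m) \<in> borel_measurable M" for n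
        using N(1) by (intro borel_measurable_times borel_measurable_indicator
            measurable_coord_apply[OF hull_selectionsD(1)[OF Y]]) auto
      fix t assume t: "t \<in> space M"
      show "(\<lambda>n. indicator (space M - N) t * coord (Y n t) m) \<longlonglongrightarrow> coord (h t) m"
        using h(2)[OF t] t by (cases "t \<in> N") (auto simp: h_def)
    qed
  qed
  moreover have AEN: "AE t in M. t \<notin> N" using N(1) by (rule AE_not_in)
  have hK: "AE t in M. h t \<in> hull_at t"
    using AEN AE_space by eventually_elim (rule h(1))
  moreover have AE_lim: "AE t in M. (\<forall>n. norm (Y n t) \<le> \<phi> t) \<and> (\<forall>m. (\<lambda>n. coord (Y n t) m) \<longlonglongrightarrow> coord (h t) m)"
    using AEN AE_space 
  proof eventually_elim
    case (elim t)
    then show ?case using h(2)[of t] N(2)[of t] norm_hull_at_le[of t] by auto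
  qed
  moreover have "(\<integral>t. blinfun_apply (h t) x \<partial>M) = blinfun_apply y x" for x
  proof -
    have "(\<lambda>n. \<integral>t. blinfun_apply (Y n t) x \<partial>M) \<longlonglongrightarrow> (\<integral>t. blinfun_apply (h t) x \<partial>M)"
    proof (rule integral_dominated_convergence)
      show "integrable M (\<lambda>t. \<phi> t * norm x)" using integrable_\<phi> by simp
      show "(\<lambda>t. blinfun_apply (h t) x) \<in> borel_measurable M"
        using \<open>weak_star_scalarly_measurable M h\<close> by (simp add: weak_star_scalarly_measurable_def)
      show "(\<lambda>t. blinfun_apply (Y n t) x) \<in> borel_measurable M" for n
        using hull_selectionsD(1)[OF Y] by (simp add: weak_star_scalarly_measurable_def)
      show "AE t in M. (\<lambda>n. blinfun_apply (Y n t) x) \<longlonglongrightarrow> blinfun_apply (h t) x"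
        using AE_lim
      proof eventually_elim
        case (elim t)
        then have "limitin weak_star (\<lambda>n. Y n t) (h t) sequentially"
          by (intro coord_limit_weak_star(1)) auto
        then show ?case by (simp add: limitin_weak_star_iff)
      qed
      show "AE t in M. norm (blinfun_apply (Y n t) x) \<le> \<phi> t * norm x" for n
        using AE_lim
      proof eventually_elim
        case (elim t)
        have "norm (blinfun_apply (Y n t) x) \<le> norm (Y n t) * norm x" by (rule norm_blinfun)
        also have "\<dots> \<le> \<phi> t * norm x" using elim by (intro mult_right_mono) auto
        finally show ?case .
      qed
    qed
    then have "(\<lambda>n::nat. blinfun_apply y x) \<longlonglongrightarrow> (\<integral>t. blinfun_apply (h t) x \<partial>M)"
      unfolding hull_selectionsD(3)[OF Y] .
    from LIMSEQ_unique[OF this tendsto_const] show ?thesis .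
  qed
  ultimately show ?thesis by (intro bexI[of _ h]) (simp_all add: hull_selections_def)
qed

text \<open>Weighted by 2^n, the energies of the increments still sum to a finite value. So the
  weighted densities are summable almost everywhere, which makes the increments of each coordinate
  absolutely summable.\<close>

lemma AE_convergent_of_energy_Cauchy:
  assumes Y: "\<And>n. dominated 1 (Y n)"
    and small: "\<And>n. energy (\<lambda>t. Y (Suc n) t - Y n t) \<le> (1 / 4) ^ n"
  shows "AE t in M. \<forall>m. convergent (\<lambda>n. coord (Y n t) m)"
proof -
  define D where "D n t = energy_at t (Y (Suc n) t - Y n t)" for n t
  have D_nonneg: "0 \<le> D n t" for n t unfolding D_def energy_at_def using inner_dual_self_nonneg by simp
  have D_int: "integrable M (D n)" for n
    unfolding D_def[abs_def] by (rule integrable_energy[OF dominated_add(2)[OF Y Y]])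
  have "(\<integral>\<^sup>+t. (\<Sum>n. ennreal (2 ^ n * D n t)) \<partial>M) = (\<Sum>n. \<integral>\<^sup>+t. ennreal (2 ^ n * D n t) \<partial>M)"
    using D_int by (intro nn_integral_suminf) auto
  also have "\<dots> \<le> (\<Sum>n. ennreal ((1 / 2) ^ n))"
  proof (intro suminf_le)
    fix n
    have "(\<integral>\<^sup>+t. ennreal (2 ^ n * D n t) \<partial>M) = ennreal (\<integral>t. 2 ^ n * D n t \<partial>M)"
      using D_int D_nonneg by (intro nn_integral_eq_integral) auto
    also have "(\<integral>t. 2 ^ n * D n t \<partial>M) = 2 ^ n * energy (\<lambda>t. Y (Suc n) t - Y n t)"
      by (simp add: D_def energy_def)
    also have "\<dots> \<le> 2 ^ n * (1 / 4) ^ n" by (intro mult_left_mono small) auto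
    also have "\<dots> = (1 / 2) ^ n" by (simp flip: power_mult_distrib)
    finally show "(\<integral>\<^sup>+t. ennreal (2 ^ n * D n t) \<partial>M) \<le> ennreal ((1 / 2) ^ n)"
      by (simp add: ennreal_leI)
  qed auto
  also have "\<dots> < \<infinity>"
    by (subst suminf_ennreal2) (auto intro!: summable_geometric simp: less_top[symmetric])
  finally have "AE t in M. (\<Sum>n. ennreal (2 ^ n * D n t)) \<noteq> \<infinity>"
    using D_int by (intro nn_integral_PInf_AE) (auto intro!: borel_measurable_suminf)
  then show ?thesis
    using AE_space
  proof eventually_elim
    case (elim t)
    have sum_D: "summable (\<lambda>n. 2 ^ n * D n t)"
      using elim D_nonneg by (intro summable_suminf_not_top) auto
    show ?case
    proof
      fix m
      let ?a = "\<lambda>n. coord (Y (Suc n) t) m - coord (Y n t) m"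
      have pos: "(1 + \<phi> t)\<^sup>2 > 0" using \<phi>_nonneg[OF elim(2)] by (simp add: add_pos_nonneg)
      have "summable (\<lambda>n. (1 / 2 :: real) ^ n + (1 + \<phi> t)\<^sup>2 * (2 ^ n * D n t))"
        by (intro summable_add summable_mult sum_D summable_geometric) simp
      moreover have "norm (?a n) \<le> (1 / 2) ^ n + (1 + \<phi> t)\<^sup>2 * (2 ^ n * D n t)" for n
      proof -
        have "(?a n)\<^sup>2 \<le> (1 + \<phi> t)\<^sup>2 * D n t"
          using coord_square_le[of "Y (Suc n) t - Y n t" m] pos by (simp add: D_def energy_at_def)
        then have "2 ^ n * (?a n)\<^sup>2 \<le> 2 ^ n * ((1 + \<phi> t)\<^sup>2 * D n t)" by (intro mult_left_mono) auto
        \<comment> \<open>Either the increment is at most 2^-n, or 2^n times its modulus is at least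
          1 and the quadratic term dominates. This trades squares for first powers.\<close>
        moreover have "\<bar>?a n\<bar> \<le> (1 / 2) ^ n + 2 ^ n * (?a n)\<^sup>2"
        proof (cases "\<bar>?a n\<bar> \<le> (1 / 2) ^ n")
          case True
          then show ?thesis by (rule order_trans) simp
        next
          case False
          then have "1 \<le> 2 ^ n * \<bar>?a n\<bar>"
            using mult_left_mono[of "(1 / 2) ^ n" "\<bar>?a n\<bar>" "2 ^ n"] by (simp add: power_divide)
          then have "\<bar>?a n\<bar> * 1 \<le> \<bar>?a n\<bar> * (2 ^ n * \<bar>?a n\<bar>)" by (intro mult_left_mono) auto
          also have "\<dots> = 2 ^ n * (\<bar>?a n\<bar> * \<bar>?a n\<bar>)" by (simp add: mult.left_commute)
          also have "\<bar>?a n\<bar> * \<bar>?a n\<bar> = (?a n)\<^sup>2" by (simp add: power2_eq_square)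
          finally show ?thesis by (smt (verit) zero_le_power zero_le_divide_1_iff)
        qed
        moreover have "(1 + \<phi> t)\<^sup>2 * (2 ^ n * D n t) = 2 ^ n * ((1 + \<phi> t)\<^sup>2 * D n t)" by (rule mult.left_commute)
        ultimately show ?thesis unfolding real_norm_def by linarith
      qed
      ultimately have "summable ?a" by (intro summable_comparison_test[of ?a]) auto
      then have "convergent (\<lambda>n. \<Sum>i<n. ?a i)" by (simp add: summable_iff_convergent)
      then have "convergent (\<lambda>n. coord (Y n t) m - coord (Y 0 t) m)" 
        using sum_lessThan_telescope[of "\<lambda>n. coord (Y n t) m"] by simp
      then have "convergent (\<lambda>n. (coord (Y n t) m - coord (Y 0 t) m) + coord (Y 0 t) m)"
        by (intro convergent_add convergent_const)
      then show "convergent (\<lambda>n. coord (Y n t) m)" by simp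
    qed
  qed
qed

text \<open>Completeness in the form that \<open>smooth_variational_principle\<close> asks for;
  small consecutive increments suffice.\<close>

lemma hull_selections_complete:
  assumes Y: "\<And>n. Y n \<in> hull_selections y"
    and small: "\<And>n. energy (\<lambda>t. Y (Suc n) t - Y n t) \<le> (1 / 4) ^ n"
  shows "\<exists>h\<in>hull_selections y. (\<lambda>n. energy (Y n)) \<longlonglongrightarrow> energy h \<and>
    (\<forall>g\<in>hull_selections y. (\<lambda>n. energy (\<lambda>t. Y n t - g t)) \<longlonglongrightarrow> energy (\<lambda>t. h t - g t))"
proof -
  obtain h where h: "h \<in> hull_selections y"
    "AE t in M. (\<forall>n. norm (Y n t) \<le> \<phi> t) \<and> (\<forall>m. (\<lambda>n. coord (Y n t) m) \<longlonglongrightarrow> coord (h t) m)"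
    using hull_selections_limit[OF Y AE_convergent_of_energy_Cauchy[OF hull_selectionsD(5)[OF Y] small]] by blast
  have "(\<lambda>n. energy (Y n)) \<longlonglongrightarrow> energy h"
    by (rule energy_tendsto[where k = 1]) (use h hull_selectionsD(1) Y in auto)
  moreover have "(\<lambda>n. energy (\<lambda>t. Y n t - g t)) \<longlonglongrightarrow> energy (\<lambda>t. h t - g t)" if g: "g \<in> hull_selections y" for g
  proof (rule energy_tendsto[where k = 2])
    show "weak_star_scalarly_measurable M (\<lambda>t. Y n t - g t)" for n
      using dominated_add(2)[OF hull_selectionsD(5)[OF Y] hull_selectionsD(5)[OF g]] by (simp add: dominated_def)
    show "weak_star_scalarly_measurable M (\<lambda>t. h t - g t)"
      using dominated_add(2)[OF hull_selectionsD(5)[OF h(1)] hull_selectionsD(5)[OF g]] by (simp add: dominated_def)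
    show "AE t in M. (\<forall>n. norm (Y n t - g t) \<le> 2 * \<phi> t) \<and>
        (\<forall>m. (\<lambda>n. coord (Y n t - g t) m) \<longlonglongrightarrow> coord (h t - g t) m)"
      using h(2) hull_selectionsD(4)[OF g]
    proof eventually_elim
      case (elim t)
      have "norm (Y n t - g t) \<le> 2 * \<phi> t" for n
        using norm_triangle_ineq4[of "Y n t" "g t"] elim(1)[THEN conjunct1, rule_format, of n] elim(2) by linarith
      then show ?case using elim by (auto intro!: tendsto_diff)
    qed
  qed
  ultimately show ?thesis using h(1) by blast
qed

text \<open>Saturation gives orthogonality to the countably many coordinates; density of the
  multiples of the \<open>z m\<close> extends it to every \<open>x\<close>.\<close>

lemma orthogonal_perturbation:
  fixes w :: "'a \<Rightarrow> ('e \<Rightarrow>\<^sub>L real)"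
  assumes A: "A \<in> sets M" "measure M A > 0"
    and w: "weak_star_scalarly_measurable M w" "AE t in M. norm (w t) \<le> \<phi> t"
  shows "\<exists>\<psi> \<in> borel_measurable M. (\<forall>t. \<bar>\<psi> t\<bar> \<le> (1::real)) \<and> (\<forall>t. t \<notin> A \<longrightarrow> \<psi> t = 0) \<and>
    \<not> (AE t in M. \<psi> t = 0) \<and> (\<forall>x. (\<integral>t. blinfun_apply (\<psi> t *\<^sub>R w t) x \<partial>M) = 0)"
proof -
  have "integrable M (\<lambda>t. coord (w t) m)" for m
    unfolding coord_def by (rule integrable_apply[OF w])
  from saturated_exists_orthogonal[where u = "\<lambda>m t. coord (w t) m", OF finite_measure_axioms saturated A this]
  obtain \<psi> where \<psi>: "\<psi> \<in> borel_measurable M" "\<forall>t. \<bar>\<psi> t\<bar> \<le> (1::real)" "\<forall>t. t \<notin> A \<longrightarrow> \<psi> t = 0"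
    "\<not> (AE t in M. \<psi> t = 0)" "\<forall>m. (\<integral>t. \<psi> t * coord (w t) m \<partial>M) = 0" by auto
  let ?v = "\<lambda>t. \<psi> t *\<^sub>R w t"
  have v: "weak_star_scalarly_measurable M ?v"
    using \<psi>(1) w(1) unfolding weak_star_scalarly_measurable_iff by (auto intro!: borel_measurable_times)
  have v_le: "AE t in M. norm (?v t) \<le> \<phi> t"
    using w(2)
  proof eventually_elim
    case (elim t)
    have "\<bar>\<psi> t\<bar> * norm (w t) \<le> 1 * norm (w t)" using \<psi>(2) by (intro mult_right_mono) auto
    then show ?case using elim by simp
  qed
  have int: "integrable M (\<lambda>t. blinfun_apply (?v t) x)" for x by (rule integrable_apply[OF v v_le])
  have "(\<integral>t. blinfun_apply (?v t) x \<partial>M) = 0" for x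
  proof -
    \<comment> \<open>\<open>\<phi>\<close> bounds the perturbation, so approximating
      \<open>x\<close> within e/(I+1) changes the integral by at most e; the summand 1 covers I =
      0.\<close>
    define I where "I = (\<integral>t. \<phi> t \<partial>M)"
    have I: "0 \<le> I" unfolding I_def by (intro integral_nonneg_AE AE_I2 \<phi>_nonneg)
    have "\<bar>\<integral>t. blinfun_apply (?v t) x \<partial>M\<bar> \<le> 0 + e" if e: "e > 0" for e
    proof -
      have "e / (I + 1) > 0" using e I by simp
      then obtain m c where c: "norm (x - c *\<^sub>R z m) < e / (I + 1)" using dense_z by blast
      have "(\<integral>t. blinfun_apply (?v t) (z m) \<partial>M) = 0"
        using \<psi>(5) by (simp add: blinfun.scaleR_left coord_def)
      moreover have "blinfun_apply (?v t) x = blinfun_apply (?v t) (x - c *\<^sub>R z m) + c * blinfun_apply (?v t) (z m)" for t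
        by (simp only: blinfun.diff_right blinfun.scaleR_right) simp
      ultimately have "(\<integral>t. blinfun_apply (?v t) x \<partial>M) = (\<integral>t. blinfun_apply (?v t) (x - c *\<^sub>R z m) \<partial>M)"
        using int by (simp only: Bochner_Integration.integral_add Bochner_Integration.integrable_mult_right integral_mult_right_zero)
      also have "\<bar>\<dots>\<bar> \<le> (\<integral>t. \<bar>blinfun_apply (?v t) (x - c *\<^sub>R z m)\<bar> \<partial>M)" by (rule integral_abs_bound)
      also have "\<dots> \<le> (\<integral>t. \<phi> t * (e / (I + 1)) \<partial>M)"
      proof (rule integral_mono_AE)
        show "AE t in M. \<bar>blinfun_apply (?v t) (x - c *\<^sub>R z m)\<bar> \<le> \<phi> t * (e / (I + 1))"
          using v_le AE_space
        proof eventually_elim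
          case (elim t)
          have "\<bar>blinfun_apply (?v t) (x - c *\<^sub>R z m)\<bar> \<le> norm (?v t) * norm (x - c *\<^sub>R z m)"
            using norm_blinfun[of "?v t" "x - c *\<^sub>R z m"] by simp
          also have "\<dots> \<le> \<phi> t * (e / (I + 1))"
            using elim c \<phi>_nonneg by (intro mult_mono) auto
          finally show ?case .
        qed
      qed (use int integrable_\<phi> in auto)
      also have "\<dots> = I * (e / (I + 1))" using integrable_\<phi> by (simp add: I_def)
      also have "\<dots> \<le> (I + 1) * (e / (I + 1))" using e I by (intro mult_right_mono) auto
      also have "\<dots> = e" using I by (simp add: add_nonneg_eq_0_iff)
      finally show ?thesis by simp
    qed
    then have "\<bar>\<integral>t. blinfun_apply (?v t) x \<partial>M\<bar> \<le> 0" by (rule field_le_epsilon)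
    then show ?thesis by simp
  qed
  then show ?thesis using \<psi> by blast
qed

lemma hull_selections_perturb:
  assumes h: "h \<in> hull_selections y"
    and w: "weak_star_scalarly_measurable M w" "AE t in M. norm (w t) \<le> \<phi> t"
    and hw: "AE t in M. h t + w t \<in> hull_at t \<and> h t - w t \<in> hull_at t"
    and \<psi>: "\<psi> \<in> borel_measurable M" "\<And>t. \<bar>\<psi> t\<bar> \<le> (1::real)"
    and orth: "\<And>x. (\<integral>t. blinfun_apply (\<psi> t *\<^sub>R w t) x \<partial>M) = 0"
  shows "(\<lambda>t. h t + \<psi> t *\<^sub>R w t) \<in> hull_selections y"
proof -
  have v: "weak_star_scalarly_measurable M (\<lambda>t. \<psi> t *\<^sub>R w t)"
    using \<psi>(1) w(1) unfolding weak_star_scalarly_measurable_iff by (auto intro!: borel_measurable_times)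
  have v_le: "AE t in M. norm (\<psi> t *\<^sub>R w t) \<le> \<phi> t"
    using w(2)
  proof eventually_elim
    case (elim t)
    have "\<bar>\<psi> t\<bar> * norm (w t) \<le> 1 * norm (w t)" using \<psi>(2) by (intro mult_right_mono) auto
    then show ?case using elim by simp
  qed
  have "weak_star_scalarly_measurable M (\<lambda>t. h t + \<psi> t *\<^sub>R w t)"
    using hull_selectionsD(1)[OF h] v unfolding weak_star_scalarly_measurable_iff
    by (auto intro!: borel_measurable_add)
  moreover have "AE t in M. h t + \<psi> t *\<^sub>R w t \<in> hull_at t"
    using hw AE_space
  proof eventually_elim
    case (elim t)
    \<comment> \<open>\<open>h t + \<psi> t *\<^sub>R w t\<close> as a convex combination of
      \<open>h t + w t\<close> and \<open>h t - w t\<close>; the weights are nonnegative because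
      \<open>\<bar>\<psi> t\<bar> \<le> 1\<close>.\<close>
    have "((1 + \<psi> t) / 2) *\<^sub>R (h t + w t) + ((1 - \<psi> t) / 2) *\<^sub>R (h t - w t) \<in> hull_at t"
      using elim \<psi>(2)[of t] by (intro convexD[OF convex_hull_at]) (auto simp: abs_le_iff simp flip: add_divide_distrib)
    also have "((1 + \<psi> t) / 2) *\<^sub>R (h t + w t) + ((1 - \<psi> t) / 2) *\<^sub>R (h t - w t) =
      ((1 + \<psi> t) / 2 + (1 - \<psi> t) / 2) *\<^sub>R h t + ((1 + \<psi> t) / 2 - (1 - \<psi> t) / 2) *\<^sub>R w t"
      by (simp only: scaleR_add_left scaleR_diff_left scaleR_add_right scaleR_diff_right) simp
    also have "\<dots> = h t + \<psi> t *\<^sub>R w t"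
      by (simp flip: add_divide_distrib diff_divide_distrib)
    finally show ?case .
  qed
  moreover have "(\<integral>t. blinfun_apply (h t + \<psi> t *\<^sub>R w t) x \<partial>M) = blinfun_apply y x" for x
    using integrable_apply[OF hull_selectionsD(1,4)[OF h], of x] integrable_apply[OF v v_le, of x] orth[of x] hull_selectionsD(3)[OF h]
    by (simp only: blinfun.add_left Bochner_Integration.integral_add)
  ultimately show ?thesis by (simp add: hull_selections_def)
qed

lemma energy_eq_0D:
  assumes v: "dominated k v" and e: "energy v \<le> 0"
  shows "AE t in M. v t = 0"
proof -
  have "energy v = 0" using e energy_nonneg[of v] by simp
  then have "AE t in M. energy_at t (v t) = 0"
    unfolding energy_def
    using integral_nonneg_eq_0_iff_AE[OF integrable_energy[OF v]] inner_dual_self_nonneg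
    by (simp add: energy_at_def)
  then show ?thesis
    using AE_space
  proof eventually_elim
    case (elim t)
    have "(1 + \<phi> t)\<^sup>2 \<noteq> 0" using \<phi>_nonneg[OF elim(2)] by (simp add: add_nonneg_eq_0_iff)
    then have "inner_dual (v t) (v t) = 0" using elim(1) by (simp add: energy_at_def)
    then show ?case by (simp add: inner_dual_self_eq_0)
  qed
qed

text \<open>The variational principle replaces the existence of an extreme point of the convex set
  \<open>hull_selections y\<close>: at most half of the energy is lost in the perturbation, so the
  maximised functional is still strictly convex.\<close>

theorem extreme_hull_selection:
  assumes f: "f \<in> hull_selections y"
  shows "\<exists>h\<in>hull_selections y. AE t in M. h t extreme_point_of hull_at t"
proof -
  let ?X = "hull_selections y"
  define d where "d g h = energy (\<lambda>t. g t - h t)" for g h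
  define \<mu> where "\<mu> = measure M (space M)"
  have diff_dom: "dominated (1 + 1) (\<lambda>t. g t - h t)" if "g \<in> ?X" "h \<in> ?X" for g h
    using dominated_add(2) hull_selectionsD(5) that by blast
  have d_nonneg: "0 \<le> d g h" for g h unfolding d_def by (rule energy_nonneg)
  have d_bound: "d g h \<le> 2 * (1 + 1)\<^sup>2 * \<mu>" if "g \<in> ?X" "h \<in> ?X" for g h
    unfolding d_def \<mu>_def by (rule energy_le[OF diff_dom[OF that]])
  have "\<exists>h\<in>?X. \<exists>Y. (\<forall>n. Y n \<in> ?X) \<and> (\<forall>g\<in>?X.
    energy g - (\<Sum>n. (1 / 2) ^ (n + 2) * d g (Y n)) \<le> energy h - (\<Sum>n. (1 / 2) ^ (n + 2) * d h (Y n)))"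
  proof (rule smooth_variational_principle[where d = d and \<Phi> = energy, OF f])
    show "0 \<le> d g h" for g h by (rule d_nonneg)
    show "d g h \<le> 2 * (1 + 1)\<^sup>2 * \<mu>" if "g \<in> ?X" "h \<in> ?X" for g h using that by (rule d_bound)
    show "d g g = 0" for g by (simp add: d_def energy_def energy_at_def inner_dual_def)
    show "energy g \<le> 2 * 1\<^sup>2 * \<mu>" if "g \<in> ?X" for g
      unfolding \<mu>_def using hull_selectionsD(5)[OF that] by (rule energy_le)
    fix Y assume Y: "\<And>n. Y n \<in> ?X" and small: "\<And>m n. n \<le> m \<Longrightarrow> d (Y m) (Y n) \<le> (1 / 4) ^ n"
    have "energy (\<lambda>t. Y (Suc n) t - Y n t) \<le> (1 / 4) ^ n" for n using small[of n "Suc n"] by (simp add: d_def)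
    from hull_selections_complete[OF Y this]
    show "\<exists>h\<in>?X. (\<lambda>n. energy (Y n)) \<longlonglongrightarrow> energy h \<and> (\<forall>x\<in>?X. (\<lambda>n. d (Y n) x) \<longlonglongrightarrow> d h x)"
      unfolding d_def .
  qed
  then obtain h Y where h: "h \<in> ?X" and Y: "\<And>n. Y n \<in> ?X"
    and max: "\<And>g. g \<in> ?X \<Longrightarrow>
      energy g - (\<Sum>n. (1 / 2) ^ (n + 2) * d g (Y n)) \<le> energy h - (\<Sum>n. (1 / 2) ^ (n + 2) * d h (Y n))"
    by auto
  have "AE t in M. h t extreme_point_of hull_at t"
  proof (rule ccontr)
    assume ne: "\<not> (AE t in M. h t extreme_point_of hull_at t)"
    obtain A w where A: "A \<in> sets M" "measure M A > 0" and w: "weak_star_scalarly_measurable M w"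
      and off: "\<And>t. t \<notin> A \<Longrightarrow> w t = 0"
      and on: "\<And>t. t \<in> A \<Longrightarrow> w t \<noteq> 0 \<and> h t + w t \<in> hull_at t \<and> h t - w t \<in> hull_at t"
      using nonextreme_selection[OF hull_selectionsD(1,2)[OF h] ne] by auto
    have hw: "AE t in M. h t + w t \<in> hull_at t \<and> h t - w t \<in> hull_at t"
      using hull_selectionsD(2)[OF h]
    proof eventually_elim
      case (elim t)
      then show ?case using on[of t] off[of t] by (cases "t \<in> A") auto
    qed
    have w_le: "AE t in M. norm (w t) \<le> \<phi> t"
      using hw AE_space
    proof eventually_elim
      case (elim t)
      have "norm ((h t + w t) - (h t - w t)) \<le> norm (h t + w t) + norm (h t - w t)"
        by (rule norm_triangle_ineq4)
      also have "\<dots> \<le> \<phi> t + \<phi> t" using elim by (intro add_mono norm_hull_at_le) auto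
      also have "(h t + w t) - (h t - w t) = 2 *\<^sub>R w t" by (simp add: scaleR_2)
      finally show ?case by simp
    qed
    obtain \<psi> where \<psi>: "\<psi> \<in> borel_measurable M" "\<And>t. \<bar>\<psi> t\<bar> \<le> (1::real)" "\<And>t. t \<notin> A \<Longrightarrow> \<psi> t = 0"
      "\<not> (AE t in M. \<psi> t = 0)" "\<And>x. (\<integral>t. blinfun_apply (\<psi> t *\<^sub>R w t) x \<partial>M) = 0"
      using orthogonal_perturbation[OF A w w_le] by auto
    define v where "v t = \<psi> t *\<^sub>R w t" for t
    have plus: "(\<lambda>t. h t + v t) \<in> ?X"
      unfolding v_def by (rule hull_selections_perturb[OF h w w_le hw \<psi>(1,2,5)])
    have minus: "(\<lambda>t. h t - v t) \<in> ?X"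
    proof -
      have "(\<lambda>t. h t + (- \<psi> t) *\<^sub>R w t) \<in> ?X"
      proof (rule hull_selections_perturb[OF h w w_le hw])
        show "(\<lambda>t. - \<psi> t) \<in> borel_measurable M" using \<psi>(1) by simp
        show "(\<integral>t. blinfun_apply ((- \<psi> t) *\<^sub>R w t) x \<partial>M) = 0" for x
          using \<psi>(5)[of x] by (simp add: blinfun.minus_left)
      qed (simp add: \<psi>(2))
      then show ?thesis by (simp add: v_def)
    qed
    have v_dom: "dominated 1 v"
      unfolding dominated_def
    proof
      show "weak_star_scalarly_measurable M v"
        using \<psi>(1) w unfolding v_def weak_star_scalarly_measurable_iff by (auto intro!: borel_measurable_times)
      show "AE t in M. norm (v t) \<le> 1 * \<phi> t"
        using w_le
      proof eventually_elim
        case (elim t)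
        have "\<bar>\<psi> t\<bar> * norm (w t) \<le> 1 * norm (w t)" using \<psi>(2) by (intro mult_right_mono) auto
        then show ?case using elim by (simp add: v_def)
      qed
    qed
    have par: "energy (\<lambda>t. h t + v t) + energy (\<lambda>t. h t - v t) = 2 * energy h + 2 * energy v"
      by (rule energy_parallelogram[OF hull_selectionsD(5)[OF h] v_dom])
    \<comment> \<open>Subtracting \<open>Y n\<close> shifts the centre of the pair from
      \<open>h\<close> to \<open>h - Y n\<close>, so every penalty term also obeys the parallelogram
      law with the same \<open>v\<close>.\<close>
    have par_d: "d (\<lambda>t. h t + v t) (Y n) + d (\<lambda>t. h t - v t) (Y n) = 2 * d h (Y n) + 2 * energy v" for n
      using energy_parallelogram[OF diff_dom[OF h Y] v_dom, of n]
      by (simp add: d_def algebra_simps)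
    define q where "q g = (\<Sum>n. (1 / 2) ^ (n + 2) * d g (Y n))" for g
    have sm: "summable (\<lambda>n. (1 / 2) ^ (n + 2) * d g (Y n))" if g: "g \<in> ?X" for g
    proof (rule summable_comparison_test)
      show "summable (\<lambda>n. (1 / 2) ^ (n + 2) * (2 * (1 + 1)\<^sup>2 * \<mu>))"
        unfolding power_add by (intro summable_mult2 summable_geometric) simp
      have "norm ((1 / 2) ^ (n + 2) * d g (Y n)) \<le> (1 / 2) ^ (n + 2) * (2 * (1 + 1)\<^sup>2 * \<mu>)" for n
        unfolding norm_mult using d_bound[OF g Y[of n]] d_nonneg[of g "Y n"] by (intro mult_mono) auto
      then show "\<exists>N. \<forall>n\<ge>N. norm ((1 / 2) ^ (n + 2) * d g (Y n)) \<le> (1 / 2) ^ (n + 2) * (2 * (1 + 1)\<^sup>2 * \<mu>)" by blast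
    qed
    have geo: "(\<lambda>n. (1 / 2 :: real) ^ (n + 2)) sums (1 / 2)"
      using sums_mult[OF geometric_sums[of "1 / 2 :: real"], of "1 / 4"] by (simp add: power_add)
    have "q (\<lambda>t. h t + v t) + q (\<lambda>t. h t - v t) = (\<Sum>n. 2 * ((1 / 2) ^ (n + 2) * d h (Y n)) + (1 / 2) ^ (n + 2) * (2 * energy v))"
      unfolding q_def suminf_add[OF sm[OF plus] sm[OF minus]] distrib_left[symmetric] par_d
      by (simp add: distrib_left mult.left_commute)
    also have "\<dots> = 2 * q h + 1 / 2 * (2 * energy v)"
    proof -
      have "(\<lambda>n. 2 * ((1 / 2) ^ (n + 2) * d h (Y n)) + (1 / 2) ^ (n + 2) * (2 * energy v)) sums (2 * q h + 1 / 2 * (2 * energy v))"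
        unfolding q_def by (intro sums_add sums_mult sums_mult2 geo summable_sums sm[OF h])
      then show ?thesis by (rule sums_unique[symmetric])
    qed
    finally have "q (\<lambda>t. h t + v t) + q (\<lambda>t. h t - v t) = 2 * q h + energy v" by simp
    \<comment> \<open>Adding the maximality inequalities at \<open>h + v\<close> and
      \<open>h - v\<close>: the parallelogram law contributes twice \<open>energy v\<close>, the
      penalties of total weight 1/2 take back one, and the remaining \<open>energy v\<close> must be
      at most 0.\<close>
    then have "energy v \<le> 0" using max[OF plus] max[OF minus] par unfolding q_def[symmetric] by linarith
    from energy_eq_0D[OF v_dom this] have "AE t in M. \<psi> t = 0"
    proof eventually_elim
      case (elim t)
      then show ?case using \<psi>(3)[of t] on[of t] by (cases "t \<in> A") (auto simp: v_def)
    qed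
    then show False using \<psi>(4) by blast
  qed
  then show ?thesis using h by blast
qed

end

lemma has_gelfand_integral_space_iff:
  "has_gelfand_integral M (space M) f y \<longleftrightarrow> weak_star_scalarly_measurable M f \<and>
    (\<forall>x. integrable M (\<lambda>t. blinfun_apply (f t) x) \<and> blinfun_apply y x = (\<integral>t. blinfun_apply (f t) x \<partial>M))"
proof -
  have "set_integrable M (space M) g \<longleftrightarrow> integrable M g" for g :: "'a \<Rightarrow> real"
    unfolding set_integrable_def by (intro Bochner_Integration.integrable_cong) auto
  moreover have "(LINT t:space M|M. g t) = (\<integral>t. g t \<partial>M)" for g :: "'a \<Rightarrow> real"
    unfolding set_lebesgue_integral_def by (intro Bochner_Integration.integral_cong) auto
  ultimately show ?thesis unfolding has_gelfand_integral_def by simp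
qed

lemma ex_dual_coordinates:
  assumes "separable_space (euclidean :: 'e::banach topology)"
  shows "\<exists>z :: nat \<Rightarrow> 'e. dual_coordinates z"
proof -
  obtain D :: "'e set" where D: "countable D" "closure D = UNIV"
    using assms unfolding separable_space_def by (auto simp: euclidean_closure_of)
  have "D \<noteq> {}" using D(2) by auto
  define x where "x = from_nat_into D"
  have x: "range x = D" unfolding x_def by (rule range_from_nat_into) fact+
  \<comment> \<open>The factor shrinks \<open>x m\<close> to norm at most 2^-m and is positive, so
    dividing by it recovers the dense sequence with a positive multiplier.\<close>
  define a where "a m = 1 / (2 ^ m * (1 + norm (x m)))" for m
  have a: "a m > 0" for m by (simp add: a_def add_pos_nonneg)
  have "dual_coordinates (\<lambda>m. a m *\<^sub>R x m)"
  proof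
    fix m
    have "norm (a m *\<^sub>R x m) = (1 / 2) ^ m * (norm (x m) / (1 + norm (x m)))"
      by (simp add: a_def power_divide abs_mult)
    also have "\<dots> \<le> (1 / 2) ^ m * 1"
      by (intro mult_left_mono) (auto simp: divide_le_eq add_nonneg_eq_0_iff add_pos_nonneg)
    finally show "norm (a m *\<^sub>R x m) \<le> (1 / 2) ^ m" by simp
  next
    fix e :: real and y :: 'e assume e: "e > 0"
    have "y \<in> closure D" using D(2) by simp
    then obtain u where "u \<in> D" "dist u y < e" using e unfolding closure_approachable by blast
    then obtain m where m: "dist (x m) y < e" using x by blast
    have "y - (1 / a m) *\<^sub>R (a m *\<^sub>R x m) = y - x m" using a[of m] by simp
    then have "norm (y - (1 / a m) *\<^sub>R (a m *\<^sub>R x m)) < e" using m by (simp add: dist_norm norm_minus_commute)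
    moreover have "0 < 1 / a m" using a[of m] by simp
    ultimately show "\<exists>m c. 0 < c \<and> norm (y - c *\<^sub>R (a m *\<^sub>R x m)) < e" by blast
  qed
  then show ?thesis by blast
qed

theorem theorem3p1:
  fixes M :: "'a measure"
    and \<Gamma> :: "'a \<Rightarrow> ('e::banach \<Rightarrow>\<^sub>L real) set"
  assumes "finite_measure M"
    and "complete_measure M"
    and "saturated M"
    and "separable_space (euclidean :: 'e topology)"
    and "multifunction M \<Gamma>"
    and "integrably_bounded M \<Gamma>"
    and "\<And>t. t \<in> space M \<Longrightarrow> closedin weak_star (\<Gamma> t)"
    and "gph M \<Gamma> \<in> sets (M \<Otimes>\<^sub>M borel_weak_star)"
  shows "multifunction_integral M \<Gamma> =
         multifunction_integral M (\<lambda>t. extreme_points (weak_star_closed_convex_hull (\<Gamma> t)))"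
proof -
  obtain z :: "nat \<Rightarrow> 'e" where z: "dual_coordinates z" using ex_dual_coordinates[OF assms(4)] by blast
  obtain \<phi> where \<phi>: "integrable M \<phi>" "\<And>t u. t \<in> space M \<Longrightarrow> u \<in> \<Gamma> t \<Longrightarrow> norm u \<le> \<phi> t"
    using assms(6) unfolding integrably_bounded_def by blast
  interpret dual_coordinates z by (rule z)
  interpret finite_measure M by (rule assms(1))
  interpret complete_measure M by (rule assms(2))
  interpret bounded_multifunction z M \<Gamma> \<phi>
    by unfold_locales (use assms \<phi> in auto)
  show ?thesis
  proof (intro subset_antisym subsetI)
    fix y assume "y \<in> multifunction_integral M \<Gamma>"
    then obtain f where f: "AE t in M. f t \<in> \<Gamma> t" "has_gelfand_integral M (space M) f y"
      unfolding multifunction_integral_def selector_def gelfand_integrable_def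
      using gelfand_integral_eqI by blast
    have "AE t in M. f t \<in> hull_at t"
      using f(1) by eventually_elim (use subset_hull_closed in blast)
    then have "f \<in> hull_selections y"
      using f(2) by (simp add: hull_selections_def has_gelfand_integral_space_iff)
    then obtain h where h: "h \<in> hull_selections y" "AE t in M. h t extreme_point_of hull_at t"
      using extreme_hull_selection by blast
    have "has_gelfand_integral M (space M) h y"
      unfolding has_gelfand_integral_space_iff
      using hull_selectionsD(1,3)[OF h(1)] integrable_apply[OF hull_selectionsD(1,4)[OF h(1)]] by simp
    moreover have "selector M (\<lambda>t. extreme_points (hull_at t)) h"
      using h(2) by (simp add: selector_def extreme_points_def)
    ultimately show "y \<in> multifunction_integral M (\<lambda>t. extreme_points (hull_at t))"
      unfolding multifunction_integral_def gelfand_integrable_def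
      using gelfand_integral_eqI by fastforce
  next
    fix y assume "y \<in> multifunction_integral M (\<lambda>t. extreme_points (hull_at t))"
    then obtain f where f: "AE t in M. f t extreme_point_of hull_at t"
      "gelfand_integrable M (space M) f" "y = gelfand_integral M (space M) f"
      unfolding multifunction_integral_def selector_def extreme_points_def by auto
    have "AE t in M. f t \<in> \<Gamma> t"
      using f(1) AE_space
    proof eventually_elim
      case (elim t)
      show ?case
        \<comment> \<open>The Milman-type inclusion at each \<open>t\<close>; the same function then
          serves as a selector of \<open>\<Gamma>\<close>, with the same integral.\<close>
        by (rule extreme_point_hull_closed_mem[OF assms(7) norm_\<Gamma>_le]) (use elim in auto)
    qed
    then show "y \<in> multifunction_integral M \<Gamma>"
      unfolding multifunction_integral_def selector_def using f(2,3) by blast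
  qed
qed

end
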